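(* $\mathrm{ZFC}$ interprets $\mathrm{SO}$; that is, there is a $\mathrm{ZFC}$-definable $L_{\mathrm{SO}}$-structure $\mathcal{A}$ such that $\mathrm{ZFC}\vdash \mathrm{SO}^{\mathcal{A}}$.
   Context: **The theory SO.** $L_{\mathrm{SO}}=\{\mathrm{Ord},\mathrm{SOrd},<,=,\in,\mathrm{G}\}$ is the first-order language with unary predicates $\mathrm{Ord}$ ("is an ordinal"), $\mathrm{SOrd}$ ("is a set of ordinals"), binary predicates $<,=,\in$ and a binary function symbol $\mathrm{G}$. Upper case letters $X,Y,P_i$ range over all objects, lower case Greek letters over objects satisfying $\mathrm{Ord}$, lower case Roman letters over objects satisfying $\mathrm{SOrd}$ (so $\forall\alpha\,\phi$ means $\forall\alpha(\mathrm{Ord}(\alpha)\to\phi)$, etc.). $\alpha\le\beta$ means $\alpha<\beta\lor\alpha=\beta$; $\exists^{=1}$ means "there is exactly one". $\max$ is the maximum with respect to $<$, and $(\alpha,\beta)<^*(\gamma,\delta)$ means: $\max(\alpha,\beta)<\max(\gamma,\delta)$, or the maxima are equal and $\alpha<\gamma$, or the maxima are equal and $\alpha=\gamma$ and $\beta<\delta$. The axioms of $\mathrm{SO}$ are: (SOR) $\forall X,Y\,((\mathrm{Ord}(X)\leftrightarrow\lnot\mathrm{SOrd}(X))\land(X<Y\to\mathrm{Ord}(X)\land\mathrm{Ord}(Y))\land(X\in Y\to\mathrm{Ord}(X)\land\mathrm{SOrd}(Y))\land\mathrm{Ord}(\mathrm{G}(X,Y)))$. (WO) $\forall\alpha,\beta,\gamma\,(\lnot\alpha<\alpha\land(\alpha<\beta\land\beta<\gamma\to\alpha<\gamma)\land(\alpha<\beta\lor\alpha=\beta\lor\beta<\alpha))\land\forall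 a(\exists\alpha(\alpha\in a)\to\exists\alpha(\alpha\in a\land\forall\beta(\beta<\alpha\to\lnot\beta\in a)))$. (INF) $\exists\alpha(\exists\beta(\beta<\alpha)\land\forall\beta(\beta<\alpha\to\exists\gamma(\beta<\gamma\land\gamma<\alpha)))$. (EXT) $\forall a,b(\forall\alpha(\alpha\in a\leftrightarrow\alpha\in b)\to a=b)$. (INI) $\forall\alpha\exists a\forall\beta(\beta<\alpha\leftrightarrow\beta\in a)$. (BOU) $\forall a\exists\alpha\forall\beta(\beta\in a\to\beta<\alpha)$. (GPF) $\forall\alpha,\beta,\gamma\,(\mathrm{G}(\beta,\gamma)\le\alpha\leftrightarrow\forall\delta,\epsilon((\delta,\epsilon)<^*(\beta,\gamma)\to\mathrm{G}(\delta,\epsilon)<\alpha))$. (SUR) $\forall\alpha\exists\beta,\gamma(\alpha=\mathrm{G}(\beta,\gamma))$. (SEP) for every $L_{\mathrm{SO}}$-formula $\phi(\alpha,P_1,\dots,P_n)$: $\forall P_1,\dots,P_n\forall a\exists b\forall\alpha(\alpha\in b\leftrightarrow\alpha\in a\land\phi(\alpha,P_1,\dots,P_n))$. (REP) for every $L_{\mathrm{SO}}$-formula $\phi(\alpha,\beta,P_1,\dots,P_n)$: $\forall P_1,\dots,P_n(\forall\xi,\zeta_1,\zeta_2(\phi(\xi,\zeta_1,\vec P)\land\phi(\xi,\zeta_2,\vec P)\to\zeta_1=\zeta_2)\to\forall a\exists b\forall\zeta(\zeta\in b\leftrightarrow\exists\xi\in a\,\phi(\xi,\zeta,\vec P)))$.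 (POW) $\forall a\exists b\forall z(\exists\alpha(\alpha\in z)\land\forall\alpha(\alpha\in z\to\alpha\in a)\to\exists^{=1}\xi\forall\beta(\beta\in z\leftrightarrow\mathrm{G}(\beta,\xi)\in b))$. **Interpretability.** Let $L_1,L_2$ be first-order languages and $T_1$ an $L_1$-theory. A $T_1$-definable $L_2$-structure $\mathcal{A}$ consists of $L_1$-formulas $\phi_u$ and $\phi_i$ for each non-logical symbol $i$ of $L_2$ and for $=$, such that: $\phi_u$ has exactly one free variable and $T_1\vdash\exists x\,\phi_u(x)$ (write $x\in U$ for $\phi_u(x)$); for an $n$-ary relation symbol $r$ (including $=$) $\phi_r$ has free variables $v_1,\dots,v_n$; for an $n$-ary function symbol $f$, $\phi_f$ has free variables $v_1,\dots,v_{n+1}$ and $T_1$ proves that for all $v_1,\dots,v_n\in U$ there is $v_{n+1}\in U$ with $\phi_f(v_1,\dots,v_{n+1})$, unique up to $\phi_=$; for a constant symbol $c$, $\phi_c$ has one free variable and $T_1$ proves that it is satisfied by an element of $U$, unique up to $\phi_=$; and $T_1$ proves that $\phi_=$ is on $U$ an equivalence relation respecting all relations and functions defined by the formulas of $\mathcal{A}$. For an $L_2$-formula $\psi$, $\psi^{\mathcal{A}}$ is the $L_1$-formula obtained by replacing each symbol (including $=$) by its defining formula (function terms being unravelled in the usual way by existential quantifiers over $U$) and restricting all quantifiers to $U$; $\Phi^{\mathcal{A}}=\{\phi^{\mathcal{A}}:\phi\in\Phi\}$. An $L_1$-theory $T_1$ interprets an $L_2$-theory $T_2$ iff there is a $T_1$-definable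 $L_2$-structure $\mathcal{A}$ with $T_1\vdash T_2^{\mathcal{A}}$. *)

theory Defs
  imports Main
begin

section \<open>First-order languages, formulas and provability\<close>

text \<open>
  A language is given by its sets of function and relation symbols with their arities; constants
  are nullary function symbols and equality is a logical symbol. The symbol sets are explicit
  because a language may have no function symbols, whereas HOL types are never empty.
\<close>

record ('f, 'r) language =
  funs :: "'f set"
  fun_arity :: "'f \<Rightarrow> nat"
  rels :: "'r set"
  rel_arity :: "'r \<Rightarrow> nat"

text \<open>Variables are de Bruijn indices.\<close>

datatype 'f tm = Var nat | Fun 'f "'f tm list"

datatype ('f, 'r) fm =
    Falsum (\<open>\<^bold>\<bottom>\<close>)
  | Equal "'f tm" "'f tm" (infix \<open>\<^bold>=\<close> 50)
  | Rel 'r "'f tm list"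
  | Imp "('f, 'r) fm" "('f, 'r) fm" (infixr \<open>\<^bold>\<longrightarrow>\<close> 25)
  | Forall "('f, 'r) fm"

abbreviation Neg (\<open>\<^bold>\<not> _\<close> [40] 40)
  where "\<^bold>\<not> \<phi> \<equiv> \<phi> \<^bold>\<longrightarrow> \<^bold>\<bottom>"
abbreviation And (infixr \<open>\<^bold>\<and>\<close> 35)
  where "\<phi> \<^bold>\<and> \<psi> \<equiv> \<^bold>\<not> (\<phi> \<^bold>\<longrightarrow> \<^bold>\<not> \<psi>)"
abbreviation Or (infixr \<open>\<^bold>\<or>\<close> 30)
  where "\<phi> \<^bold>\<or> \<psi> \<equiv> \<^bold>\<not> \<phi> \<^bold>\<longrightarrow> \<psi>"
abbreviation Iff (infix \<open>\<^bold>\<longleftrightarrow>\<close> 25)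
  where "\<phi> \<^bold>\<longleftrightarrow> \<psi> \<equiv> (\<phi> \<^bold>\<longrightarrow> \<psi>) \<^bold>\<and> (\<psi> \<^bold>\<longrightarrow> \<phi>)"
abbreviation Exists
  where "Exists \<phi> \<equiv> \<^bold>\<not> Forall (\<^bold>\<not> \<phi>)"

definition Conj :: "('f, 'r) fm list \<Rightarrow> ('f, 'r) fm"
  where "Conj \<phi>s = foldr And \<phi>s (\<^bold>\<not> \<^bold>\<bottom>)"

definition Foralls :: "nat \<Rightarrow> ('f, 'r) fm \<Rightarrow> ('f, 'r) fm"
  where "Foralls n = Forall ^^ n"

primrec wf_tm :: "('f, 'r) language \<Rightarrow> 'f tm \<Rightarrow> bool" where
  "wf_tm L (Var n) \<longleftrightarrow> True"
| "wf_tm L (Fun f ts) \<longleftrightarrow>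
     f \<in> funs L \<and> length ts = fun_arity L f \<and> list_all (wf_tm L) ts"

primrec wf_fm :: "('f, 'r) language \<Rightarrow> ('f, 'r) fm \<Rightarrow> bool" where
  "wf_fm L \<^bold>\<bottom> \<longleftrightarrow> True"
| "wf_fm L (s \<^bold>= t) \<longleftrightarrow> wf_tm L s \<and> wf_tm L t"
| "wf_fm L (Rel r ts) \<longleftrightarrow>
     r \<in> rels L \<and> length ts = rel_arity L r \<and> list_all (wf_tm L) ts"
| "wf_fm L (\<phi> \<^bold>\<longrightarrow> \<psi>) \<longleftrightarrow> wf_fm L \<phi> \<and> wf_fm L \<psi>"
| "wf_fm L (Forall \<phi>) \<longleftrightarrow> wf_fm L \<phi>"

primrec fv_tm :: "'f tm \<Rightarrow> nat set" where
  "fv_tm (Var n) = {n}"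
| "fv_tm (Fun f ts) = \<Union> (set (map fv_tm ts))"

primrec fv_fm :: "('f, 'r) fm \<Rightarrow> nat set" where
  "fv_fm \<^bold>\<bottom> = {}"
| "fv_fm (s \<^bold>= t) = fv_tm s \<union> fv_tm t"
| "fv_fm (Rel r ts) = \<Union> (set (map fv_tm ts))"
| "fv_fm (\<phi> \<^bold>\<longrightarrow> \<psi>) = fv_fm \<phi> \<union> fv_fm \<psi>"
| "fv_fm (Forall \<phi>) = {n. Suc n \<in> fv_fm \<phi>}"

primrec subst_tm :: "(nat \<Rightarrow> 'f tm) \<Rightarrow> 'f tm \<Rightarrow> 'f tm" where
  "subst_tm \<sigma> (Var n) = \<sigma> n"
| "subst_tm \<sigma> (Fun f ts) = Fun f (map (subst_tm \<sigma>) ts)"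

definition lift_subst :: "(nat \<Rightarrow> 'f tm) \<Rightarrow> nat \<Rightarrow> 'f tm"
  where "lift_subst \<sigma> = case_nat (Var 0) (\<lambda>n. subst_tm (\<lambda>k. Var (Suc k)) (\<sigma> n))"

primrec subst_fm :: "(nat \<Rightarrow> 'f tm) \<Rightarrow> ('f, 'r) fm \<Rightarrow> ('f, 'r) fm" where
  "subst_fm \<sigma> \<^bold>\<bottom> = \<^bold>\<bottom>"
| "subst_fm \<sigma> (s \<^bold>= t) = (subst_tm \<sigma> s \<^bold>= subst_tm \<sigma> t)"
| "subst_fm \<sigma> (Rel r ts) = Rel r (map (subst_tm \<sigma>) ts)"
| "subst_fm \<sigma> (\<phi> \<^bold>\<longrightarrow> \<psi>) = (subst_fm \<sigma> \<phi> \<^bold>\<longrightarrow> subst_fm \<sigma> \<psi>)"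
| "subst_fm \<sigma> (Forall \<phi>) = Forall (subst_fm (lift_subst \<sigma>) \<phi>)"

abbreviation rename :: "(nat \<Rightarrow> nat) \<Rightarrow> ('f, 'r) fm \<Rightarrow> ('f, 'r) fm"
  where "rename \<rho> \<equiv> subst_fm (\<lambda>n. Var (\<rho> n))"

text \<open>Replace index 0 by a term and lower all other indices by one.\<close>

abbreviation inst :: "'f tm \<Rightarrow> ('f, 'r) fm \<Rightarrow> ('f, 'r) fm"
  where "inst t \<equiv> subst_fm (case_nat t Var)"

text \<open>
  Classical natural deduction with equality, in which only formulas of the language \<open>L\<close> occur.
  The set of assumptions may be infinite; in the rule \<open>forallI\<close> index 0 is made fresh by
  shifting the assumptions, which does not change assumptions that are sentences.
\<close>

inductive proves :: "('f, 'r) language \<Rightarrow> ('f, 'r) fm set \<Rightarrow> ('f, 'r) fm \<Rightarrow> bool"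
  for L :: "('f, 'r) language" where
  assm: "\<phi> \<in> \<Gamma> \<Longrightarrow> wf_fm L \<phi> \<Longrightarrow> proves L \<Gamma> \<phi>"
| impI: "wf_fm L \<phi> \<Longrightarrow> proves L (insert \<phi> \<Gamma>) \<psi> \<Longrightarrow> proves L \<Gamma> (\<phi> \<^bold>\<longrightarrow> \<psi>)"
| impE: "proves L \<Gamma> (\<phi> \<^bold>\<longrightarrow> \<psi>) \<Longrightarrow> proves L \<Gamma> \<phi> \<Longrightarrow> proves L \<Gamma> \<psi>"
| raa: "wf_fm L \<phi> \<Longrightarrow> proves L (insert (\<^bold>\<not> \<phi>) \<Gamma>) \<^bold>\<bottom> \<Longrightarrow> proves L \<Gamma> \<phi>"
| forallI: "proves L (rename Suc ` \<Gamma>) \<phi> \<Longrightarrow> proves L \<Gamma> (Forall \<phi>)"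
| forallE: "proves L \<Gamma> (Forall \<phi>) \<Longrightarrow> wf_tm L t \<Longrightarrow> proves L \<Gamma> (inst t \<phi>)"
| eqI: "wf_tm L t \<Longrightarrow> proves L \<Gamma> (t \<^bold>= t)"
| eqE: "proves L \<Gamma> (s \<^bold>= t) \<Longrightarrow> proves L \<Gamma> (inst s \<phi>) \<Longrightarrow> proves L \<Gamma> (inst t \<phi>)"


section \<open>Interpretability\<close>

text \<open>
  In \<open>eq_fm\<close> and in \<open>rel_fm r\<close>, index \<open>i\<close> stands for the argument \<open>v\<^sub>i\<^sub>+\<^sub>1\<close>. In \<open>fun_fm f\<close> for an
  \<open>n\<close>-ary function symbol \<open>f\<close>, index 0 stands for the value \<open>v\<^sub>n\<^sub>+\<^sub>1\<close> and index \<open>i\<close> (\<open>1 \<le> i \<le> n\<close>)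
  for the argument \<open>v\<^sub>i\<close>. The first two type parameters belong to the
  language in which the structure is defined.
\<close>

record ('f1, 'r1, 'f2, 'r2) interp =
  univ_fm :: "('f1, 'r1) fm"
  eq_fm :: "('f1, 'r1) fm"
  rel_fm :: "'r2 \<Rightarrow> ('f1, 'r1) fm"
  fun_fm :: "'f2 \<Rightarrow> ('f1, 'r1) fm"

text \<open>Quantifiers relativised to a formula whose only free variable is index 0.\<close>

definition ForallU :: "('f, 'r) fm \<Rightarrow> ('f, 'r) fm \<Rightarrow> ('f, 'r) fm"
  where "ForallU U \<phi> = Forall (U \<^bold>\<longrightarrow> \<phi>)"

definition ExistsU :: "('f, 'r) fm \<Rightarrow> ('f, 'r) fm \<Rightarrow> ('f, 'r) fm"
  where "ExistsU U \<phi> = Exists (U \<^bold>\<and> \<phi>)"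

definition ForallsU :: "('f, 'r) fm \<Rightarrow> nat \<Rightarrow> ('f, 'r) fm \<Rightarrow> ('f, 'r) fm"
  where "ForallsU U n = ForallU U ^^ n"

definition eq_at :: "('f1, 'r1, 'f2, 'r2) interp \<Rightarrow> nat \<Rightarrow> nat \<Rightarrow> ('f1, 'r1) fm"
  where "eq_at A i j = rename (case_nat i (\<lambda>_. j)) (eq_fm A)"

text \<open>
  \<open>fun_at A f w \<rho>\<close> says that the variable \<open>w\<close> is a value of \<open>f\<close> at the variables
  \<open>\<rho> 0, \<rho> 1, \<dots>\<close>.
\<close>

definition fun_at :: "('f1, 'r1, 'f2, 'r2) interp \<Rightarrow> 'f2 \<Rightarrow> nat \<Rightarrow> (nat \<Rightarrow> nat) \<Rightarrow> ('f1, 'r1) fm"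
  where "fun_at A f w \<rho> = rename (case_nat w \<rho>) (fun_fm A f)"

definition total_unique :: "('f1, 'r1, 'f2, 'r2) interp \<Rightarrow> 'f2 \<Rightarrow> nat \<Rightarrow> ('f1, 'r1) fm" where
  "total_unique A f n = ForallsU (univ_fm A) n
     (ExistsU (univ_fm A)
        (fun_at A f 0 (\<lambda>i. i + 1) \<^bold>\<and>
         ForallU (univ_fm A) (fun_at A f 0 (\<lambda>i. i + 2) \<^bold>\<longrightarrow> eq_at A 0 1)))"

definition eq_equivalence :: "('f1, 'r1, 'f2, 'r2) interp \<Rightarrow> ('f1, 'r1) fm" where
  "eq_equivalence A =
    (ForallsU (univ_fm A) 1 (eq_at A 0 0) \<^bold>\<and>
     ForallsU (univ_fm A) 2 (eq_at A 0 1 \<^bold>\<longrightarrow> eq_at A 1 0) \<^bold>\<and>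
     ForallsU (univ_fm A) 3 (eq_at A 0 1 \<^bold>\<and> eq_at A 1 2 \<^bold>\<longrightarrow> eq_at A 0 2))"

text \<open>The two argument tuples are the indices \<open>0, \<dots>, n - 1\<close> and \<open>n, \<dots>, 2 * n - 1\<close>.\<close>

definition respects_rel :: "('f1, 'r1, 'f2, 'r2) interp \<Rightarrow> 'r2 \<Rightarrow> nat \<Rightarrow> ('f1, 'r1) fm" where
  "respects_rel A r n = ForallsU (univ_fm A) (2 * n)
     (Conj (map (\<lambda>i. eq_at A i (n + i)) [0..<n]) \<^bold>\<longrightarrow>
      (rel_fm A r \<^bold>\<longleftrightarrow> rename (\<lambda>i. n + i) (rel_fm A r)))"

text \<open>As before, but with the two function values at the indices 0 and 1.\<close>

definition respects_fun :: "('f1, 'r1, 'f2, 'r2) interp \<Rightarrow> 'f2 \<Rightarrow> nat \<Rightarrow> ('f1, 'r1) fm" where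
  "respects_fun A f n = ForallsU (univ_fm A) (2 * n + 2)
     (Conj (map (\<lambda>i. eq_at A (2 + i) (2 + n + i)) [0..<n]) \<^bold>\<and>
      fun_at A f 0 (\<lambda>i. 2 + i) \<^bold>\<and> fun_at A f 1 (\<lambda>i. 2 + n + i) \<^bold>\<longrightarrow>
      eq_at A 0 1)"

definition definable_structure ::
  "('f1, 'r1) language \<Rightarrow> ('f1, 'r1) fm set \<Rightarrow> ('f2, 'r2) language \<Rightarrow>
   ('f1, 'r1, 'f2, 'r2) interp \<Rightarrow> bool" where
  "definable_structure L1 T1 L2 A \<longleftrightarrow>
     wf_fm L1 (univ_fm A) \<and> fv_fm (univ_fm A) = {0} \<and> proves L1 T1 (Exists (univ_fm A)) \<and>
     wf_fm L1 (eq_fm A) \<and> fv_fm (eq_fm A) = {0, 1} \<and>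
     (\<forall>r \<in> rels L2. wf_fm L1 (rel_fm A r) \<and> fv_fm (rel_fm A r) = {..<rel_arity L2 r}) \<and>
     (\<forall>f \<in> funs L2. wf_fm L1 (fun_fm A f) \<and> fv_fm (fun_fm A f) = {..fun_arity L2 f} \<and>
        proves L1 T1 (total_unique A f (fun_arity L2 f))) \<and>
     proves L1 T1 (eq_equivalence A) \<and>
     (\<forall>r \<in> rels L2. proves L1 T1 (respects_rel A r (rel_arity L2 r))) \<and>
     (\<forall>f \<in> funs L2. proves L1 T1 (respects_fun A f (fun_arity L2 f)))"

text \<open>
  Unravelling of terms. \<open>bind_tm A k t \<phi>\<close> expresses \<open>\<phi>\<close> with the value of \<open>t\<close> in place of index 0,
  and \<open>bind_tms A k [t\<^sub>1, \<dots>, t\<^sub>n] \<phi>\<close> expresses \<open>\<phi>\<close> with the values of \<open>t\<^sub>1, \<dots>, t\<^sub>n\<close> in place of the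
  indices \<open>0, \<dots>, n - 1\<close>; the remaining indices of \<open>\<phi>\<close> refer to the surrounding context, and the
  variables of the terms have to be shifted by \<open>k\<close> to refer to that context. A variable is its own
  value; a value of a function term is introduced by an existential quantifier over the universe.
\<close>

primrec bind_tm :: "('f1, 'r1, 'f2, 'r2) interp \<Rightarrow> nat \<Rightarrow> 'f2 tm \<Rightarrow> ('f1, 'r1) fm \<Rightarrow> ('f1, 'r1) fm"
  and bind_tms :: "('f1, 'r1, 'f2, 'r2) interp \<Rightarrow> nat \<Rightarrow> 'f2 tm list \<Rightarrow> ('f1, 'r1) fm \<Rightarrow> ('f1, 'r1) fm"
where
  "bind_tm A k (Var n) \<phi> = inst (Var (n + k)) \<phi>"
| "bind_tm A k (Fun f ts) \<phi> = bind_tms A k ts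
     (ExistsU (univ_fm A)
        (fun_fm A f \<^bold>\<and> rename (case_nat 0 (\<lambda>i. Suc (i + length ts))) \<phi>))"
| "bind_tms A k [] \<phi> = \<phi>"
| "bind_tms A k (t # ts) \<phi> = bind_tms A k ts (bind_tm A (k + length ts) t \<phi>)"

primrec translate :: "('f1, 'r1, 'f2, 'r2) interp \<Rightarrow> ('f2, 'r2) fm \<Rightarrow> ('f1, 'r1) fm" where
  "translate A \<^bold>\<bottom> = \<^bold>\<bottom>"
| "translate A (s \<^bold>= t) = bind_tms A 0 [s, t] (eq_fm A)"
| "translate A (Rel r ts) = bind_tms A 0 ts (rel_fm A r)"
| "translate A (\<phi> \<^bold>\<longrightarrow> \<psi>) = (translate A \<phi> \<^bold>\<longrightarrow> translate A \<psi>)"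
| "translate A (Forall \<phi>) = ForallU (univ_fm A) (translate A \<phi>)"

definition interprets ::
  "('f1, 'r1) language \<Rightarrow> ('f1, 'r1) fm set \<Rightarrow> ('f2, 'r2) language \<Rightarrow> ('f2, 'r2) fm set \<Rightarrow> bool"
where
  "interprets L1 T1 L2 T2 \<longleftrightarrow>
     (\<exists>A. definable_structure L1 T1 L2 A \<and> (\<forall>\<phi> \<in> T2. proves L1 T1 (translate A \<phi>)))"


section \<open>The theory ZFC\<close>

datatype zf_rel = Elem

type_synonym zf_fm = "(unit, zf_rel) fm"

definition L_ZF :: "(unit, zf_rel) language" where
  "L_ZF = \<lparr>funs = {}, fun_arity = (\<lambda>_. 0), rels = {Elem}, rel_arity = (\<lambda>_. 2)\<rparr>"

definition elem :: "nat \<Rightarrow> nat \<Rightarrow> zf_fm"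
  where "elem i j = Rel Elem [Var i, Var j]"

text \<open>
  In the comments, the variables bound by the quantifiers enclosing a formula are listed from
  index 0 upwards.
\<close>

definition zf_extensionality :: zf_fm where
  "zf_extensionality = Foralls 2 (Forall \<comment> \<open>\<open>z, y, x\<close>\<close> (elem 0 2 \<^bold>\<longleftrightarrow> elem 0 1) \<^bold>\<longrightarrow> Var 1 \<^bold>= Var 0)"

definition zf_foundation :: zf_fm where
  "zf_foundation = Forall (Exists (elem 0 1) \<^bold>\<longrightarrow>
     Exists (elem 0 1 \<^bold>\<and> \<^bold>\<not> Exists \<comment> \<open>\<open>z, y, x\<close>\<close> (elem 0 2 \<^bold>\<and> elem 0 1)))"

definition zf_pairing :: zf_fm where
  "zf_pairing = Foralls 2 (Exists (Forall \<comment> \<open>\<open>w, p, y, x\<close>\<close>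
     (elem 0 1 \<^bold>\<longleftrightarrow> Var 0 \<^bold>= Var 3 \<^bold>\<or> Var 0 \<^bold>= Var 2)))"

definition zf_union :: zf_fm where
  "zf_union = Forall (Exists (Forall (elem 0 1 \<^bold>\<longleftrightarrow>
     Exists \<comment> \<open>\<open>y, z, u, x\<close>\<close> (elem 1 0 \<^bold>\<and> elem 0 3))))"

definition zf_powerset :: zf_fm where
  "zf_powerset = Forall (Exists (Forall (elem 0 1 \<^bold>\<longleftrightarrow>
     Forall \<comment> \<open>\<open>w, z, p, x\<close>\<close> (elem 0 1 \<^bold>\<longrightarrow> elem 0 3))))"

definition zf_infinity :: zf_fm where
  "zf_infinity = Exists
     (Exists (elem 0 1 \<^bold>\<and> Forall \<comment> \<open>\<open>w, e, x\<close>\<close> (\<^bold>\<not> elem 0 1)) \<^bold>\<and>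
      Forall (elem 0 1 \<^bold>\<longrightarrow>
        Exists (elem 0 2 \<^bold>\<and>
          Forall \<comment> \<open>\<open>w, s, y, x\<close>\<close> (elem 0 1 \<^bold>\<longleftrightarrow> elem 0 2 \<^bold>\<or> Var 0 \<^bold>= Var 2))))"

text \<open>In \<open>\<phi>\<close>, index 0 is the element and the indices \<open>1, \<dots>, n\<close> are the parameters.\<close>

definition zf_separation :: "nat \<Rightarrow> zf_fm \<Rightarrow> zf_fm" where
  "zf_separation n \<phi> = Foralls n (Forall (Exists (Forall \<comment> \<open>\<open>z, y, x, P\<^sub>1, \<dots>, P\<^sub>n\<close>\<close>
     (elem 0 1 \<^bold>\<longleftrightarrow> elem 0 2 \<^bold>\<and> rename (case_nat 0 (\<lambda>i. i + 3)) \<phi>))))"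

text \<open>
  In \<open>\<phi>\<close>, index 0 is the argument, index 1 the value, and \<open>2, \<dots>, n + 1\<close> are the parameters.
\<close>

definition zf_replacement :: "nat \<Rightarrow> zf_fm \<Rightarrow> zf_fm" where
  "zf_replacement n \<phi> = Foralls n
     (Foralls 3 \<comment> \<open>\<open>z, y, x, P\<^sub>1, \<dots>, P\<^sub>n\<close>\<close>
        (rename (case_nat 2 (case_nat 1 (\<lambda>i. i + 3))) \<phi> \<^bold>\<and>
         rename (case_nat 2 (case_nat 0 (\<lambda>i. i + 3))) \<phi> \<^bold>\<longrightarrow> Var 1 \<^bold>= Var 0) \<^bold>\<longrightarrow>
      Forall (Exists (Forall (elem 0 1 \<^bold>\<longleftrightarrow>
        Exists \<comment> \<open>\<open>x, y, b, a, P\<^sub>1, \<dots>, P\<^sub>n\<close>\<close>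
          (elem 0 3 \<^bold>\<and> rename (case_nat 0 (case_nat 1 (\<lambda>i. i + 4))) \<phi>)))))"

text \<open>
  Every set \<open>F\<close> of nonempty pairwise disjoint sets has a set \<open>c\<close> that meets each \<open>x \<in> F\<close> in
  exactly one point.
\<close>

definition zf_choice :: zf_fm where
  "zf_choice = Forall
     (Forall (elem 0 1 \<^bold>\<longrightarrow> Exists \<comment> \<open>\<open>w, x, F\<close>\<close> (elem 0 1)) \<^bold>\<and>
      Foralls 2 (elem 1 2 \<^bold>\<and> elem 0 2 \<^bold>\<and> \<^bold>\<not> Var 1 \<^bold>= Var 0 \<^bold>\<longrightarrow>
        \<^bold>\<not> Exists \<comment> \<open>\<open>w, y, x, F\<close>\<close> (elem 0 2 \<^bold>\<and> elem 0 1)) \<^bold>\<longrightarrow>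
      Exists (Forall (elem 0 2 \<^bold>\<longrightarrow>
        Exists (Forall \<comment> \<open>\<open>v, w, x, c, F\<close>\<close>
          (elem 0 2 \<^bold>\<and> elem 0 3 \<^bold>\<longleftrightarrow> Var 0 \<^bold>= Var 1)))))"

definition ZFC :: "zf_fm set" where
  "ZFC = {zf_extensionality, zf_foundation, zf_pairing, zf_union, zf_powerset, zf_infinity,
          zf_choice} \<union>
     {zf_separation n \<phi> | n \<phi>. wf_fm L_ZF \<phi> \<and> fv_fm \<phi> \<subseteq> {..<n + 1}} \<union>
     {zf_replacement n \<phi> | n \<phi>. wf_fm L_ZF \<phi> \<and> fv_fm \<phi> \<subseteq> {..<n + 2}}"


section \<open>The theory SO\<close>

datatype so_rel = OrdSym | SOrdSym | LessSym | MemSym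
datatype so_fun = GSym

type_synonym so_tm = "so_fun tm"
type_synonym so_fm = "(so_fun, so_rel) fm"

definition L_SO :: "(so_fun, so_rel) language" where
  "L_SO = \<lparr>funs = {GSym}, fun_arity = (\<lambda>_. 2), rels = {OrdSym, SOrdSym, LessSym, MemSym},
     rel_arity = (\<lambda>r. case r of OrdSym \<Rightarrow> 1 | SOrdSym \<Rightarrow> 1 | LessSym \<Rightarrow> 2 | MemSym \<Rightarrow> 2)\<rparr>"

definition Ord :: "so_tm \<Rightarrow> so_fm" where "Ord t = Rel OrdSym [t]"
definition SOrd :: "so_tm \<Rightarrow> so_fm" where "SOrd t = Rel SOrdSym [t]"
definition less_so :: "so_tm \<Rightarrow> so_tm \<Rightarrow> so_fm" (infix \<open>\<^bold><\<close> 50) where "s \<^bold>< t = Rel LessSym [s, t]"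
definition mem_so :: "so_tm \<Rightarrow> so_tm \<Rightarrow> so_fm" (infix \<open>\<^bold>\<in>\<close> 50) where "s \<^bold>\<in> t = Rel MemSym [s, t]"
definition le_so :: "so_tm \<Rightarrow> so_tm \<Rightarrow> so_fm" (infix \<open>\<^bold>\<le>\<close> 50) where "s \<^bold>\<le> t = (s \<^bold>< t \<^bold>\<or> s \<^bold>= t)"
definition G :: "so_tm \<Rightarrow> so_tm \<Rightarrow> so_tm" where "G s t = Fun GSym [s, t]"

text \<open>Quantifiers over ordinals (\<open>O\<close>) and over sets of ordinals (\<open>S\<close>).\<close>

definition ForallO :: "so_fm \<Rightarrow> so_fm" where "ForallO \<phi> = Forall (Ord (Var 0) \<^bold>\<longrightarrow> \<phi>)"
definition ExistsO :: "so_fm \<Rightarrow> so_fm" where "ExistsO \<phi> = Exists (Ord (Var 0) \<^bold>\<and> \<phi>)"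
definition ForallS :: "so_fm \<Rightarrow> so_fm" where "ForallS \<phi> = Forall (SOrd (Var 0) \<^bold>\<longrightarrow> \<phi>)"
definition ExistsS :: "so_fm \<Rightarrow> so_fm" where "ExistsS \<phi> = Exists (SOrd (Var 0) \<^bold>\<and> \<phi>)"

definition Exists1O :: "so_fm \<Rightarrow> so_fm" where
  "Exists1O \<phi> =
     ExistsO (\<phi> \<^bold>\<and> ForallO (rename (case_nat 0 (\<lambda>i. i + 2)) \<phi> \<^bold>\<longrightarrow> Var 0 \<^bold>= Var 1))"

text \<open>\<open>is_max a b m\<close> says that \<open>m\<close> is the maximum of \<open>a\<close> and \<open>b\<close>.\<close>

definition is_max :: "so_tm \<Rightarrow> so_tm \<Rightarrow> so_tm \<Rightarrow> so_fm" where
  "is_max a b m = ((a \<^bold>< b \<^bold>\<and> m \<^bold>= b) \<^bold>\<or> (\<^bold>\<not> a \<^bold>< b \<^bold>\<and> m \<^bold>= a))"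

text \<open>
  \<open>pair_less i j k l\<close> says that \<open>(i, j) <\<^sup>* (k, l)\<close> for the variables with these indices; the two
  maxima are the bound variables 1 and 0.
\<close>

definition pair_less :: "nat \<Rightarrow> nat \<Rightarrow> nat \<Rightarrow> nat \<Rightarrow> so_fm" where
  "pair_less i j k l = (let a = Var (i + 2); b = Var (j + 2); c = Var (k + 2); d = Var (l + 2) in
     ExistsO (ExistsO (is_max a b (Var 1) \<^bold>\<and> is_max c d (Var 0) \<^bold>\<and>
       (Var 1 \<^bold>< Var 0 \<^bold>\<or>
        (Var 1 \<^bold>= Var 0 \<^bold>\<and> a \<^bold>< c) \<^bold>\<or>
        (Var 1 \<^bold>= Var 0 \<^bold>\<and> a \<^bold>= c \<^bold>\<and> b \<^bold>< d)))))"

definition so_SOR :: so_fm where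
  "so_SOR = Forall (Forall \<comment> \<open>\<open>Y, X\<close>\<close>
     ((Ord (Var 1) \<^bold>\<longleftrightarrow> \<^bold>\<not> SOrd (Var 1)) \<^bold>\<and>
      (Var 1 \<^bold>< Var 0 \<^bold>\<longrightarrow> Ord (Var 1) \<^bold>\<and> Ord (Var 0)) \<^bold>\<and>
      (Var 1 \<^bold>\<in> Var 0 \<^bold>\<longrightarrow> Ord (Var 1) \<^bold>\<and> SOrd (Var 0)) \<^bold>\<and>
      Ord (G (Var 1) (Var 0))))"

definition so_WO :: so_fm where
  "so_WO = ForallO (ForallO (ForallO \<comment> \<open>\<open>\<gamma>, \<beta>, \<alpha>\<close>\<close>
     ((\<^bold>\<not> Var 2 \<^bold>< Var 2 \<^bold>\<and>
       (Var 2 \<^bold>< Var 1 \<^bold>\<and> Var 1 \<^bold>< Var 0 \<^bold>\<longrightarrow> Var 2 \<^bold>< Var 0) \<^bold>\<and>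
       (Var 2 \<^bold>< Var 1 \<^bold>\<or> Var 2 \<^bold>= Var 1 \<^bold>\<or> Var 1 \<^bold>< Var 2)) \<^bold>\<and>
      ForallS (ExistsO (Var 0 \<^bold>\<in> Var 1) \<^bold>\<longrightarrow>
        ExistsO (Var 0 \<^bold>\<in> Var 1 \<^bold>\<and>
          ForallO \<comment> \<open>\<open>\<beta>, \<alpha>, a\<close>\<close> (Var 0 \<^bold>< Var 1 \<^bold>\<longrightarrow> \<^bold>\<not> Var 0 \<^bold>\<in> Var 2))))))"

definition so_INF :: so_fm where
  "so_INF = ExistsO (ExistsO (Var 0 \<^bold>< Var 1) \<^bold>\<and>
     ForallO (Var 0 \<^bold>< Var 1 \<^bold>\<longrightarrow>
       ExistsO \<comment> \<open>\<open>\<gamma>, \<beta>, \<alpha>\<close>\<close> (Var 1 \<^bold>< Var 0 \<^bold>\<and> Var 0 \<^bold>< Var 2)))"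

definition so_EXT :: so_fm where
  "so_EXT = ForallS (ForallS
     (ForallO \<comment> \<open>\<open>\<alpha>, b, a\<close>\<close> (Var 0 \<^bold>\<in> Var 2 \<^bold>\<longleftrightarrow> Var 0 \<^bold>\<in> Var 1) \<^bold>\<longrightarrow> Var 1 \<^bold>= Var 0))"

definition so_INI :: so_fm where
  "so_INI = ForallO (ExistsS (ForallO \<comment> \<open>\<open>\<beta>, a, \<alpha>\<close>\<close> (Var 0 \<^bold>< Var 2 \<^bold>\<longleftrightarrow> Var 0 \<^bold>\<in> Var 1)))"

definition so_BOU :: so_fm where
  "so_BOU = ForallS (ExistsO (ForallO \<comment> \<open>\<open>\<beta>, \<alpha>, a\<close>\<close> (Var 0 \<^bold>\<in> Var 2 \<^bold>\<longrightarrow> Var 0 \<^bold>< Var 1)))"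

definition so_GPF :: so_fm where
  "so_GPF = ForallO (ForallO (ForallO \<comment> \<open>\<open>\<gamma>, \<beta>, \<alpha>\<close>\<close>
     (G (Var 1) (Var 0) \<^bold>\<le> Var 2 \<^bold>\<longleftrightarrow>
      ForallO (ForallO \<comment> \<open>\<open>\<epsilon>, \<delta>, \<gamma>, \<beta>, \<alpha>\<close>\<close>
        (pair_less 1 0 3 2 \<^bold>\<longrightarrow> G (Var 1) (Var 0) \<^bold>< Var 4)))))"

definition so_SUR :: so_fm where
  "so_SUR = ForallO (ExistsO (ExistsO \<comment> \<open>\<open>\<gamma>, \<beta>, \<alpha>\<close>\<close> (Var 2 \<^bold>= G (Var 1) (Var 0))))"

text \<open>In \<open>\<phi>\<close>, index 0 is \<open>\<alpha>\<close> and the indices \<open>1, \<dots>, n\<close> are the parameters.\<close>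

definition so_SEP :: "nat \<Rightarrow> so_fm \<Rightarrow> so_fm" where
  "so_SEP n \<phi> = Foralls n (ForallS (ExistsS (ForallO \<comment> \<open>\<open>\<alpha>, b, a, P\<^sub>1, \<dots>, P\<^sub>n\<close>\<close>
     (Var 0 \<^bold>\<in> Var 1 \<^bold>\<longleftrightarrow> Var 0 \<^bold>\<in> Var 2 \<^bold>\<and> rename (case_nat 0 (\<lambda>i. i + 3)) \<phi>))))"

text \<open>In \<open>\<phi>\<close>, index 0 is \<open>\<xi>\<close>, index 1 is \<open>\<zeta>\<close>, and \<open>2, \<dots>, n + 1\<close> are the parameters.\<close>

definition so_REP :: "nat \<Rightarrow> so_fm \<Rightarrow> so_fm" where
  "so_REP n \<phi> = Foralls n
     (ForallO (ForallO (ForallO \<comment> \<open>\<open>\<zeta>\<^sub>2, \<zeta>\<^sub>1, \<xi>, P\<^sub>1, \<dots>, P\<^sub>n\<close>\<close>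
        (rename (case_nat 2 (case_nat 1 (\<lambda>i. i + 3))) \<phi> \<^bold>\<and>
         rename (case_nat 2 (case_nat 0 (\<lambda>i. i + 3))) \<phi> \<^bold>\<longrightarrow> Var 1 \<^bold>= Var 0))) \<^bold>\<longrightarrow>
      ForallS (ExistsS (ForallO (Var 0 \<^bold>\<in> Var 1 \<^bold>\<longleftrightarrow>
        ExistsO \<comment> \<open>\<open>\<xi>, \<zeta>, b, a, P\<^sub>1, \<dots>, P\<^sub>n\<close>\<close>
          (Var 0 \<^bold>\<in> Var 3 \<^bold>\<and> rename (case_nat 0 (case_nat 1 (\<lambda>i. i + 4))) \<phi>)))))"

definition so_POW :: so_fm where
  "so_POW = ForallS (ExistsS (ForallS
     (ExistsO (Var 0 \<^bold>\<in> Var 1) \<^bold>\<and> ForallO \<comment> \<open>\<open>\<alpha>, z, b, a\<close>\<close> (Var 0 \<^bold>\<in> Var 1 \<^bold>\<longrightarrow> Var 0 \<^bold>\<in> Var 3) \<^bold>\<longrightarrow>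
      Exists1O (ForallO \<comment> \<open>\<open>\<beta>, \<xi>, z, b, a\<close>\<close>
        (Var 0 \<^bold>\<in> Var 2 \<^bold>\<longleftrightarrow> G (Var 0) (Var 1) \<^bold>\<in> Var 3)))))"

definition SO :: "so_fm set" where
  "SO = {so_SOR, so_WO, so_INF, so_EXT, so_INI, so_BOU, so_GPF, so_SUR, so_POW} \<union>
     {so_SEP n \<phi> | n \<phi>. wf_fm L_SO \<phi> \<and> fv_fm \<phi> \<subseteq> {..<n + 1}} \<union>
     {so_REP n \<phi> | n \<phi>. wf_fm L_SO \<phi> \<and> fv_fm \<phi> \<subseteq> {..<n + 2}}"

end

theory Submission
  imports Defs "HOL-Library.Countable" "HOL-Library.Infinite_Set"
begin

text \<open>By completeness of the calculus it suffices to show that the translated axioms hold in every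
  model of ZFC. As the language has no function symbols, the Henkin model can be built from the
  variables themselves, and as models of ZFC are infinite, its carrier may be taken to be the
  type of natural numbers.

  Inside a model, ordinals are interpreted as von Neumann ordinals, and the pairing function \<open>G\<close>
  as the collapse of the well-order \<open><\<^sup>*\<close> on pairs of ordinals. It is onto because
  \<open>\<alpha> \<le> G(\<alpha>, 0)\<close>. For (POW), recursion along the ordinals with a choice function enumerates
  the subsets of \<open>a\<close> without repetition as \<open>h(\<xi>)\<close>, \<open>\<xi> < \<kappa>\<close>, and
  \<open>b = {G(\<beta>, \<xi>) | \<xi> < \<kappa>, \<beta> \<in> h(\<xi>)}\<close> is as required. Separation, replacement and recursion
  apply only to classes that are definable in the model, so definability with parameters is
  tracked as a predicate on relations.\<close>

section \<open>Substitution\<close>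

text \<open>A model of ZFC is seen only from inside: it need not be well-founded in HOL, and a HOL
  predicate on it may fail to be definable. Hence least elements, induction and replacement are
  available there for definable classes alone. The schemes of SO fit this frame because the
  translation of a formula of SO is itself a formula of set theory.

  SO asks for two disjoint sorts and for an ordinal \<open>G(X, Y)\<close> at all objects, so off
  the ordinals the pairing function gets a default value.

  That \<alpha> \<le> G(\<alpha>, 0) gives surjectivity rests on a feature of the collapse: each
  value is exactly the set of the earlier values, so every element of a value is again a value.
  (GPF) expresses the same fact.

  In (POW) the code \<xi> can be unique only for nonempty z: every \<xi> \<ge> \<kappa> has an empty
  section in b, just like the index below \<kappa> of the empty subset. For nonempty z, the absence
  of repetitions in the enumeration gives uniqueness.\<close>

lemma subst_tm_comp: "subst_tm \<sigma> (subst_tm \<tau> t) = subst_tm (\<lambda>n. subst_tm \<sigma> (\<tau> n)) t"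
  by (induction t) auto

lemma lift_subst_0 [simp]: "lift_subst \<sigma> 0 = Var 0"
  and lift_subst_Suc [simp]: "lift_subst \<sigma> (Suc n) = subst_tm (\<lambda>k. Var (Suc k)) (\<sigma> n)"
  by (simp_all add: lift_subst_def)

lemma lift_subst_comp:
  "(\<lambda>n. subst_tm (lift_subst \<sigma>) (lift_subst \<tau> n)) = lift_subst (\<lambda>n. subst_tm \<sigma> (\<tau> n))"
proof
  fix n show "subst_tm (lift_subst \<sigma>) (lift_subst \<tau> n) = lift_subst (\<lambda>n. subst_tm \<sigma> (\<tau> n)) n"
    by (cases n) (simp_all add: subst_tm_comp)
qed

lemma subst_fm_comp: "subst_fm \<sigma> (subst_fm \<tau> \<phi>) = subst_fm (\<lambda>n. subst_tm \<sigma> (\<tau> n)) \<phi>"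
  by (induction \<phi> arbitrary: \<sigma> \<tau>) (simp_all add: subst_tm_comp lift_subst_comp)

lemma subst_tm_cong: "(\<And>n. n \<in> fv_tm t \<Longrightarrow> \<sigma> n = \<tau> n) \<Longrightarrow> subst_tm \<sigma> t = subst_tm \<tau> t"
  by (induction t) auto

lemma subst_fm_cong: "(\<And>n. n \<in> fv_fm \<phi> \<Longrightarrow> \<sigma> n = \<tau> n) \<Longrightarrow> subst_fm \<sigma> \<phi> = subst_fm \<tau> \<phi>"
proof (induction \<phi> arbitrary: \<sigma> \<tau>)
  case (Equal s t)
  then show ?case using subst_tm_cong[of s \<sigma> \<tau>] subst_tm_cong[of t \<sigma> \<tau>] by auto
next
  case (Rel r ts)
  then show ?case using subst_tm_cong[of _ \<sigma> \<tau>] by fastforce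
next
  case (Imp \<phi> \<psi>)
  have "subst_fm \<sigma> \<phi> = subst_fm \<tau> \<phi>" by (rule Imp.IH) (simp add: Imp.prems)
  moreover have "subst_fm \<sigma> \<psi> = subst_fm \<tau> \<psi>" by (rule Imp.IH) (simp add: Imp.prems)
  ultimately show ?case by simp
next
  case (Forall \<phi>)
  have "lift_subst \<sigma> n = lift_subst \<tau> n" if "n \<in> fv_fm \<phi>" for n
    using that Forall.prems by (cases n) auto
  then have "subst_fm (lift_subst \<sigma>) \<phi> = subst_fm (lift_subst \<tau>) \<phi>"
    by (rule Forall.IH)
  then show ?case by simp
qed simp

lemma subst_tm_Var [simp]: "subst_tm Var t = t"
  by (induction t) (simp_all add: map_idI)

lemma lift_subst_Var [simp]: "lift_subst Var = Var"
proof
  show "lift_subst Var n = Var n" for n by (cases n) simp_all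
qed

lemma subst_fm_Var [simp]: "subst_fm Var \<phi> = \<phi>"
  by (induction \<phi>) (simp_all add: map_idI)

lemma lift_rename: "lift_subst (\<lambda>n. Var (\<rho> n)) = (\<lambda>n. Var (case_nat 0 (\<lambda>i. Suc (\<rho> i)) n))"
proof
  show "lift_subst (\<lambda>n. Var (\<rho> n)) n = Var (case_nat 0 (\<lambda>i. Suc (\<rho> i)) n)" for n
    by (cases n) simp_all
qed

lemma wf_tm_rename [simp]: "wf_tm L (subst_tm (\<lambda>n. Var (\<rho> n)) t) = wf_tm L t"
  by (induction t) (auto simp: list_all_iff)

lemma wf_fm_rename [simp]: "wf_fm L (rename \<rho> \<phi>) = wf_fm L \<phi>"
  by (induction \<phi> arbitrary: \<rho>) (simp_all add: list_all_iff lift_rename)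

text \<open>Lets a renaming pass through the instances that occur in the rules
  \<open>forallE\<close> and \<open>eqE\<close>.\<close>

lemma rename_inst:
  "rename \<rho> (inst t \<phi>) =
     inst (subst_tm (\<lambda>n. Var (\<rho> n)) t) (rename (case_nat 0 (\<lambda>i. Suc (\<rho> i))) \<phi>)"
proof -
  have "(\<lambda>n. subst_tm (\<lambda>n. Var (\<rho> n)) (case_nat t Var n)) =
    (\<lambda>n. subst_tm (case_nat (subst_tm (\<lambda>n. Var (\<rho> n)) t) Var)
           (Var (case_nat 0 (\<lambda>i. Suc (\<rho> i)) n)))"
    by (rule ext) (simp split: nat.split)
  then show ?thesis unfolding subst_fm_comp by presburger
qed

lemma fv_tm_rename: "fv_tm (subst_tm (\<lambda>n. Var (\<rho> n)) t) = \<rho> ` fv_tm t"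
  by (induction t) auto

lemma fv_fm_rename: "fv_fm (rename \<rho> \<phi>) = \<rho> ` fv_fm \<phi>"
proof (induction \<phi> arbitrary: \<rho>)
  case (Forall \<phi>)
  have "Suc n \<in> case_nat 0 (\<lambda>i. Suc (\<rho> i)) ` A \<longleftrightarrow> n \<in> \<rho> ` {i. Suc i \<in> A}" for n and A :: "nat set"
  proof
    assume "Suc n \<in> case_nat 0 (\<lambda>i. Suc (\<rho> i)) ` A"
    then obtain i where "i \<in> A" "Suc n = case_nat 0 (\<lambda>i. Suc (\<rho> i)) i" by blast
    then show "n \<in> \<rho> ` {i. Suc i \<in> A}" by (cases i) auto
  qed force
  then show ?case by (simp add: lift_rename Forall.IH)
qed (auto simp: fv_tm_rename)

lemma finite_fv_tm: "finite (fv_tm t)"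
  by (induction t) auto

lemma finite_fv_fm: "finite (fv_fm \<phi>)"
proof (induction \<phi>)
  case (Forall \<phi>)
  have "{n. Suc n \<in> fv_fm \<phi>} = Suc -` fv_fm \<phi>" by auto
  then show ?case using finite_vimageI[OF Forall.IH, of Suc] by simp
qed (auto simp: finite_fv_tm)


section \<open>Completeness\<close>

lemma proves_mono: "proves L \<Gamma> \<phi> \<Longrightarrow> \<Gamma> \<subseteq> \<Gamma>' \<Longrightarrow> proves L \<Gamma>' \<phi>"
proof (induction arbitrary: \<Gamma>' rule: proves.induct)
  case (assm \<phi> \<Gamma>) then show ?case by (blast intro: proves.assm)
next
  case (impI \<phi> \<Gamma> \<psi>)
  then show ?case by (meson insert_mono proves.impI)
next
  case (raa \<phi> \<Gamma>)
  then show ?case by (meson insert_mono proves.raa)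
next
  case (forallI \<Gamma> \<phi>)
  then show ?case by (auto intro!: proves.forallI forallI.IH image_mono)
qed (blast intro: proves.intros)+

lemma proves_rename: "proves L \<Gamma> \<phi> \<Longrightarrow> proves L (rename \<rho> ` \<Gamma>) (rename \<rho> \<phi>)"
proof (induction arbitrary: \<rho> rule: proves.induct)
  case (assm \<phi> \<Gamma>)
  then show ?case by (intro proves.assm) auto
next
  case (impI \<phi> \<Gamma> \<psi>)
  from impI.IH[of \<rho>] impI.hyps show ?case by (simp add: proves.impI)
next
  case (impE \<Gamma> \<phi> \<psi>)
  from impE.IH(1)[of \<rho>] impE.IH(2)[of \<rho>] show ?case by (simp add: proves.impE)
next
  case (raa \<phi> \<Gamma>)
  from raa.IH[of \<rho>] raa.hyps show ?case by (simp add: proves.raa)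
next
  case (forallI \<Gamma> \<phi>)
  let ?\<rho> = "case_nat 0 (\<lambda>i. Suc (\<rho> i))"
  \<comment> \<open>The renaming lifted under the binder fixes index 0, so it respects the shift by
    which \<open>forallI\<close> makes that index fresh.\<close>
  have "rename ?\<rho> ` rename Suc ` \<Gamma> = rename Suc ` rename \<rho> ` \<Gamma>"
    by (simp add: image_image subst_fm_comp)
  with forallI.IH[of ?\<rho>] show ?case by (simp add: lift_rename proves.forallI)
next
  case (forallE \<Gamma> \<phi> t)
  from forallE.IH[of \<rho>] have "proves L (rename \<rho> ` \<Gamma>) (Forall (rename (case_nat 0 (\<lambda>i. Suc (\<rho> i))) \<phi>))"
    by (simp add: lift_rename)
  from proves.forallE[OF this, of "subst_tm (\<lambda>n. Var (\<rho> n)) t"] forallE.hyps show ?case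
    by (simp add: rename_inst)
next
  case (eqI t \<Gamma>)
  then show ?case by (simp add: proves.eqI)
next
  case (eqE \<Gamma> s t \<phi>)
  from eqE.IH(1)[of \<rho>] eqE.IH(2)[of \<rho>] show ?case
    unfolding rename_inst subst_fm.simps by (rule proves.eqE)
qed

text \<open>Each rule uses finitely many premises, so finite sets of assumptions can be united. For
  \<open>forallI\<close> the finite set of shifted assumptions is pulled back along the shift. This
  is what keeps the union of the Henkin stages consistent.\<close>

lemma proves_finite: "proves L \<Gamma> \<phi> \<Longrightarrow> \<exists>\<Delta> \<subseteq> \<Gamma>. finite \<Delta> \<and> proves L \<Delta> \<phi>"
proof (induction rule: proves.induct)
  case (assm \<phi> \<Gamma>)
  then show ?case by (intro exI[of _ "{\<phi>}"]) (auto intro: proves.assm)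
next
  case (impI \<phi> \<Gamma> \<psi>)
  then obtain \<Delta> where "\<Delta> \<subseteq> insert \<phi> \<Gamma>" "finite \<Delta>" "proves L \<Delta> \<psi>" by blast
  then show ?case using impI.hyps
    by (intro exI[of _ "\<Delta> - {\<phi>}"]) (auto intro!: proves.impI elim!: proves_mono)
next
  case (impE \<Gamma> \<phi> \<psi>)
  then obtain \<Delta> \<Delta>' where "\<Delta> \<subseteq> \<Gamma>" "finite \<Delta>" "proves L \<Delta> (\<phi> \<^bold>\<longrightarrow> \<psi>)"
    "\<Delta>' \<subseteq> \<Gamma>" "finite \<Delta>'" "proves L \<Delta>' \<phi>" by blast
  then show ?case
    by (intro exI[of _ "\<Delta> \<union> \<Delta>'"]) (auto intro: proves.impE proves_mono)
next
  case (raa \<phi> \<Gamma>)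
  then obtain \<Delta> where "\<Delta> \<subseteq> insert (\<^bold>\<not> \<phi>) \<Gamma>" "finite \<Delta>" "proves L \<Delta> \<^bold>\<bottom>" by blast
  then show ?case using raa.hyps
    by (intro exI[of _ "\<Delta> - {\<^bold>\<not> \<phi>}"]) (auto intro!: proves.raa elim!: proves_mono)
next
  case (forallI \<Gamma> \<phi>)
  then obtain \<Delta> where "\<Delta> \<subseteq> rename Suc ` \<Gamma>" "finite \<Delta>" "proves L \<Delta> \<phi>" by blast
  then show ?case by (metis finite_subset_image proves.forallI)
next
  case (eqI t \<Gamma>)
  then show ?case by (intro exI[of _ "{}"]) (auto intro: proves.eqI)
next
  case (eqE \<Gamma> s t \<phi>)
  then obtain \<Delta> \<Delta>' where "\<Delta> \<subseteq> \<Gamma>" "finite \<Delta>" "proves L \<Delta> (s \<^bold>= t)"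
    "\<Delta>' \<subseteq> \<Gamma>" "finite \<Delta>'" "proves L \<Delta>' (inst s \<phi>)" by blast
  then show ?case
    by (intro exI[of _ "\<Delta> \<union> \<Delta>'"]) (auto intro: proves.eqE proves_mono)
qed (blast intro: proves.intros)+

text \<open>Generalises a named variable instead of index 0. The renaming that sends
  \<open>k\<close> to 0 and shifts everything else agrees with the plain shift on formulas without
  \<open>k\<close>, and it undoes the instantiation by \<open>Var k\<close>.\<close>

lemma proves_forall_fresh:
  assumes "proves L \<Gamma> (inst (Var k) \<phi>)" and "\<And>\<gamma>. \<gamma> \<in> \<Gamma> \<Longrightarrow> k \<notin> fv_fm \<gamma>" and "k \<notin> fv_fm (Forall \<phi>)"
  shows "proves L \<Gamma> (Forall \<phi>)"
proof (rule proves.forallI)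
  let ?\<rho> = "\<lambda>i. if i = k then 0 else Suc i"
  have "rename ?\<rho> \<gamma> = rename Suc \<gamma>" if "\<gamma> \<in> \<Gamma>" for \<gamma>
    using assms(2)[OF that] by (intro subst_fm_cong) auto
  then have 1: "rename ?\<rho> ` \<Gamma> = rename Suc ` \<Gamma>" by auto
  have "rename ?\<rho> (inst (Var k) \<phi>) = subst_fm Var \<phi>"
    unfolding subst_fm_comp using assms(3) by (intro subst_fm_cong) (auto split: nat.splits)
  with proves_rename[OF assms(1), of ?\<rho>] 1 show "proves L (rename Suc ` \<Gamma>) \<phi>" by simp
qed

text \<open>If the new instance could be refuted, the instance itself would be provable, and
  generalising over the fresh \<open>k\<close> would prove the very formula whose negation is
  assumed.\<close>

lemma consistent_witness:
  assumes "\<not> proves L \<Gamma> \<^bold>\<bottom>" "(\<^bold>\<not> Forall \<phi>) \<in> \<Gamma>" "wf_fm L \<phi>"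
    and fresh: "\<And>\<gamma>. \<gamma> \<in> \<Gamma> \<Longrightarrow> k \<notin> fv_fm \<gamma>"
  shows "\<not> proves L (insert (\<^bold>\<not> inst (Var k) \<phi>) \<Gamma>) \<^bold>\<bottom>"
proof
  assume "proves L (insert (\<^bold>\<not> inst (Var k) \<phi>) \<Gamma>) \<^bold>\<bottom>"
  moreover have "case_nat (Var k) Var = (\<lambda>n. Var (case_nat k id n) :: 'a tm)"
    by (rule ext) (simp split: nat.split)
  then have "wf_fm L (inst (Var k) \<phi>)" using assms(3) by simp
  ultimately have "proves L \<Gamma> (inst (Var k) \<phi>)" by (blast intro: proves.raa)
  then have "proves L \<Gamma> (Forall \<phi>)"
    using fresh[OF assms(2)] fresh by (intro proves_forall_fresh) auto
  moreover have "proves L \<Gamma> (\<^bold>\<not> Forall \<phi>)" using assms(2,3) by (intro proves.assm) auto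
  ultimately show False using assms(1) proves.impE by blast
qed

section \<open>The Henkin construction\<close>

instance tm :: (countable) countable
  by countable_datatype

instance fm :: (countable, countable) countable
  by countable_datatype

text \<open>Variables that are not free in the finitely many formulas added so far serve as Henkin
  constants; this is possible because the axioms are sentences.\<close>

primrec henkin :: "('f::countable, 'r::countable) language \<Rightarrow> ('f, 'r) fm set \<Rightarrow> ('f, 'r) fm \<Rightarrow> nat \<Rightarrow> ('f, 'r) fm set"
where
  "henkin L \<Gamma> \<phi> 0 = {\<phi>}"
| "henkin L \<Gamma> \<phi> (Suc n) = (let \<psi> = from_nat n; \<Delta> = insert \<psi> (henkin L \<Gamma> \<phi> n) in
     if wf_fm L \<psi> \<and> \<not> proves L (\<Gamma> \<union> \<Delta>) \<^bold>\<bottom>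
     then \<Delta> \<union> {\<^bold>\<not> inst (Var (SOME k. \<forall>\<delta> \<in> \<Delta>. k \<notin> fv_fm \<delta>)) \<chi> | \<chi>. \<psi> = (\<^bold>\<not> Forall \<chi>)}
     else henkin L \<Gamma> \<phi> n)"

lemma henkin_step_finite: "finite {\<^bold>\<not> inst t \<chi> | \<chi>. \<psi> = (\<^bold>\<not> Forall \<chi>)}"
proof (cases "\<exists>\<chi>. \<psi> = (\<^bold>\<not> Forall \<chi>)")
  case True
  then obtain \<chi> where "\<psi> = (\<^bold>\<not> Forall \<chi>)" by blast
  then have "{\<^bold>\<not> inst t \<chi> | \<chi>. \<psi> = (\<^bold>\<not> Forall \<chi>)} = {\<^bold>\<not> inst t \<chi>}" by auto
  then show ?thesis by simp
qed simp

lemma finite_henkin: "finite (henkin L \<Gamma> \<phi> n)"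
  by (induction n) (simp_all add: Let_def henkin_step_finite)

lemma henkin_consistent:
  assumes "\<And>\<gamma>. \<gamma> \<in> \<Gamma> \<Longrightarrow> fv_fm \<gamma> = {}" "\<not> proves L (insert \<phi> \<Gamma>) \<^bold>\<bottom>"
  shows "\<not> proves L (\<Gamma> \<union> henkin L \<Gamma> \<phi> n) \<^bold>\<bottom>"
proof (induction n)
  case 0
  then show ?case using assms(2) by simp
next
  case (Suc n)
  define \<psi> :: "('a, 'b) fm" where "\<psi> = from_nat n"
  define \<Delta> where "\<Delta> = insert \<psi> (henkin L \<Gamma> \<phi> n)"
  define k where "k = (SOME k. \<forall>\<delta> \<in> \<Delta>. k \<notin> fv_fm \<delta>)"
  \<comment> \<open>The choice of \<open>k\<close> by \<open>SOME\<close> is meaningful: finitely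
    many formulas have finitely many free variables altogether, while the possibly infinite set of
    axioms contributes none.\<close>
  have "finite (\<Union>\<delta>\<in>\<Delta>. fv_fm \<delta>)"
    by (simp add: \<Delta>_def finite_henkin finite_fv_fm)
  then obtain m where "m \<notin> (\<Union>\<delta>\<in>\<Delta>. fv_fm \<delta>)"
    using ex_new_if_finite infinite_UNIV_nat by blast
  then have "\<forall>\<delta> \<in> \<Delta>. m \<notin> fv_fm \<delta>" by blast
  then have "\<forall>\<delta> \<in> \<Delta>. k \<notin> fv_fm \<delta>" unfolding k_def by (rule someI)
  then have fresh: "\<And>\<gamma>. \<gamma> \<in> \<Gamma> \<union> \<Delta> \<Longrightarrow> k \<notin> fv_fm \<gamma>" using assms(1) by blast
  have eq: "henkin L \<Gamma> \<phi> (Suc n) = (if wf_fm L \<psi> \<and> \<not> proves L (\<Gamma> \<union> \<Delta>) \<^bold>\<bottom>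
      then \<Delta> \<union> {\<^bold>\<not> inst (Var k) \<chi> | \<chi>. \<psi> = (\<^bold>\<not> Forall \<chi>)} else henkin L \<Gamma> \<phi> n)"
    unfolding henkin.simps Let_def \<psi>_def \<Delta>_def k_def by simp
  show ?case
  proof (cases "wf_fm L \<psi> \<and> \<not> proves L (\<Gamma> \<union> \<Delta>) \<^bold>\<bottom>")
    case True
    show ?thesis
    proof (cases "\<exists>\<chi>. \<psi> = (\<^bold>\<not> Forall \<chi>)")
      case ex: True
      then obtain \<chi> where \<chi>: "\<psi> = (\<^bold>\<not> Forall \<chi>)" by blast
      have "\<not> proves L (insert (\<^bold>\<not> inst (Var k) \<chi>) (\<Gamma> \<union> \<Delta>)) \<^bold>\<bottom>"
        using True fresh by (intro consistent_witness) (auto simp: \<Delta>_def \<chi>)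
      moreover have "\<Gamma> \<union> henkin L \<Gamma> \<phi> (Suc n) = insert (\<^bold>\<not> inst (Var k) \<chi>) (\<Gamma> \<union> \<Delta>)"
        using True \<chi> eq by auto
      ultimately show ?thesis by simp
    next
      case False
      then have "henkin L \<Gamma> \<phi> (Suc n) = \<Delta>" using True unfolding eq by auto
      then show ?thesis using True by argo
    qed
  next
    case False
    then have "henkin L \<Gamma> \<phi> (Suc n) = henkin L \<Gamma> \<phi> n" unfolding eq by (rule if_not_P)
    then show ?thesis using Suc by argo
  qed
qed

lemma henkin_mono: "m \<le> n \<Longrightarrow> henkin L \<Gamma> \<phi> m \<subseteq> henkin L \<Gamma> \<phi> n"
  by (rule lift_Suc_mono_le) (auto simp: Let_def)

text \<open>The union of the stages is consistent because a derivation of falsity uses finitely many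
  formulas, which already lie in one stage as the stages increase. It is maximal because every
  formula is considered at the stage given by its code.\<close>

lemma maximal_consistent:
  fixes L :: "('f::countable, 'r::countable) language"
  assumes sent: "\<And>\<gamma>. \<gamma> \<in> \<Gamma> \<Longrightarrow> fv_fm \<gamma> = {}" and con: "\<not> proves L (insert \<phi> \<Gamma>) \<^bold>\<bottom>"
  obtains S where "insert \<phi> \<Gamma> \<subseteq> S" "\<not> proves L S \<^bold>\<bottom>"
    "\<And>\<psi>. wf_fm L \<psi> \<Longrightarrow> \<psi> \<notin> S \<Longrightarrow> proves L (insert \<psi> S) \<^bold>\<bottom>"
    "\<And>\<chi>. wf_fm L \<chi> \<Longrightarrow> (\<^bold>\<not> Forall \<chi>) \<in> S \<Longrightarrow> \<exists>k. (\<^bold>\<not> inst (Var k) \<chi>) \<in> S"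
proof -
  define S where "S = \<Gamma> \<union> (\<Union>n. henkin L \<Gamma> \<phi> n)"
  have fin: "\<exists>n. \<Delta> \<subseteq> \<Gamma> \<union> henkin L \<Gamma> \<phi> n" if "finite \<Delta>" "\<Delta> \<subseteq> S" for \<Delta>
    using that
  proof (induction \<Delta> rule: finite_induct)
    case (insert x \<Delta>)
    then obtain n where n: "\<Delta> \<subseteq> \<Gamma> \<union> henkin L \<Gamma> \<phi> n" by blast
    from insert.prems obtain m where "x \<in> \<Gamma> \<union> henkin L \<Gamma> \<phi> m" unfolding S_def by blast
    then show ?case
      using n henkin_mono[of n "max m n" L \<Gamma> \<phi>] henkin_mono[of m "max m n" L \<Gamma> \<phi>]
      by (intro exI[of _ "max m n"]) auto
  qed simp
  have con_S: "\<not> proves L S \<^bold>\<bottom>"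
  proof
    assume "proves L S \<^bold>\<bottom>"
    from proves_finite[OF this] obtain \<Delta> where \<Delta>: "\<Delta> \<subseteq> S" "finite \<Delta>" "proves L \<Delta> \<^bold>\<bottom>"
      by (elim exE conjE)
    from fin[OF \<Delta>(2,1)] obtain n where "\<Delta> \<subseteq> \<Gamma> \<union> henkin L \<Gamma> \<phi> n" ..
    with \<Delta>(3) have "proves L (\<Gamma> \<union> henkin L \<Gamma> \<phi> n) \<^bold>\<bottom>" by (rule proves_mono)
    with henkin_consistent[OF sent con] show False by simp
  qed
  \<comment> \<open>A formula consistent with the whole of \<open>S\<close> is consistent with the
    smaller stage at which it comes up, so it is added there, together with its witness.\<close>
  have stage: "\<psi> \<in> henkin L \<Gamma> \<phi> (Suc (to_nat \<psi>)) \<and>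
      (\<forall>\<chi>. \<psi> = (\<^bold>\<not> Forall \<chi>) \<longrightarrow> (\<exists>k. (\<^bold>\<not> inst (Var k) \<chi>) \<in> henkin L \<Gamma> \<phi> (Suc (to_nat \<psi>))))"
    if "wf_fm L \<psi>" "\<not> proves L (insert \<psi> S) \<^bold>\<bottom>" for \<psi>
  proof -
    have "\<not> proves L (\<Gamma> \<union> insert \<psi> (henkin L \<Gamma> \<phi> (to_nat \<psi>))) \<^bold>\<bottom>"
      using that(2) proves_mono[of L _ "\<^bold>\<bottom>" "insert \<psi> S"] unfolding S_def by blast
    with that(1) show ?thesis by (auto simp: Let_def)
  qed
  show ?thesis
  proof
    show "insert \<phi> \<Gamma> \<subseteq> S" unfolding S_def using henkin.simps(1)[of L \<Gamma> \<phi>] by blast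
    show "\<not> proves L S \<^bold>\<bottom>" by (rule con_S)
    show "proves L (insert \<psi> S) \<^bold>\<bottom>" if "wf_fm L \<psi>" "\<psi> \<notin> S" for \<psi>
      using stage[OF that(1)] that(2) unfolding S_def by blast
    show "\<exists>k. (\<^bold>\<not> inst (Var k) \<chi>) \<in> S" if "wf_fm L \<chi>" "(\<^bold>\<not> Forall \<chi>) \<in> S" for \<chi>
    proof -
      have 1: "\<not> proves L (insert (\<^bold>\<not> Forall \<chi>) S) \<^bold>\<bottom>" using con_S that(2) by (simp add: insert_absorb)
      have "wf_fm L (\<^bold>\<not> Forall \<chi>)" using that(1) by simp
      from stage[OF this 1, THEN conjunct2, THEN spec, THEN mp, OF refl]
      obtain k where k: "(\<^bold>\<not> inst (Var k) \<chi>) \<in> henkin L \<Gamma> \<phi> (Suc (to_nat (\<^bold>\<not> Forall \<chi>)))" ..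
      show ?thesis unfolding S_def by (rule exI[of _ k], rule UnI2, rule UN_I[OF UNIV_I], rule k)
    qed
  qed
qed

section \<open>Semantics and the completeness theorem\<close>

primrec eval :: "('f \<Rightarrow> 'm list \<Rightarrow> 'm) \<Rightarrow> (nat \<Rightarrow> 'm) \<Rightarrow> 'f tm \<Rightarrow> 'm" where
  "eval F e (Var n) = e n"
| "eval F e (Fun f ts) = F f (map (eval F e) ts)"

text \<open>The carrier \<open>U\<close> bounds quantifiers only; assignments and function values
  are not forced into it. Where this matters, \<open>range e \<subseteq> U\<close> is a separate
  condition.\<close>

primrec sat :: "'m set \<Rightarrow> ('f \<Rightarrow> 'm list \<Rightarrow> 'm) \<Rightarrow> ('r \<Rightarrow> 'm list \<Rightarrow> bool) \<Rightarrow> (nat \<Rightarrow> 'm) \<Rightarrow> ('f, 'r) fm \<Rightarrow> bool"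
where
  "sat U F R e \<^bold>\<bottom> \<longleftrightarrow> False"
| "sat U F R e (s \<^bold>= t) \<longleftrightarrow> eval F e s = eval F e t"
| "sat U F R e (Rel r ts) \<longleftrightarrow> R r (map (eval F e) ts)"
| "sat U F R e (\<phi> \<^bold>\<longrightarrow> \<psi>) \<longleftrightarrow> (sat U F R e \<phi> \<longrightarrow> sat U F R e \<psi>)"
| "sat U F R e (Forall \<phi>) \<longleftrightarrow> (\<forall>x\<in>U. sat U F R (case_nat x e) \<phi>)"

lemma eval_rename: "eval F e (subst_tm (\<lambda>n. Var (\<rho> n)) t) = eval F (\<lambda>n. e (\<rho> n)) t"
  by (induction t) (auto intro: arg_cong[where f = "F _"])

lemma sat_rename: "sat U F R e (rename \<rho> \<phi>) = sat U F R (\<lambda>n. e (\<rho> n)) \<phi>"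
proof (induction \<phi> arbitrary: e \<rho>)
  case (Forall \<phi>)
  have "(\<lambda>n. case_nat x e (case_nat 0 (\<lambda>i. Suc (\<rho> i)) n)) = case_nat x (\<lambda>n. e (\<rho> n))" for x
    by (rule ext) (simp split: nat.split)
  then show ?case by (simp add: lift_rename Forall.IH)
qed (simp_all add: eval_rename comp_def)

lemma eval_cong: "(\<And>n. n \<in> fv_tm t \<Longrightarrow> e n = e' n) \<Longrightarrow> eval F e t = eval F e' t"
proof (induction t)
  case (Fun f ts)
  have "map (eval F e) ts = map (eval F e') ts"
    using Fun.prems by (intro map_cong refl Fun.IH) auto
  then show ?case by (metis eval.simps(2))
qed simp

lemma sat_cong: "(\<And>n. n \<in> fv_fm \<phi> \<Longrightarrow> e n = e' n) \<Longrightarrow> sat U F R e \<phi> = sat U F R e' \<phi>"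
proof (induction \<phi> arbitrary: e e')
  case (Equal s t)
  then show ?case using eval_cong[of s e e'] eval_cong[of t e e'] by auto
next
  case (Rel r ts)
  then have "map (eval F e) ts = map (eval F e') ts" using eval_cong[of _ e e'] by fastforce
  then show ?case by (metis sat.simps(3))
next
  case (Imp \<phi> \<psi>)
  have "sat U F R e \<phi> = sat U F R e' \<phi>" by (rule Imp.IH) (simp add: Imp.prems)
  moreover have "sat U F R e \<psi> = sat U F R e' \<psi>" by (rule Imp.IH) (simp add: Imp.prems)
  ultimately show ?case by simp
next
  case (Forall \<phi>)
  have "sat U F R (case_nat x e) \<phi> = sat U F R (case_nat x e') \<phi>" for x
    using Forall.prems by (intro Forall.IH) (auto split: nat.split)
  then show ?case by simp
qed simp

lemma wf_tm_no_funs: "funs L = {} \<Longrightarrow> wf_tm L t \<Longrightarrow> \<exists>n. t = Var n"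
  by (cases t) auto

lemma wf_tms_no_funs: "funs L = {} \<Longrightarrow> list_all (wf_tm L) ts \<Longrightarrow> \<exists>ns. ts = map Var ns"
proof (induction ts)
  case (Cons t ts)
  then obtain n ns where "t = Var n" "ts = map Var ns" using wf_tm_no_funs[of L t] by auto
  then have "t # ts = map Var (n # ns)" by simp
  then show ?case ..
qed simp

lemma inst_Var: "inst (Var k) \<phi> = rename (case_nat k id) \<phi>"
proof -
  have "case_nat (Var k) Var = (\<lambda>n. Var (case_nat k id n) :: 'a tm)"
    by (rule ext) (simp split: nat.split)
  then show ?thesis by simp
qed

text \<open>All terms are variables, so the model consists of the variables modulo the equations in
  a maximal consistent set \<open>S\<close>. The interpretation \<open>F\<close> of function symbols
  can be arbitrary since no well-formed formula mentions it.\<close>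

theorem completeness:
  fixes L :: "('f::countable, 'r::countable) language"
  assumes nf: "funs L = {}" and sent: "\<And>\<gamma>. \<gamma> \<in> \<Gamma> \<Longrightarrow> fv_fm \<gamma> = {} \<and> wf_fm L \<gamma>"
    and wf: "wf_fm L \<phi>" and unprov: "\<not> proves L \<Gamma> \<phi>"
  obtains U :: "nat set" and R e where "U \<noteq> {}" "range e \<subseteq> U"
    "\<And>\<gamma>. \<gamma> \<in> \<Gamma> \<Longrightarrow> sat U F R e \<gamma>" "\<not> sat U F R e \<phi>"
proof -
  have "\<not> proves L (insert (\<^bold>\<not> \<phi>) \<Gamma>) \<^bold>\<bottom>" using unprov wf proves.raa by blast
  with sent obtain S where sub: "insert (\<^bold>\<not> \<phi>) \<Gamma> \<subseteq> S" and con: "\<not> proves L S \<^bold>\<bottom>"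
    and max: "\<And>\<psi>. wf_fm L \<psi> \<Longrightarrow> \<psi> \<notin> S \<Longrightarrow> proves L (insert \<psi> S) \<^bold>\<bottom>"
    and wit: "\<And>\<chi>. wf_fm L \<chi> \<Longrightarrow> (\<^bold>\<not> Forall \<chi>) \<in> S \<Longrightarrow> \<exists>k. (\<^bold>\<not> inst (Var k) \<chi>) \<in> S"
    using maximal_consistent[of \<Gamma> L "\<^bold>\<not> \<phi>"] by auto
  have closed: "\<psi> \<in> S" if "proves L S \<psi>" "wf_fm L \<psi>" for \<psi>
  proof (rule ccontr)
    assume "\<psi> \<notin> S"
    then have "proves L S (\<^bold>\<not> \<psi>)" using max that(2) by (blast intro: proves.impI)
    with that(1) con show False by (blast intro: proves.impE)
  qed
  have imp: "(\<psi> \<^bold>\<longrightarrow> \<chi>) \<in> S \<longleftrightarrow> (\<psi> \<in> S \<longrightarrow> \<chi> \<in> S)" if "wf_fm L \<psi>" "wf_fm L \<chi>" for \<psi> \<chi>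
  proof
    assume "(\<psi> \<^bold>\<longrightarrow> \<chi>) \<in> S"
    then show "\<psi> \<in> S \<longrightarrow> \<chi> \<in> S" using that closed
      by (metis proves.assm proves.impE wf_fm.simps(4))
  next
    assume *: "\<psi> \<in> S \<longrightarrow> \<chi> \<in> S"
    have "proves L (insert \<psi> S) \<chi>"
    proof (cases "\<psi> \<in> S")
      case True
      then show ?thesis using * that(2) by (blast intro: proves.assm)
    next
      case False
      then show ?thesis using max[OF that(1)] that(2)
        by (blast intro: proves.raa proves_mono)
    qed
    then show "(\<psi> \<^bold>\<longrightarrow> \<chi>) \<in> S" using that by (intro closed) (auto intro: proves.impI)
  qed
  have bot: "\<^bold>\<bottom> \<notin> S" using con proves.assm[of "\<^bold>\<bottom>" S L] by auto
  have all: "Forall \<psi> \<in> S \<longleftrightarrow> (\<forall>k. rename (case_nat k id) \<psi> \<in> S)" if "wf_fm L \<psi>" for \<psi>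
  proof
    assume "Forall \<psi> \<in> S"
    then have "proves L S (Forall \<psi>)" using that by (intro proves.assm) auto
    from proves.forallE[OF this, of "Var _"] show "\<forall>k. rename (case_nat k id) \<psi> \<in> S"
      using that by (intro allI closed) (simp_all add: inst_Var)
  next
    assume *: "\<forall>k. rename (case_nat k id) \<psi> \<in> S"
    show "Forall \<psi> \<in> S"
    proof (rule ccontr)
      assume "Forall \<psi> \<notin> S"
      then have "(\<^bold>\<not> Forall \<psi>) \<in> S" using imp[of "Forall \<psi>" "\<^bold>\<bottom>"] that by simp
      then obtain k where "(\<^bold>\<not> rename (case_nat k id) \<psi>) \<in> S"
        using wit[of \<psi>] \<open>wf_fm L \<psi>\<close> by (auto simp: inst_Var)
      then show False using * bot imp[of "rename (case_nat k id) \<psi>" "\<^bold>\<bottom>"] that by simp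
    qed
  qed
  define eqv where "eqv i j \<longleftrightarrow> (Var i \<^bold>= Var j) \<in> S" for i j
  \<comment> \<open>The rule \<open>eqE\<close> replaces index 0 only. Moving \<open>k\<close> to
    index 0 and shifting the other indices makes both renamed formulas instances of one
    formula.\<close>
  have eq_subst: "rename \<rho> \<psi> \<in> S \<Longrightarrow> eqv (\<rho> k) j \<Longrightarrow> rename (\<rho>(k := j)) \<psi> \<in> S"
    if "wf_fm L \<psi>" for \<rho> k j \<psi>
  proof -
    assume 1: "rename \<rho> \<psi> \<in> S" and 2: "eqv (\<rho> k) j"
    let ?\<psi> = "rename (\<lambda>i. if i = k then 0 else Suc (\<rho> i)) \<psi>"
    have i1: "inst (Var (\<rho> k)) ?\<psi> = rename \<rho> \<psi>"
      unfolding subst_fm_comp by (intro subst_fm_cong) simp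
    have i2: "inst (Var j) ?\<psi> = rename (\<rho>(k := j)) \<psi>"
      unfolding subst_fm_comp by (intro subst_fm_cong) simp
    have "proves L S (Var (\<rho> k) \<^bold>= Var j)"
      using 2 by (intro proves.assm) (auto simp: eqv_def)
    moreover have "proves L S (inst (Var (\<rho> k)) ?\<psi>)"
      using 1 that unfolding i1 by (intro proves.assm) auto
    ultimately have "proves L S (inst (Var j) ?\<psi>)" by (rule proves.eqE)
    then show ?thesis using that unfolding i2 by (intro closed) auto
  qed
  have refl: "eqv i i" for i
    unfolding eqv_def by (intro closed proves.eqI) auto
  have sym: "eqv j i" if "eqv i j" for i j
    using eq_subst[of "Var 0 \<^bold>= Var 1" "\<lambda>_. i" 0 j] refl[of i] that by (simp add: eqv_def)
  have trans: "eqv i k" if "eqv i j" "eqv j k" for i j k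
    using eq_subst[of "Var 0 \<^bold>= Var 1" "case_nat i (\<lambda>_. j)" 1 k] that by (simp add: eqv_def)
  \<comment> \<open>Least representatives in place of equivalence classes keep the carrier a set of
    natural numbers.\<close>
  define rep where "rep i = (LEAST j. eqv i j)" for i
  have rep: "eqv i (rep i)" for i unfolding rep_def using refl by (rule LeastI)
  have rep_eq: "rep i = rep j \<longleftrightarrow> eqv i j" for i j
  proof
    assume "rep i = rep j"
    then show "eqv i j" using rep sym trans by metis
  next
    assume "eqv i j"
    then have "eqv i = eqv j" using sym trans by blast
    then show "rep i = rep j" by (simp add: rep_def)
  qed
  define R where "R r ns \<longleftrightarrow> Rel r (map Var ns) \<in> S" for r ns
  \<comment> \<open>Arguments are replaced one at a time from the right; the entry just treated
    joins the tail \<open>ns\<close>, which is why \<open>ns\<close> is arbitrary in the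
    induction.\<close>
  have eq_substs: "(Rel r (map Var (ms @ ns)) :: ('f, 'r) fm) \<in> S
      \<longleftrightarrow> (Rel r (map Var (map rep ms @ ns)) :: ('f, 'r) fm) \<in> S"
    if "r \<in> rels L" "length (ms @ ns) = rel_arity L r" for r ms ns
    using that
  proof (induction ms arbitrary: ns rule: rev_induct)
    case (snoc m ms)
    \<comment> \<open>A marker larger than every variable of the atom: updating the identity at
      \<open>N\<close> changes the marked position alone, even when \<open>m\<close> occurs
      elsewhere too.\<close>
    define N where "N = Suc (Max (set (ms @ m # ns)))"
    have N: "x \<noteq> N" if "x \<in> set ms \<union> set ns" for x
    proof -
      have "x \<le> Max (set (ms @ m # ns))" using that by (intro Max_ge) auto
      then show ?thesis by (simp add: N_def)
    qed
    let ?\<psi> = "Rel r (map Var (ms @ N # ns)) :: ('f, 'r) fm"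
    have wf: "wf_fm L ?\<psi>" using snoc.prems by (auto simp: list_all_iff)
    have ren: "rename (id(N := x)) ?\<psi> = Rel r (map Var (ms @ x # ns))" for x
      using N by auto
    have "Rel r (map Var (ms @ m # ns)) \<in> S \<longleftrightarrow> Rel r (map Var (ms @ rep m # ns)) \<in> S"
      using eq_subst[OF wf, of "id(N := m)" N "rep m"] eq_subst[OF wf, of "id(N := rep m)" N m]
        rep[of m] sym[OF rep[of m]] unfolding fun_upd_upd ren by auto
    moreover note snoc.IH[of "rep m # ns"] snoc.prems
    ultimately show ?case by simp
  qed simp
  \<comment> \<open>The claim covers all renamings because the quantifier case turns the choice of
    an element \<open>rep k\<close> into an extension of the renaming by \<open>k\<close>.\<close>
  have truth: "sat (range rep) F R (\<lambda>i. rep (\<rho> i)) \<psi> \<longleftrightarrow> rename \<rho> \<psi> \<in> S" if "wf_fm L \<psi>" for \<rho> \<psi>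
    using that
  proof (induction \<psi> arbitrary: \<rho>)
    case (Equal s t)
    then obtain i j where "s = Var i" "t = Var j" using wf_tm_no_funs[OF nf] by (meson wf_fm.simps(2))
    then show ?case by (simp add: rep_eq eqv_def)
  next
    case (Rel r ts)
    then obtain ns where ns: "ts = map Var ns" using wf_tms_no_funs[OF nf] by (meson wf_fm.simps(3))
    show ?case using eq_substs[of r "map \<rho> ns" "[]"] Rel ns by (simp add: R_def comp_def)
  next
    case (Imp \<psi> \<chi>)
    then show ?case using imp[of "rename \<rho> \<psi>" "rename \<rho> \<chi>"] by simp
  next
    case (Forall \<psi>)
    have 1: "case_nat (rep k) (\<lambda>i. rep (\<rho> i)) = (\<lambda>i. rep (case_nat k \<rho> i))" for k
      by (rule ext) (simp split: nat.split)
    have 2: "rename (case_nat k id) (rename (case_nat 0 (\<lambda>i. Suc (\<rho> i))) \<psi>) = rename (case_nat k \<rho>) \<psi>" for k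
      unfolding subst_fm_comp by (intro subst_fm_cong) (simp split: nat.split)
    show ?case using all[of "rename (case_nat 0 (\<lambda>i. Suc (\<rho> i))) \<psi>"] Forall
      by (simp only: sat.simps ball_simps 1 subst_fm.simps lift_rename 2 wf_fm_rename wf_fm.simps)
  qed (use bot in simp)
  show ?thesis
  proof (rule that[of "range rep" rep R])
    show "sat (range rep) F R rep \<gamma>" if "\<gamma> \<in> \<Gamma>" for \<gamma>
      using truth[of \<gamma> id] sent[OF that] that sub by (auto simp: id_def)
    show "\<not> sat (range rep) F R rep \<phi>"
      using truth[of \<phi> id] imp[of \<phi> "\<^bold>\<bottom>"] wf sub bot by (auto simp: id_def)
  qed auto
qed


section \<open>Set theory inside a model of ZFC\<close>

text \<open>The universe is the whole type, so set-theoretic quantifiers become HOL quantifiers; the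
  function interpretation is a dummy.\<close>

definition zf_sat :: "('m \<Rightarrow> 'm \<Rightarrow> bool) \<Rightarrow> (nat \<Rightarrow> 'm) \<Rightarrow> zf_fm \<Rightarrow> bool" where
  "zf_sat E = sat UNIV (\<lambda>_ _. undefined) (\<lambda>_ xs. E (xs ! 0) (xs ! 1))"

lemma zf_sat_simps [simp]:
  "\<not> zf_sat E e \<^bold>\<bottom>"
  "zf_sat E e (Var i \<^bold>= Var j) \<longleftrightarrow> e i = e j"
  "zf_sat E e (elem i j) \<longleftrightarrow> E (e i) (e j)"
  "zf_sat E e (\<phi> \<^bold>\<longrightarrow> \<psi>) \<longleftrightarrow> (zf_sat E e \<phi> \<longrightarrow> zf_sat E e \<psi>)"
  "zf_sat E e (Forall \<phi>) \<longleftrightarrow> (\<forall>x. zf_sat E (case_nat x e) \<phi>)"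
  "zf_sat E e (rename \<rho> \<phi>) \<longleftrightarrow> zf_sat E (\<lambda>n. e (\<rho> n)) \<phi>"
  by (simp_all add: zf_sat_def elem_def sat_rename)

lemma zf_sat_connectives [simp]:
  "zf_sat E e (\<^bold>\<not> \<phi>) \<longleftrightarrow> \<not> zf_sat E e \<phi>"
  "zf_sat E e (\<phi> \<^bold>\<or> \<psi>) \<longleftrightarrow> zf_sat E e \<phi> \<or> zf_sat E e \<psi>"
  "zf_sat E e (\<phi> \<^bold>\<and> \<psi>) \<longleftrightarrow> zf_sat E e \<phi> \<and> zf_sat E e \<psi>"
  "zf_sat E e (Exists \<phi>) \<longleftrightarrow> (\<exists>x. zf_sat E (case_nat x e) \<phi>)"
  "zf_sat E e (\<phi> \<^bold>\<longleftrightarrow> \<psi>) \<longleftrightarrow> (zf_sat E e \<phi> \<longleftrightarrow> zf_sat E e \<psi>)"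
  by auto

lemma wf_fm_elem [simp]: "wf_fm L_ZF (elem i j)"
  by (simp add: elem_def L_ZF_def)

text \<open>The assignment \<open>e\<close> in the two schemes supplies the parameters, so their
  number need not be mentioned. The remaining axioms are stated as HOL propositions.\<close>

locale zf =
  fixes E :: "'m \<Rightarrow> 'm \<Rightarrow> bool" (infix \<open>\<epsilon>\<close> 50)
  assumes extensionality: "(\<And>z. z \<epsilon> x \<longleftrightarrow> z \<epsilon> y) \<Longrightarrow> x = y"
    and foundation: "y \<epsilon> x \<Longrightarrow> \<exists>y. y \<epsilon> x \<and> \<not> (\<exists>z. z \<epsilon> x \<and> z \<epsilon> y)"
    and pairing: "\<exists>p. \<forall>z. z \<epsilon> p \<longleftrightarrow> z = x \<or> z = y"
    and union: "\<exists>u. \<forall>z. z \<epsilon> u \<longleftrightarrow> (\<exists>y. z \<epsilon> y \<and> y \<epsilon> x)"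
    and power: "\<exists>p. \<forall>z. z \<epsilon> p \<longleftrightarrow> (\<forall>w. w \<epsilon> z \<longrightarrow> w \<epsilon> x)"
    and infinity: "\<exists>x. (\<exists>e. e \<epsilon> x \<and> (\<forall>w. \<not> w \<epsilon> e)) \<and>
      (\<forall>y. y \<epsilon> x \<longrightarrow> (\<exists>s. s \<epsilon> x \<and> (\<forall>w. w \<epsilon> s \<longleftrightarrow> w \<epsilon> y \<or> w = y)))"
    and choice: "(\<And>x. x \<epsilon> F \<Longrightarrow> \<exists>w. w \<epsilon> x) \<Longrightarrow>
      (\<And>x y w. x \<epsilon> F \<Longrightarrow> y \<epsilon> F \<Longrightarrow> w \<epsilon> x \<Longrightarrow> w \<epsilon> y \<Longrightarrow> x = y) \<Longrightarrow>
      \<exists>c. \<forall>x. x \<epsilon> F \<longrightarrow> (\<exists>w. \<forall>v. v \<epsilon> x \<and> v \<epsilon> c \<longleftrightarrow> v = w)"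
    and separation: "wf_fm L_ZF \<phi> \<Longrightarrow> \<exists>y. \<forall>z. z \<epsilon> y \<longleftrightarrow> z \<epsilon> x \<and> zf_sat E (case_nat z e) \<phi>"
    and replacement: "wf_fm L_ZF \<phi> \<Longrightarrow>
      (\<And>x y z. zf_sat E (case_nat x (case_nat y e)) \<phi> \<Longrightarrow> zf_sat E (case_nat x (case_nat z e)) \<phi> \<Longrightarrow> y = z) \<Longrightarrow>
      \<exists>b. \<forall>y. y \<epsilon> b \<longleftrightarrow> (\<exists>x. x \<epsilon> a \<and> zf_sat E (case_nat x (case_nat y e)) \<phi>)"
begin

subsection \<open>Definability with parameters\<close>

text \<open>The even indices hold the arguments and the odd ones the parameters, so that the parameters
  of two formulas can be merged by a renaming.\<close>

definition definable :: "((nat \<Rightarrow> 'm) \<Rightarrow> bool) \<Rightarrow> bool" where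
  "definable P \<longleftrightarrow> (\<exists>\<phi> p. wf_fm L_ZF \<phi> \<and>
     (\<forall>e. P e \<longleftrightarrow> zf_sat E (\<lambda>i. if even i then e (i div 2) else p (i div 2)) \<phi>))"

definition def_term :: "((nat \<Rightarrow> 'm) \<Rightarrow> 'm) \<Rightarrow> bool" where
  "def_term f \<longleftrightarrow> definable (\<lambda>e. e 0 = f (\<lambda>i. e (Suc i)))"

text \<open>Each index of the formula is fed either by an argument or by a constant of the model;
  the renaming sends argument \<open>j\<close> to position \<open>2 * j\<close> and the constant of
  index \<open>i\<close> to the parameter position \<open>2 * i + 1\<close>. Through this lemma
  formulas with mixed assignments, such as translated ones, become definable relations.\<close>

lemma definable_sat:
  assumes wf: "wf_fm L_ZF \<phi>" and f: "\<And>i. (\<exists>j. f i = (\<lambda>e. e j)) \<or> (\<exists>c. f i = (\<lambda>e. c))"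
  shows "definable (\<lambda>e. zf_sat E (\<lambda>i. f i e) \<phi>)"
proof -
  have "\<forall>i. \<exists>k c. (\<forall>e. f i e = (case k of None \<Rightarrow> c | Some j \<Rightarrow> e j))"
  proof
    fix i
    from f[of i] show "\<exists>k c. \<forall>e. f i e = (case k of None \<Rightarrow> c | Some j \<Rightarrow> e j)"
    proof
      assume "\<exists>j. f i = (\<lambda>e. e j)"
      then obtain j where "f i = (\<lambda>e. e j)" ..
      then show ?thesis by (intro exI[of _ "Some j"]) simp
    next
      assume "\<exists>c. f i = (\<lambda>e. c)"
      then obtain c where "f i = (\<lambda>e. c)" ..
      then show ?thesis by (intro exI[of _ None] exI[of _ c]) simp
    qed
  qed
  then obtain k c where kc: "f i e = (case k i of None \<Rightarrow> c i | Some j \<Rightarrow> e j)" for i e by metis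
  define \<rho> where "\<rho> i = (case k i of None \<Rightarrow> 2 * i + 1 | Some j \<Rightarrow> 2 * j)" for i
  show ?thesis unfolding definable_def
  proof (intro exI conjI allI)
    show "wf_fm L_ZF (rename \<rho> \<phi>)" using wf by simp
    fix e
    have "(\<lambda>i. f i e) = (\<lambda>n. if even (\<rho> n) then e (\<rho> n div 2) else c (\<rho> n div 2))"
      by (rule ext) (simp add: kc \<rho>_def split: option.split)
    then show "zf_sat E (\<lambda>i. f i e) \<phi> \<longleftrightarrow>
        zf_sat E (\<lambda>i. if even i then e (i div 2) else c (i div 2)) (rename \<rho> \<phi>)"
      by (simp add: sat_rename)
  qed
qed

lemma definable_const: "definable (\<lambda>e. b)"
  unfolding definable_def by (cases b) (intro exI[of _ "\<^bold>\<bottom> \<^bold>\<longrightarrow> \<^bold>\<bottom>"] exI[of _ "\<^bold>\<bottom>"], simp)+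

lemma definable_imp:
  assumes "definable P" "definable Q"
  shows "definable (\<lambda>e. P e \<longrightarrow> Q e)"
proof -
  from assms(1) obtain \<phi> p where 1: "wf_fm L_ZF \<phi>"
    "\<And>e. P e \<longleftrightarrow> zf_sat E (\<lambda>i. if even i then e (i div 2) else p (i div 2)) \<phi>"
    unfolding definable_def by blast
  from assms(2) obtain \<psi> q where 2: "wf_fm L_ZF \<psi>"
    "\<And>e. Q e \<longleftrightarrow> zf_sat E (\<lambda>i. if even i then e (i div 2) else q (i div 2)) \<psi>"
    unfolding definable_def by blast
  \<comment> \<open>Parameter \<open>k\<close> of the first formula becomes parameter
    \<open>2 * k\<close> (position \<open>4 * k + 1\<close>), and parameter \<open>k\<close> of the
    second becomes \<open>2 * k + 1\<close> (position \<open>4 * k + 3\<close>); arguments stay in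
    place.\<close>
  define \<rho> \<rho>' where "\<rho> i = (if even i then i else 2 * i - 1)" and "\<rho>' i = (if even i then i else 2 * i + 1)" for i :: nat
  define r where "r i = (if even i then p (i div 2) else q (i div 2))" for i
  have r: "r (2 * k) = p k" "r (Suc (2 * k)) = q k" for k by (simp_all add: r_def)
  have 3: "(\<lambda>n. if even (\<rho> n) then e (\<rho> n div 2) else r (\<rho> n div 2)) = (\<lambda>i. if even i then e (i div 2) else p (i div 2))"
    "(\<lambda>n. if even (\<rho>' n) then e (\<rho>' n div 2) else r (\<rho>' n div 2)) = (\<lambda>i. if even i then e (i div 2) else q (i div 2))"
    (is "?l = ?r") for e
  proof -
    have "(if even (\<rho> n) then e (\<rho> n div 2) else r (\<rho> n div 2)) = (if even n then e (n div 2) else p (n div 2))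
      \<and> ?l n = ?r n" for n
    proof (cases "even n")
      case False
      then obtain k where n: "n = 2 * k + 1" by (elim oddE)
      have "\<rho> n = Suc (2 * (2 * k))" "\<rho>' n = Suc (2 * Suc (2 * k))" unfolding \<rho>_def \<rho>'_def n by simp_all
      then show ?thesis unfolding n by (simp add: r del: mult_Suc_right)
    qed (simp add: \<rho>_def \<rho>'_def)
    then show "(\<lambda>n. if even (\<rho> n) then e (\<rho> n div 2) else r (\<rho> n div 2)) = (\<lambda>i. if even i then e (i div 2) else p (i div 2))"
      "?l = ?r" by blast+
  qed
  show ?thesis unfolding definable_def
  proof (intro exI conjI allI)
    show "wf_fm L_ZF (rename \<rho> \<phi> \<^bold>\<longrightarrow> rename \<rho>' \<psi>)" using 1 2 by simp
    show "(P e \<longrightarrow> Q e) \<longleftrightarrow>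
        zf_sat E (\<lambda>i. if even i then e (i div 2) else r (i div 2)) (rename \<rho> \<phi> \<^bold>\<longrightarrow> rename \<rho>' \<psi>)" for e
      by (simp add: sat_rename 1 2 3)
  qed
qed

lemma definable_all:
  assumes "definable (\<lambda>e. P (e 0) (\<lambda>i. e (Suc i)))"
  shows "definable (\<lambda>e. \<forall>x. P x e)"
proof -
  from assms obtain \<phi> p where 1: "wf_fm L_ZF \<phi>"
    "\<And>e. P (e 0) (\<lambda>i. e (Suc i)) \<longleftrightarrow> zf_sat E (\<lambda>i. if even i then e (i div 2) else p (i div 2)) \<phi>"
    unfolding definable_def by blast
  \<comment> \<open>The quantifier occupies position 0 and shifts the interleaved assignment by one.
    Hence argument \<open>j + 1\<close>, expected at \<open>2 * j + 2\<close>, is found at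
    \<open>2 * j + 1\<close>, and parameter \<open>k\<close>, expected at \<open>2 * k + 1\<close>,
    is found at \<open>2 * k + 2\<close>.\<close>
  define \<rho> where "\<rho> i = (if i = 0 then 0 else if even i then i - 1 else i + 1)" for i :: nat
  have 2: "(\<lambda>n. case_nat x (\<lambda>i. if even i then e (i div 2) else p (i div 2)) (\<rho> n)) =
      (\<lambda>i. if even i then case_nat x e (i div 2) else p (i div 2))" (is "?l = ?r") for e x
  proof
    fix n show "?l n = ?r n"
    proof (cases "n = 0")
      case False
      show ?thesis
      proof (cases "even n")
        case True
        then obtain m where "n = 2 * m" by blast
        with False obtain k where "n = 2 * Suc k" by (cases m) auto
        then show ?thesis by (simp add: \<rho>_def)
      next
        case False
        then obtain m where "n = 2 * m + 1" by (elim oddE)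
        then show ?thesis by (simp add: \<rho>_def)
      qed
    qed (simp add: \<rho>_def)
  qed
  have 3: "P x e \<longleftrightarrow> zf_sat E (\<lambda>i. if even i then case_nat x e (i div 2) else p (i div 2)) \<phi>" for x e
    using 1(2)[of "case_nat x e"] by simp
  show ?thesis unfolding definable_def
  proof (intro exI conjI allI)
    show "wf_fm L_ZF (Forall (rename \<rho> \<phi>))" using 1 by simp
    show "(\<forall>x. P x e) \<longleftrightarrow>
        zf_sat E (\<lambda>i. if even i then e (i div 2) else p (i div 2)) (Forall (rename \<rho> \<phi>))" for e
      by (simp add: sat_rename 2 3)
  qed
qed

lemma definable_rename:
  assumes "definable P"
  shows "definable (\<lambda>e. P (\<lambda>i. e (h i)))"
proof -
  from assms obtain \<phi> p where 1: "wf_fm L_ZF \<phi>"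
    "\<And>e. P e \<longleftrightarrow> zf_sat E (\<lambda>i. if even i then e (i div 2) else p (i div 2)) \<phi>"
    unfolding definable_def by blast
  define \<rho> where "\<rho> i = (if even i then 2 * h (i div 2) else i)" for i :: nat
  have 2: "(\<lambda>n. if even (\<rho> n) then e (\<rho> n div 2) else p (\<rho> n div 2)) =
     (\<lambda>i. if even i then e (h (i div 2)) else p (i div 2))" for e
    by (auto simp: fun_eq_iff \<rho>_def)
  show ?thesis unfolding definable_def
  proof (intro exI conjI allI)
    show "wf_fm L_ZF (rename \<rho> \<phi>)" using 1 by simp
    show "P (\<lambda>i. e (h i)) \<longleftrightarrow>
        zf_sat E (\<lambda>i. if even i then e (i div 2) else p (i div 2)) (rename \<rho> \<phi>)" for e
      by (simp add: sat_rename 1 2)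
  qed
qed

lemma definable_elem_var: "definable (\<lambda>e. e i \<epsilon> e j)"
proof -
  have "(\<exists>l. (\<lambda>e. if k = 0 then e i else e j) = (\<lambda>e. e l :: 'm)) \<or>
      (\<exists>c. (\<lambda>e. if k = 0 then e i else e j) = (\<lambda>e. c))" for k :: nat
    by (cases k) auto
  from definable_sat[of "elem 0 1" "\<lambda>k e. if k = 0 then e i else e j", OF _ this] show ?thesis
    by simp
qed

lemma definable_eq_var: "definable (\<lambda>e. e i = e j)"
proof -
  have "(\<exists>l. (\<lambda>e. if k = 0 then e i else e j) = (\<lambda>e. e l :: 'm)) \<or>
      (\<exists>c. (\<lambda>e. if k = 0 then e i else e j) = (\<lambda>e. c))" for k :: nat
    by (cases k) auto
  from definable_sat[of "Var 0 \<^bold>= Var 1" "\<lambda>k e. if k = 0 then e i else e j", OF _ this] show ?thesis by simp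
qed

lemma definable_eq_const: "definable (\<lambda>e. e i = c)"
proof -
  have "(\<exists>l. (\<lambda>e. if k = 0 then e i else c) = (\<lambda>e. e l :: 'm)) \<or>
      (\<exists>c'. (\<lambda>e. if k = 0 then e i else c) = (\<lambda>e. c'))" for k :: nat
    by (cases k) auto
  from definable_sat[of "Var 0 \<^bold>= Var 1" "\<lambda>k e. if k = 0 then e i else c", OF _ this] show ?thesis by simp
qed

text \<open>Closure rules that follow the shape of the abstracted proposition or term, so that
  \<open>intro dfi\<close> settles most definability goals.\<close>

named_theorems dfi

lemmas [dfi] = definable_const definable_imp definable_all

lemma definable_not [dfi]: "definable P \<Longrightarrow> definable (\<lambda>e. \<not> P e)"
  using definable_imp[OF _ definable_const[of False]] by simp

lemma definable_or [dfi]: "definable P \<Longrightarrow> definable Q \<Longrightarrow> definable (\<lambda>e. P e \<or> Q e)"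
  using definable_imp[OF definable_not, of P Q] by (simp add: disj_imp)

lemma definable_and [dfi]: "definable P \<Longrightarrow> definable Q \<Longrightarrow> definable (\<lambda>e. P e \<and> Q e)"
  using definable_not[OF definable_imp[OF _ definable_not, of P Q]] by simp

lemma definable_iff [dfi]: "definable P \<Longrightarrow> definable Q \<Longrightarrow> definable (\<lambda>e. P e \<longleftrightarrow> Q e)"
  using definable_and[OF definable_imp definable_imp, of P Q Q P] by (simp add: iff_conv_conj_imp)

lemma definable_ex [dfi]:
  "definable (\<lambda>e. P (e 0) (\<lambda>i. e (Suc i))) \<Longrightarrow> definable (\<lambda>e. \<exists>x. P x e)"
  using definable_not[OF definable_all[OF definable_not, of P]] by simp

text \<open>In a language without function symbols a definable value is inserted by naming it with
  an existential quantifier.\<close>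

lemma definable_term:
  assumes "definable (\<lambda>e. P (e 0) (\<lambda>i. e (Suc i)))" "def_term f"
  shows "definable (\<lambda>e. P (f e) e)"
proof -
  have "definable (\<lambda>e. \<exists>x. x = f e \<and> P x e)"
    by (intro dfi assms(1) assms(2)[unfolded def_term_def])
  then show ?thesis by simp
qed

lemma def_term_rename: "def_term f \<Longrightarrow> def_term (\<lambda>e. f (\<lambda>i. e (h i)))"
  unfolding def_term_def
  by (drule definable_rename[where h = "case_nat 0 (\<lambda>i. Suc (h i))"]) simp

lemma def_term_var [dfi]: "def_term (\<lambda>e. e i)"
  unfolding def_term_def by (rule definable_eq_var)

lemma def_term_const [dfi]: "def_term (\<lambda>e. c)"
  unfolding def_term_def by (rule definable_eq_const)

lemma definable_comp1: "definable (\<lambda>e. P (e 0)) \<Longrightarrow> def_term f \<Longrightarrow> definable (\<lambda>e. P (f e))"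
  by (rule definable_term[where P = "\<lambda>x e. P x"])

lemma definable_comp2:
  assumes "definable (\<lambda>e. P (e 0) (e (Suc 0)))" "def_term f" "def_term g"
  shows "definable (\<lambda>e. P (f e) (g e))"
proof -
  have "definable (\<lambda>e. P (e (Suc 0)) (e 0))"
    using definable_rename[OF assms(1), of "\<lambda>i. 1 - i"] by simp
  then have "definable (\<lambda>e. P (e 0) (g (\<lambda>i. e (Suc i))))"
    by (rule definable_term[where P = "\<lambda>x e. P (e 0) x"]) (rule def_term_rename, rule assms)
  then show ?thesis
    by (rule definable_term[where P = "\<lambda>x e. P x (g e)"]) (rule assms)
qed

lemma definable_comp3:
  assumes "definable (\<lambda>e. P (e 0) (e (Suc 0)) (e (Suc (Suc 0))))" "def_term f" "def_term g" "def_term h"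
  shows "definable (\<lambda>e. P (f e) (g e) (h e))"
proof -
  have "definable (\<lambda>e. P (e (Suc 0)) (e (Suc (Suc 0))) (e 0))"
    using definable_rename[OF assms(1), of "\<lambda>i. if i = 2 then 0 else Suc i"] by simp
  then have "definable (\<lambda>e. P (e 0) (e (Suc 0)) (h (\<lambda>i. e (Suc (Suc i)))))"
    by (rule definable_term[where P = "\<lambda>x e. P (e 0) (e (Suc 0)) x"])
       (rule def_term_rename[where h = "\<lambda>i. Suc (Suc i)"], rule assms)
  then have "definable (\<lambda>e. P (e (Suc 0)) (e 0) (h (\<lambda>i. e (Suc (Suc i)))))"
    by (drule_tac definable_rename[where h = "\<lambda>i. if i = 0 then 1 else if i = 1 then 0 else i"]) simp
  then have "definable (\<lambda>e. P (e 0) (g (\<lambda>i. e (Suc i))) (h (\<lambda>i. e (Suc i))))"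
    by (rule definable_term[where P = "\<lambda>x e. P (e 0) x (h (\<lambda>i. e (Suc i)))"]) (rule def_term_rename, rule assms)
  then show ?thesis
    by (rule definable_term[where P = "\<lambda>x e. P x (g e) (h e)"]) (rule assms)
qed

lemma def_term_comp1:
  assumes "def_term (\<lambda>e. F (e 0))" "def_term f"
  shows "def_term (\<lambda>e. F (f e))"
  using definable_comp2[of "\<lambda>x y. x = F y", OF assms(1)[unfolded def_term_def]
      def_term_var[of 0] def_term_rename[OF assms(2), of Suc]]
  unfolding def_term_def .

lemma def_term_comp2:
  assumes "def_term (\<lambda>e. F (e 0) (e (Suc 0)))" "def_term f" "def_term g"
  shows "def_term (\<lambda>e. F (f e) (g e))"
  using definable_comp3[of "\<lambda>x y z. x = F y z", OF assms(1)[unfolded def_term_def]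
      def_term_var[of 0] def_term_rename[OF assms(2), of Suc] def_term_rename[OF assms(3), of Suc]]
  unfolding def_term_def .

lemma definable_elem [dfi]: "def_term f \<Longrightarrow> def_term g \<Longrightarrow> definable (\<lambda>e. f e \<epsilon> g e)"
  by (rule definable_comp2) (rule definable_elem_var)

lemma definable_eq [dfi]: "def_term f \<Longrightarrow> def_term g \<Longrightarrow> definable (\<lambda>e. f e = g e)"
  by (rule definable_comp2) (rule definable_eq_var)

lemma def_term_if [dfi]:
  assumes "definable P" "def_term f" "def_term g"
  shows "def_term (\<lambda>e. if P e then f e else g e)"
proof -
  have "definable (\<lambda>e. (P (\<lambda>i. e (Suc i)) \<and> e 0 = f (\<lambda>i. e (Suc i))) \<or>
      (\<not> P (\<lambda>i. e (Suc i)) \<and> e 0 = g (\<lambda>i. e (Suc i))))"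
    by (intro dfi definable_rename[OF assms(1)] def_term_rename[OF assms(2)] def_term_rename[OF assms(3)])
  moreover have "x = (if b then u else v) \<longleftrightarrow> (b \<and> x = u) \<or> (\<not> b \<and> x = v)" for b and x u v :: 'm
    by auto
  ultimately show ?thesis unfolding def_term_def by (simp only:)
qed

text \<open>Definite description; unlike \<open>The\<close>, its junk value does not depend on the predicate, which
  keeps it definable.\<close>

definition tha :: "('m \<Rightarrow> bool) \<Rightarrow> 'm" where
  "tha P = (if \<exists>!x. P x then THE x. P x else undefined)"

lemma tha_equality: "P a \<Longrightarrow> (\<And>x. P x \<Longrightarrow> x = a) \<Longrightarrow> tha P = a"
  unfolding tha_def by (subst if_P) (rule ex1I, assumption+, rule the_equality)

lemma def_term_tha [dfi]:
  assumes "definable (\<lambda>e. P (e 0) (\<lambda>i. e (Suc i)))"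
  shows "def_term (\<lambda>e. tha (\<lambda>x. P x e))"
proof -
  have 1: "definable (\<lambda>e. P (e 0) (\<lambda>i. e (Suc (Suc i))))"
    using definable_rename[OF assms, of "\<lambda>i. if i = 0 then 0 else Suc i"] by simp
  have 2: "definable (\<lambda>e. P (e 0) (\<lambda>i. e (Suc (Suc (Suc i)))))"
    using definable_rename[OF assms, of "\<lambda>i. if i = 0 then 0 else Suc (Suc i)"] by simp
  have "definable (\<lambda>e. (P (e 0) (\<lambda>i. e (Suc i)) \<and> (\<forall>y. P y (\<lambda>i. e (Suc i)) \<longrightarrow> y = e 0)) \<or>
     (\<not> (\<exists>x. P x (\<lambda>i. e (Suc i)) \<and> (\<forall>y. P y (\<lambda>i. e (Suc i)) \<longrightarrow> y = x)) \<and> e 0 = undefined))"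
    by (intro dfi assms 1 2)
  moreover have "x = tha Q \<longleftrightarrow> (Q x \<and> (\<forall>y. Q y \<longrightarrow> y = x)) \<or>
     (\<not> (\<exists>x. Q x \<and> (\<forall>y. Q y \<longrightarrow> y = x)) \<and> x = undefined)" for x Q
  proof (cases "\<exists>!x. Q x")
    case True
    then obtain a where "Q a" "\<And>y. Q y \<Longrightarrow> y = a" by (elim ex1E) blast
    moreover from this have "tha Q = a" by (rule tha_equality)
    ultimately show ?thesis by metis
  next
    case False
    then have "tha Q = undefined" unfolding tha_def by (rule if_not_P)
    with False show ?thesis by metis
  qed
  ultimately show ?thesis unfolding def_term_def by (simp only:)
qed

subsection \<open>Sets and classes\<close>

definition is_set :: "('m \<Rightarrow> bool) \<Rightarrow> bool" where
  "is_set P \<longleftrightarrow> (\<exists>x. \<forall>z. z \<epsilon> x \<longleftrightarrow> P z)"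

text \<open>For a proper class the value is the default of \<open>tha\<close>; membership is
  therefore known only under \<open>is_set\<close>.\<close>

definition cl :: "('m \<Rightarrow> bool) \<Rightarrow> 'm" where
  "cl P = tha (\<lambda>x. \<forall>z. z \<epsilon> x \<longleftrightarrow> P z)"

lemma def_term_cl [dfi]:
  assumes "definable (\<lambda>e. P (e 0) (\<lambda>i. e (Suc i)))"
  shows "def_term (\<lambda>e. cl (\<lambda>x. P x e))"
proof -
  have 1: "definable (\<lambda>e. P (e 0) (\<lambda>i. e (Suc (Suc i))))"
    using definable_rename[OF assms, of "\<lambda>i. if i = 0 then 0 else Suc i"] by simp
  show ?thesis unfolding cl_def by (intro dfi 1)
qed

lemma cl_eqI: "(\<And>z. z \<epsilon> x \<longleftrightarrow> P z) \<Longrightarrow> cl P = x"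
  unfolding cl_def by (rule tha_equality) (auto intro: extensionality)

lemma elem_cl: "is_set P \<Longrightarrow> z \<epsilon> cl P \<longleftrightarrow> P z"
  unfolding is_set_def using cl_eqI by metis

lemma is_set_cong: "is_set P \<Longrightarrow> (\<And>z. P z \<longleftrightarrow> Q z) \<Longrightarrow> is_set Q"
  unfolding is_set_def by simp

lemma is_set_elem [simp]: "is_set (\<lambda>z. z \<epsilon> x)"
  unfolding is_set_def by blast

lemma is_set_sep:
  assumes "is_set Q" "definable (\<lambda>e. P (e 0))" "\<And>z. P z \<Longrightarrow> Q z"
  shows "is_set P"
proof -
  from assms(2) obtain \<phi> p where 1: "wf_fm L_ZF \<phi>"
    "\<And>e. P (e 0) \<longleftrightarrow> zf_sat E (\<lambda>i. if even i then e (i div 2) else p (i div 2)) \<phi>"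
    unfolding definable_def by blast
  \<comment> \<open>\<open>P\<close> depends on argument 0 alone, so all even positions may be
    merged into the element; parameter \<open>k\<close> moves to index \<open>k + 1\<close>.\<close>
  define \<rho> where "\<rho> i = (if even i then 0 else Suc (i div 2))" for i :: nat
  have "(\<lambda>n. case_nat z p (\<rho> n)) = (\<lambda>i. if even i then z else p (i div 2))" for z
    by (auto simp: \<rho>_def)
  then have 2: "P z \<longleftrightarrow> zf_sat E (case_nat z p) (rename \<rho> \<phi>)" for z
    using 1(2)[of "\<lambda>_. z"] by (simp add: sat_rename)
  from separation[of "rename \<rho> \<phi>" "cl Q" p] 1(1) obtain y where "\<forall>z. z \<epsilon> y \<longleftrightarrow> z \<epsilon> cl Q \<and> P z"
    by (auto simp: 2)
  then show ?thesis using assms(3) elem_cl[OF assms(1)] unfolding is_set_def by blast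
qed

lemma is_set_image:
  assumes "is_set Q" "def_term (\<lambda>e. F (e 0))"
  shows "is_set (\<lambda>w. \<exists>z. Q z \<and> w = F z)"
proof -
  have "definable (\<lambda>e. e (Suc 0) = F (e 0))"
    by (intro dfi assms)
  then obtain \<phi> p where 1: "wf_fm L_ZF \<phi>"
    "\<And>e. e (Suc 0) = F (e 0) \<longleftrightarrow> zf_sat E (\<lambda>i. if even i then e (i div 2) else p (i div 2)) \<phi>"
    unfolding definable_def by blast
  \<comment> \<open>Position 0 is the argument, all other even positions are merged into the value
    at index 1, and parameter \<open>k\<close> moves to index \<open>k + 2\<close>.\<close>
  define \<rho> where "\<rho> i = (if i = 0 then 0 else if even i then 1 else Suc (Suc (i div 2)))" for i :: nat
  have "(\<lambda>n. case_nat x (case_nat y p) (\<rho> n)) =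
      (\<lambda>i. if even i then if i div 2 = 0 then x else y else p (i div 2))" for x y
    by (rule ext) (auto simp: \<rho>_def elim!: evenE)
  then have 2: "zf_sat E (case_nat x (case_nat y p)) (rename \<rho> \<phi>) \<longleftrightarrow> y = F x" for x y
    using 1(2)[of "\<lambda>i. if i = 0 then x else y"] by (simp add: sat_rename)
  from replacement[of "rename \<rho> \<phi>" p "cl Q"] 1(1) obtain b where "\<forall>y. y \<epsilon> b \<longleftrightarrow> (\<exists>x. x \<epsilon> cl Q \<and> y = F x)"
    unfolding zf_sat_simps 2[unfolded zf_sat_simps] by auto
  then show ?thesis unfolding is_set_def elem_cl[OF assms(1)] by blast
qed

definition Uni :: "'m \<Rightarrow> 'm" where "Uni x = cl (\<lambda>z. \<exists>y. z \<epsilon> y \<and> y \<epsilon> x)"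

lemma elem_Uni: "z \<epsilon> Uni x \<longleftrightarrow> (\<exists>y. z \<epsilon> y \<and> y \<epsilon> x)"
  unfolding Uni_def by (rule elem_cl) (use union in \<open>auto simp: is_set_def\<close>)

lemma is_set_Union:
  assumes "is_set Q" "def_term (\<lambda>e. F (e 0))"
  shows "is_set (\<lambda>w. \<exists>z. Q z \<and> w \<epsilon> F z)"
proof -
  have "is_set (\<lambda>w. w \<epsilon> Uni (cl (\<lambda>w. \<exists>z. Q z \<and> w = F z)))" by simp
  then show ?thesis unfolding elem_Uni elem_cl[OF is_set_image[OF assms]] by (rule is_set_cong) blast
qed

text \<open>For fixed \<open>x\<close> the values form a set by replacement, and the union of these
  sets over \<open>x\<close> is again a set. Definability of \<open>Q\<close> is what makes the
  inner set a definable function of \<open>x\<close>.\<close>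

lemma is_set_image2:
  assumes "is_set P" "is_set Q" "definable (\<lambda>e. Q (e 0))" "def_term (\<lambda>e. F (e 0) (e (Suc 0)))"
  shows "is_set (\<lambda>w. \<exists>x y. P x \<and> Q y \<and> w = F x y)"
proof -
  have *: "is_set (\<lambda>w. \<exists>y. Q y \<and> w = F x y)" for x
    by (rule is_set_image[OF assms(2)]) (intro def_term_comp2[OF assms(4)] dfi)
  have "is_set (\<lambda>w. \<exists>x. P x \<and> w \<epsilon> cl (\<lambda>w. \<exists>y. Q y \<and> w = F x y))"
    by (rule is_set_Union[OF assms(1)])
      (intro dfi def_term_comp2[OF assms(4)] definable_comp1[OF assms(3)])
  then show ?thesis unfolding elem_cl[OF *] by (rule is_set_cong) blast
qed

definition upair :: "'m \<Rightarrow> 'm \<Rightarrow> 'm" where "upair x y = cl (\<lambda>z. z = x \<or> z = y)"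

lemma elem_upair: "z \<epsilon> upair x y \<longleftrightarrow> z = x \<or> z = y"
  unfolding upair_def by (rule elem_cl) (use pairing in \<open>simp add: is_set_def\<close>)

definition opair :: "'m \<Rightarrow> 'm \<Rightarrow> 'm" where "opair x y = upair (upair x x) (upair x y)"

lemma upair_eq_iff: "upair x y = upair a b \<longleftrightarrow> (x = a \<and> y = b) \<or> (x = b \<and> y = a)"
proof
  assume "upair x y = upair a b"
  then have "z = x \<or> z = y \<longleftrightarrow> z = a \<or> z = b" for z using elem_upair by metis
  then show "(x = a \<and> y = b) \<or> (x = b \<and> y = a)" by metis
qed (auto intro: extensionality simp: elem_upair)

lemma opair_inject [simp]: "opair x y = opair a b \<longleftrightarrow> x = a \<and> y = b"
  unfolding opair_def by (auto simp: upair_eq_iff)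

lemma def_term_upair [dfi]: "def_term f \<Longrightarrow> def_term g \<Longrightarrow> def_term (\<lambda>e. upair (f e) (g e))"
  by (rule def_term_comp2, unfold upair_def) (intro dfi)+

lemma def_term_opair [dfi]: "def_term f \<Longrightarrow> def_term g \<Longrightarrow> def_term (\<lambda>e. opair (f e) (g e))"
  unfolding opair_def by (intro dfi)

lemma is_set_or:
  assumes "is_set P" "is_set Q"
  shows "is_set (\<lambda>z. P z \<or> Q z)"
proof -
  have "is_set (\<lambda>z. z \<epsilon> Uni (upair (cl P) (cl Q)))" by simp
  then show ?thesis unfolding elem_Uni elem_upair
    by (rule is_set_cong) (use elem_cl[OF assms(1)] elem_cl[OF assms(2)] in blast)
qed

lemma is_set_eq [simp]: "is_set (\<lambda>z. z = x)"
  using is_set_elem[of "upair x x"] by (simp add: elem_upair)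

lemma is_set_power: "is_set (\<lambda>z. \<forall>w. w \<epsilon> z \<longrightarrow> w \<epsilon> x)"
  using power by (simp add: is_set_def)

lemma elem_irrefl [simp]: "\<not> x \<epsilon> x"
  using foundation[of x "upair x x"] by (auto simp: elem_upair)

lemma elem_asym: "x \<epsilon> y \<Longrightarrow> \<not> y \<epsilon> x"
  using foundation[of x "upair x y"] by (auto simp: elem_upair)


subsection \<open>Recursion\<close>

text \<open>An approximation to the recursion: a set of pairs with domain closed downwards under
  \<open>R\<close>. \<open>H\<close> receives only the image of the predecessors, which is enough
  both for a collapse and for choosing values that have not occurred before.\<close>

definition attempt :: "('m \<Rightarrow> 'm \<Rightarrow> bool) \<Rightarrow> ('m \<Rightarrow> 'm) \<Rightarrow> 'm \<Rightarrow> bool" where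
  "attempt R H f \<longleftrightarrow> (\<forall>y v. opair y v \<epsilon> f \<longrightarrow>
     (\<forall>z. R z y \<longrightarrow> (\<exists>w. opair z w \<epsilon> f)) \<and> v = H (cl (\<lambda>w. \<exists>z. R z y \<and> opair z w \<epsilon> f)))"

definition recur :: "('m \<Rightarrow> 'm \<Rightarrow> bool) \<Rightarrow> ('m \<Rightarrow> 'm) \<Rightarrow> 'm \<Rightarrow> 'm" where
  "recur R H x = tha (\<lambda>v. \<exists>f. attempt R H f \<and> opair x v \<epsilon> f)"

text \<open>Minimal elements are required for definable properties only, since the relation need not
  be well-founded in HOL. Transitivity makes the predecessors of a point a downward closed domain
  for attempts.\<close>

definition def_wf :: "('m \<Rightarrow> 'm \<Rightarrow> bool) \<Rightarrow> bool" where
  "def_wf R \<longleftrightarrow> definable (\<lambda>e. R (e 0) (e (Suc 0))) \<and> (\<forall>x. is_set (\<lambda>z. R z x)) \<and>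
     (\<forall>x y z. R x y \<longrightarrow> R y z \<longrightarrow> R x z) \<and>
     (\<forall>P x. definable (\<lambda>e. P (e 0)) \<longrightarrow> P x \<longrightarrow> (\<exists>x. P x \<and> (\<forall>y. R y x \<longrightarrow> \<not> P y)))"

context
  fixes R :: "'m \<Rightarrow> 'm \<Rightarrow> bool" and H :: "'m \<Rightarrow> 'm"
  assumes R: "def_wf R" and H: "def_term (\<lambda>e. H (e 0))"
begin

lemma def_wf_definable: "def_term f \<Longrightarrow> def_term g \<Longrightarrow> definable (\<lambda>e. R (f e) (g e))"
  by (rule definable_comp2) (use R in \<open>auto simp: def_wf_def\<close>)

lemma def_wf_trans: "R x y \<Longrightarrow> R y z \<Longrightarrow> R x z"
  using R unfolding def_wf_def by blast

lemma def_wf_minimal: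
  assumes "definable (\<lambda>e. P (e 0))" "P x"
  shows "\<exists>x. P x \<and> (\<forall>y. R y x \<longrightarrow> \<not> P y)"
  by (rule R[unfolded def_wf_def, THEN conjunct2, THEN conjunct2, THEN conjunct2, rule_format])
    (rule assms)+

lemma def_wf_induct:
  assumes "definable (\<lambda>e. P (e 0))" "\<And>x. (\<And>y. R y x \<Longrightarrow> P y) \<Longrightarrow> P x"
  shows "P x"
proof (rule ccontr)
  assume "\<not> P x"
  moreover have "definable (\<lambda>e. \<not> P (e 0))" by (intro dfi assms)
  ultimately obtain x where "\<not> P x" "\<forall>y. R y x \<longrightarrow> P y"
    using def_wf_minimal[of "\<lambda>x. \<not> P x" x] by blast
  then show False using assms(2) by blast
qed

lemma def_wf_irrefl: "\<not> R x x"
proof -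
  have "definable (\<lambda>e. e 0 = x)" by (intro dfi)
  then show ?thesis using def_wf_minimal[of "\<lambda>y. y = x" x] by blast
qed

lemma definable_attempt: "def_term f \<Longrightarrow> definable (\<lambda>e. attempt R H (f e))"
  by (rule definable_comp1, unfold attempt_def) (intro dfi def_wf_definable def_term_comp1[OF H])+

lemma def_term_recur: "def_term f \<Longrightarrow> def_term (\<lambda>e. recur R H (f e))"
  by (rule def_term_comp1, unfold recur_def) (intro dfi definable_attempt)+

lemma attempt_closed: "attempt R H f \<Longrightarrow> opair y v \<epsilon> f \<Longrightarrow> R z y \<Longrightarrow> \<exists>w. opair z w \<epsilon> f"
  unfolding attempt_def by blast

lemma attempt_value:
  "attempt R H f \<Longrightarrow> opair y v \<epsilon> f \<Longrightarrow> v = H (cl (\<lambda>w. \<exists>z. R z y \<and> opair z w \<epsilon> f))"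
  unfolding attempt_def by blast

text \<open>At a point where both are defined, both are also defined at all predecessors and agree
  there, so \<open>H\<close> is applied to the same set.\<close>

lemma attempt_unique:
  assumes f: "attempt R H f" and g: "attempt R H g"
  shows "\<forall>v w. opair x v \<epsilon> f \<longrightarrow> opair x w \<epsilon> g \<longrightarrow> v = w"
proof (rule def_wf_induct[where x = x and P = "\<lambda>x. \<forall>v w. opair x v \<epsilon> f \<longrightarrow> opair x w \<epsilon> g \<longrightarrow> v = w"])
  show "definable (\<lambda>e. \<forall>v w. opair (e 0) v \<epsilon> f \<longrightarrow> opair (e 0) w \<epsilon> g \<longrightarrow> v = w)"
    by (intro dfi)
  fix x
  assume IH: "\<And>y. R y x \<Longrightarrow> \<forall>v w. opair y v \<epsilon> f \<longrightarrow> opair y w \<epsilon> g \<longrightarrow> v = w"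
  show "\<forall>v w. opair x v \<epsilon> f \<longrightarrow> opair x w \<epsilon> g \<longrightarrow> v = w"
  proof (intro allI HOL.impI)
    fix v w assume v: "opair x v \<epsilon> f" and w: "opair x w \<epsilon> g"
    have "(\<lambda>u. \<exists>z. R z x \<and> opair z u \<epsilon> f) = (\<lambda>u. \<exists>z. R z x \<and> opair z u \<epsilon> g)"
      using attempt_closed[OF f v] attempt_closed[OF g w] IH by (intro ext) metis
    then show "v = w" using attempt_value[OF f v] attempt_value[OF g w] by simp
  qed
qed

lemma attempt_recur: "attempt R H f \<Longrightarrow> opair x v \<epsilon> f \<Longrightarrow> recur R H x = v"
  unfolding recur_def by (rule tha_equality) (use attempt_unique in blast)+

lemma is_set_recur: "is_set (\<lambda>w. \<exists>z. R z x \<and> w = recur R H z)"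
  by (rule is_set_image) (use R in \<open>auto simp: def_wf_def intro: def_term_recur def_term_var\<close>)

lemma attempt_image:
  assumes "attempt R H f" "opair x v \<epsilon> f"
  shows "v = H (cl (\<lambda>w. \<exists>z. R z x \<and> w = recur R H z))"
proof -
  have "(\<lambda>w. \<exists>z. R z x \<and> opair z w \<epsilon> f) = (\<lambda>w. \<exists>z. R z x \<and> w = recur R H z)"
    using attempt_closed[OF assms] attempt_recur[OF assms(1)] by (intro ext) metis
  then show ?thesis using attempt_value[OF assms] by simp
qed

lemma attempt_ex: "\<exists>f v. attempt R H f \<and> opair x v \<epsilon> f"
proof (rule def_wf_induct[where x = x and P = "\<lambda>x. \<exists>f v. attempt R H f \<and> opair x v \<epsilon> f"])
  show "definable (\<lambda>e. \<exists>f v. attempt R H f \<and> opair (e 0) v \<epsilon> f)"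
    by (intro dfi definable_attempt)
  fix x
  assume IH: "\<And>y. R y x \<Longrightarrow> \<exists>f v. attempt R H f \<and> opair y v \<epsilon> f"
  have IH': "\<exists>f. attempt R H f \<and> opair y (recur R H y) \<epsilon> f" if "R y x" for y
    using IH[OF that] attempt_recur by blast
  define v where "v = H (cl (\<lambda>w. \<exists>z. R z x \<and> w = recur R H z))"
  \<comment> \<open>The new attempt collects the values already determined below \<open>x\<close>, a
    set by replacement, and adds one pair at \<open>x\<close>. Irreflexivity of \<open>R\<close>
    keeps that pair from interfering with those below.\<close>
  define Q where "Q p \<longleftrightarrow> (\<exists>z. R z x \<and> p = opair z (recur R H z)) \<or> p = opair x v" for p
  have "is_set (\<lambda>p. \<exists>z. R z x \<and> p = opair z (recur R H z))"
    by (rule is_set_image) (use R in \<open>auto simp: def_wf_def intro!: def_term_opair def_term_recur def_term_var\<close>)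
  then have "is_set Q" unfolding Q_def by (intro is_set_or) simp_all
  then obtain f where f: "\<And>p. p \<epsilon> f \<longleftrightarrow> Q p" unfolding is_set_def by blast
  have below: "opair z w \<epsilon> f \<longleftrightarrow> w = recur R H z" if "R z x" for z w
    using that def_wf_irrefl unfolding f Q_def by auto
  have "attempt R H f"
    unfolding attempt_def
  proof (intro allI HOL.impI)
    fix y u assume "opair y u \<epsilon> f"
    then consider "R y x" "u = recur R H y" | "y = x" "u = v" unfolding f Q_def by auto
    then show "(\<forall>z. R z y \<longrightarrow> (\<exists>w. opair z w \<epsilon> f)) \<and> u = H (cl (\<lambda>w. \<exists>z. R z y \<and> opair z w \<epsilon> f))"
    proof cases
      case 1
      obtain g where g: "attempt R H g" "opair y u \<epsilon> g" using IH'[OF 1(1)] 1(2) by blast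
      have "(\<lambda>w. \<exists>z. R z y \<and> opair z w \<epsilon> f) = (\<lambda>w. \<exists>z. R z y \<and> w = recur R H z)"
        using below def_wf_trans[OF _ 1(1)] by (intro ext) metis
      then show ?thesis using attempt_image[OF g] below def_wf_trans[OF _ 1(1)] by auto
    next
      case 2
      have "(\<lambda>w. \<exists>z. R z y \<and> opair z w \<epsilon> f) = (\<lambda>w. \<exists>z. R z x \<and> w = recur R H z)"
        using below 2 by (intro ext) metis
      then show ?thesis using below 2 v_def by auto
    qed
  qed
  moreover have "opair x v \<epsilon> f" unfolding f Q_def by simp
  ultimately show "\<exists>f v. attempt R H f \<and> opair x v \<epsilon> f" by blast
qed

text \<open>Expresses the recursion by the existence of an attempt, the form in which a first-order
  formula can state it.\<close>

lemma recur_iff: "v = recur R H x \<longleftrightarrow> (\<exists>f. attempt R H f \<and> opair x v \<epsilon> f)"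
  using attempt_ex[of x] attempt_recur by metis

lemma recur_eq: "recur R H x = H (cl (\<lambda>w. \<exists>z. R z x \<and> w = recur R H z))"
proof -
  from attempt_ex[of x] obtain f v where f: "attempt R H f" "opair x v \<epsilon> f" by blast
  show ?thesis using attempt_recur[OF f] attempt_image[OF f] by simp
qed

end


subsection \<open>Ordinals\<close>

definition tran :: "'m \<Rightarrow> bool" where
  "tran x \<longleftrightarrow> (\<forall>y. y \<epsilon> x \<longrightarrow> (\<forall>z. z \<epsilon> y \<longrightarrow> z \<epsilon> x))"

text \<open>A transitive set of transitive sets; foundation makes these exactly the von Neumann
  ordinals.\<close>

definition ord :: "'m \<Rightarrow> bool" where
  "ord x \<longleftrightarrow> tran x \<and> (\<forall>y. y \<epsilon> x \<longrightarrow> tran y)"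

lemma definable_ord [dfi]: "def_term f \<Longrightarrow> definable (\<lambda>e. ord (f e))"
  by (rule definable_comp1, unfold ord_def tran_def) (intro dfi)+

lemma ord_elem: "ord x \<Longrightarrow> y \<epsilon> x \<Longrightarrow> ord y"
  unfolding ord_def tran_def by blast

lemma ord_trans: "ord x \<Longrightarrow> z \<epsilon> y \<Longrightarrow> y \<epsilon> x \<Longrightarrow> z \<epsilon> x"
  unfolding ord_def tran_def by blast

lemma ord_intro: "(\<And>y. y \<epsilon> x \<Longrightarrow> ord y) \<Longrightarrow> (\<And>y z. y \<epsilon> x \<Longrightarrow> z \<epsilon> y \<Longrightarrow> z \<epsilon> x) \<Longrightarrow> ord x"
  unfolding ord_def tran_def by blast

text \<open>The class itself may be proper, but its part below the given \<open>x\<close> is a set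
  by separation, and foundation applies to that set.\<close>

lemma ord_least:
  assumes "definable (\<lambda>e. P (e 0))" "P x" "ord x"
  shows "\<exists>x. ord x \<and> P x \<and> (\<forall>y. y \<epsilon> x \<longrightarrow> \<not> P y)"
proof (cases "\<exists>y. y \<epsilon> x \<and> P y")
  case True
  have *: "is_set (\<lambda>y. y \<epsilon> x \<and> P y)"
    by (rule is_set_sep[of "\<lambda>y. y \<epsilon> x"]) (intro dfi assms | simp)+
  with True obtain y where "y \<epsilon> x" "P y" "\<not> (\<exists>z. (z \<epsilon> x \<and> P z) \<and> z \<epsilon> y)"
    using foundation[of _ "cl (\<lambda>y. y \<epsilon> x \<and> P y)"] unfolding elem_cl[OF *] by blast
  then show ?thesis using assms(3) ord_elem ord_trans by blast
qed (use assms in blast)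

lemma ord_induct:
  assumes "definable (\<lambda>e. P (e 0))" "ord x" "\<And>x. ord x \<Longrightarrow> (\<And>y. y \<epsilon> x \<Longrightarrow> P y) \<Longrightarrow> P x"
  shows "P x"
proof (rule ccontr)
  assume "\<not> P x"
  moreover have "definable (\<lambda>e. \<not> P (e 0))" by (intro dfi assms)
  ultimately obtain y where "ord y" "\<not> P y" "\<forall>z. z \<epsilon> y \<longrightarrow> P z"
    using ord_least[of "\<lambda>x. \<not> P x" x] assms(2) by blast
  then show False using assms(3) by blast
qed

lemma ord_linear: "ord a \<Longrightarrow> ord b \<Longrightarrow> a \<epsilon> b \<or> a = b \<or> b \<epsilon> a"
proof -
  assume a: "ord a" and b: "ord b"
  have "\<forall>b. ord b \<longrightarrow> a \<epsilon> b \<or> a = b \<or> b \<epsilon> a"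
  proof (rule ord_induct[where x = a and P = "\<lambda>a. \<forall>b. ord b \<longrightarrow> a \<epsilon> b \<or> a = b \<or> b \<epsilon> a"])
    show "definable (\<lambda>e. \<forall>b. ord b \<longrightarrow> e 0 \<epsilon> b \<or> e 0 = b \<or> b \<epsilon> e 0)" by (intro dfi)
    fix a assume a: "ord a" and IH: "\<And>y. y \<epsilon> a \<Longrightarrow> \<forall>b. ord b \<longrightarrow> y \<epsilon> b \<or> y = b \<or> b \<epsilon> y"
    show "\<forall>b. ord b \<longrightarrow> a \<epsilon> b \<or> a = b \<or> b \<epsilon> a"
    proof (intro allI HOL.impI)
      fix b assume "ord b"
      show "a \<epsilon> b \<or> a = b \<or> b \<epsilon> a"
      proof (rule ord_induct[where x = b and P = "\<lambda>b. a \<epsilon> b \<or> a = b \<or> b \<epsilon> a"])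
        show "ord b" by fact
        show "definable (\<lambda>e. a \<epsilon> e 0 \<or> a = e 0 \<or> e 0 \<epsilon> a)" by (intro dfi)
        fix b assume b: "ord b" and IH': "\<And>y. y \<epsilon> b \<Longrightarrow> a \<epsilon> y \<or> a = y \<or> y \<epsilon> a"
        \<comment> \<open>Each \<open>z\<close> in \<open>a\<close> is comparable with
          \<open>b\<close> by the outer hypothesis; \<open>b = z\<close> or
          \<open>b \<epsilon> z\<close> would put \<open>b\<close> into \<open>a\<close>. The inner
          hypothesis handles the elements of \<open>b\<close> symmetrically.\<close>
        have "a = b" if "\<not> a \<epsilon> b" "\<not> b \<epsilon> a"
        proof (rule extensionality)
          show "z \<epsilon> a \<longleftrightarrow> z \<epsilon> b" for z
            using IH[of z] IH'[of z] a b that ord_trans by blast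
        qed
        then show "a \<epsilon> b \<or> a = b \<or> b \<epsilon> a" by blast
      qed
    qed
  qed (rule a)
  with b show ?thesis by blast
qed

definition succ :: "'m \<Rightarrow> 'm" where "succ x = cl (\<lambda>z. z \<epsilon> x \<or> z = x)"

lemma elem_succ: "z \<epsilon> succ x \<longleftrightarrow> z \<epsilon> x \<or> z = x"
  unfolding succ_def by (rule elem_cl) (intro is_set_or is_set_elem is_set_eq)

lemma ord_succ: "ord x \<Longrightarrow> ord (succ x)"
  by (rule ord_intro) (auto simp: elem_succ intro: ord_elem ord_trans)

lemma ord_Uni: "(\<And>y. y \<epsilon> x \<Longrightarrow> ord y) \<Longrightarrow> ord (Uni x)"
  by (rule ord_intro) (unfold elem_Uni, (blast intro: ord_elem dest: ord_trans)+)

text \<open>The bound is the successor of the union of the ordinals in the set. This also refutes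
  any set containing all ordinals.\<close>

lemma ord_bound:
  assumes "is_set P"
  shows "\<exists>a. ord a \<and> (\<forall>b. ord b \<longrightarrow> P b \<longrightarrow> b \<epsilon> a)"
proof -
  have *: "is_set (\<lambda>b. b \<epsilon> cl P \<and> ord b)"
    by (rule is_set_sep[of "\<lambda>b. b \<epsilon> cl P"]) (intro dfi | simp)+
  define s where "s = cl (\<lambda>b. b \<epsilon> cl P \<and> ord b)"
  have s: "b \<epsilon> s \<longleftrightarrow> P b \<and> ord b" for b
    unfolding s_def elem_cl[OF *] by (simp add: elem_cl[OF assms])
  have u: "ord (Uni s)" by (rule ord_Uni) (simp add: s)
  have "b \<epsilon> succ (Uni s)" if "ord b" "P b" for b
  proof -
    have "b \<epsilon> s" using s that by simp
    then have "\<not> Uni s \<epsilon> b" using elem_Uni[of "Uni s" s] elem_irrefl by blast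
    then show ?thesis using ord_linear[OF that(1) u] unfolding elem_succ by blast
  qed
  then show ?thesis using ord_succ[OF u] by blast
qed

lemma ord_subset: "ord a \<Longrightarrow> ord b \<Longrightarrow> (\<And>z. z \<epsilon> a \<Longrightarrow> z \<epsilon> b) \<Longrightarrow> a \<epsilon> b \<or> a = b"
  using ord_linear[of a b] elem_irrefl by blast

text \<open>The set from the axiom of infinity may contain non-ordinals. Its ordinals are closed
  under successor, and their union is a nonempty ordinal without a largest element.\<close>

lemma limit_ord_ex: "\<exists>a. ord a \<and> (\<exists>b. b \<epsilon> a) \<and> (\<forall>b. b \<epsilon> a \<longrightarrow> (\<exists>c. b \<epsilon> c \<and> c \<epsilon> a))"
proof -
  from infinity obtain x e where e: "e \<epsilon> x" "\<And>w. \<not> w \<epsilon> e"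
    and x: "\<And>y. y \<epsilon> x \<Longrightarrow> \<exists>s. s \<epsilon> x \<and> (\<forall>w. w \<epsilon> s \<longleftrightarrow> w \<epsilon> y \<or> w = y)" by blast
  have suc: "succ y \<epsilon> x" if "y \<epsilon> x" for y
  proof -
    from x[OF that] obtain s where "s \<epsilon> x" "\<And>w. w \<epsilon> s \<longleftrightarrow> w \<epsilon> y \<or> w = y" by blast
    moreover from this have "s = succ y" by (intro extensionality) (simp add: elem_succ)
    ultimately show ?thesis by simp
  qed
  have *: "is_set (\<lambda>b. b \<epsilon> x \<and> ord b)"
    by (rule is_set_sep[of "\<lambda>b. b \<epsilon> x"]) (intro dfi | simp)+
  define s where "s = cl (\<lambda>b. b \<epsilon> x \<and> ord b)"
  have s: "b \<epsilon> s \<longleftrightarrow> b \<epsilon> x \<and> ord b" for b unfolding s_def by (rule elem_cl[OF *])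
  have "ord e" by (rule ord_intro) (use e in auto)
  then have "e \<epsilon> Uni s" unfolding elem_Uni s using e(1) suc ord_succ elem_succ by blast
  moreover have "\<exists>c. b \<epsilon> c \<and> c \<epsilon> Uni s" if "b \<epsilon> Uni s" for b
    using that suc ord_succ unfolding elem_Uni s by (metis elem_succ)
  moreover have "ord (Uni s)" by (rule ord_Uni) (simp add: s)
  ultimately show ?thesis by blast
qed


subsection \<open>The pairing function\<close>

text \<open>\<open>max_less c d a b\<close> expresses \<open>max(c, d) < max(a, b)\<close> and \<open>pless c d a b\<close> expresses
  \<open>(c, d) <\<^sup>* (a, b)\<close>, both without bound variables.\<close>

definition max_less :: "'m \<Rightarrow> 'm \<Rightarrow> 'm \<Rightarrow> 'm \<Rightarrow> bool" where
  "max_less c d a b \<longleftrightarrow> (c \<epsilon> a \<or> c \<epsilon> b) \<and> (d \<epsilon> a \<or> d \<epsilon> b)"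

definition pless :: "'m \<Rightarrow> 'm \<Rightarrow> 'm \<Rightarrow> 'm \<Rightarrow> bool" where
  "pless c d a b \<longleftrightarrow> max_less c d a b \<or> (\<not> max_less a b c d \<and> (c \<epsilon> a \<or> (c = a \<and> d \<epsilon> b)))"

definition omax :: "'m \<Rightarrow> 'm \<Rightarrow> 'm" where
  "omax a b = (if a \<epsilon> b then b else a)"

lemma ord_omax: "ord a \<Longrightarrow> ord b \<Longrightarrow> ord (omax a b)"
  unfolding omax_def by simp

lemma max_less_iff:
  assumes "ord a" "ord b" "ord c" "ord d"
  shows "max_less c d a b \<longleftrightarrow> omax c d \<epsilon> omax a b"
  unfolding max_less_def omax_def
  using assms ord_linear[OF assms(1,2)] ord_linear[OF assms(3,4)] ord_trans by (smt (verit))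

lemma pless_iff:
  assumes "ord a" "ord b" "ord c" "ord d"
  shows "pless c d a b \<longleftrightarrow> omax c d \<epsilon> omax a b \<or>
    (omax c d = omax a b \<and> (c \<epsilon> a \<or> (c = a \<and> d \<epsilon> b)))"
proof -
  have "omax c d \<epsilon> omax a b \<or> omax c d = omax a b \<or> omax a b \<epsilon> omax c d"
    by (intro ord_linear ord_omax assms)
  then show ?thesis
    unfolding pless_def max_less_iff[OF assms] max_less_iff[OF assms(3,4,1,2)]
    using elem_asym elem_irrefl by metis
qed

lemma pless_total:
  assumes "ord a" "ord b" "ord c" "ord d"
  shows "pless c d a b \<or> (c = a \<and> d = b) \<or> pless a b c d"
  unfolding pless_iff[OF assms] pless_iff[OF assms(3,4,1,2)]
  using ord_linear[OF assms(1,3)] ord_linear[OF assms(2,4)]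
    ord_linear[OF ord_omax[OF assms(1,2)] ord_omax[OF assms(3,4)]] by metis

lemma pless_trans:
  assumes "ord a" "ord b" "ord c" "ord d" "ord a'" "ord b'" "pless c d a b" "pless a b a' b'"
  shows "pless c d a' b'"
  using assms(7,8) unfolding pless_iff[OF assms(1-4)] pless_iff[OF assms(5,6,1,2)]
    pless_iff[OF assms(5,6,3,4)]
  using ord_trans[OF ord_omax[OF assms(5,6)]] ord_trans[OF assms(5)] ord_trans[OF assms(6)] by metis

definition pair_rel :: "'m \<Rightarrow> 'm \<Rightarrow> bool" where
  "pair_rel z y \<longleftrightarrow> (\<exists>a b c d. ord a \<and> ord b \<and> ord c \<and> ord d \<and>
     z = opair c d \<and> y = opair a b \<and> pless c d a b)"

lemma pair_rel_opair:
  "ord a \<Longrightarrow> ord b \<Longrightarrow> pair_rel z (opair a b) \<longleftrightarrow> (\<exists>c d. ord c \<and> ord d \<and> z = opair c d \<and> pless c d a b)"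
  unfolding pair_rel_def by auto

text \<open>Minimisation in three steps: the maximum \<open>m\<close>, then the first coordinate,
  then the second. A point that is not a pair of ordinals has no predecessors at all.\<close>

lemma pair_rel_minimal:
  assumes P: "definable (\<lambda>e. P (e 0))" and "P x"
  shows "\<exists>x. P x \<and> (\<forall>y. pair_rel y x \<longrightarrow> \<not> P y)"
proof (cases "\<exists>a b. ord a \<and> ord b \<and> x = opair a b")
  case False
  then show ?thesis using \<open>P x\<close> unfolding pair_rel_def by blast
next
  case True
  define Q where "Q m a b \<longleftrightarrow> ord a \<and> ord b \<and> P (opair a b) \<and> ((a \<epsilon> b \<and> m = b) \<or> (\<not> a \<epsilon> b \<and> m = a))" for m a b
  have Q: "Q m a b \<longleftrightarrow> ord a \<and> ord b \<and> P (opair a b) \<and> m = omax a b" for m a b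
    unfolding Q_def omax_def by auto
  have def_Q: "definable (\<lambda>e. Q (f e) (g e) (h e))" if "def_term f" "def_term g" "def_term h" for f g h
    unfolding Q_def by (intro dfi that definable_comp1[OF P])
  have def1: "definable (\<lambda>e. \<exists>a b. Q (e 0) a b)" by (intro dfi def_Q)
  from True \<open>P x\<close> obtain a b where ab: "Q (omax a b) a b" unfolding Q by blast
  then obtain m where m: "\<exists>a b. Q m a b" "\<And>k. k \<epsilon> m \<Longrightarrow> \<not> (\<exists>a b. Q k a b)"
    using ord_least[OF def1, of "omax a b"] ord_omax unfolding Q by blast
  have def2: "definable (\<lambda>e. \<exists>b. Q m (e 0) b)" by (intro dfi def_Q)
  from m(1) obtain a' where "\<exists>b. Q m a' b" "ord a'" unfolding Q by blast
  then obtain a where a: "\<exists>b. Q m a b" "\<And>k. k \<epsilon> a \<Longrightarrow> \<not> (\<exists>b. Q m k b)"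
    using ord_least[OF def2, of a'] by blast
  have def3: "definable (\<lambda>e. Q m a (e 0))" by (intro dfi def_Q)
  from a(1) obtain b' where "Q m a b'" "ord b'" unfolding Q by blast
  then obtain b where b: "Q m a b" "\<And>k. k \<epsilon> b \<Longrightarrow> \<not> Q m a k"
    using ord_least[OF def3, of b'] by blast
  have "\<not> P y" if "pair_rel y (opair a b)" for y
  proof
    assume "P y"
    from that obtain c d where cd: "ord c" "ord d" "y = opair c d" "pless c d a b" "ord a" "ord b"
      unfolding pair_rel_def by auto
    then have "Q (omax c d) c d" using \<open>P y\<close> unfolding Q by simp
    moreover have "omax a b = m" using b(1) unfolding Q by simp
    ultimately show False
      using cd(4) m(2) a(2) b(2) unfolding pless_iff[OF cd(5,6,1,2)] by metis
  qed
  then show ?thesis using b(1) unfolding Q by blast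
qed

lemma def_wf_pair_rel: "def_wf pair_rel"
  unfolding def_wf_def
proof (intro conjI allI HOL.impI)
  show def: "definable (\<lambda>e. pair_rel (e 0) (e (Suc 0)))"
    unfolding pair_rel_def pless_def max_less_def by (intro dfi)
  show "is_set (\<lambda>z. pair_rel z x)" for x
  proof (cases "\<exists>a b. ord a \<and> ord b \<and> x = opair a b")
    case False
    then show ?thesis
      by (intro is_set_sep[of "\<lambda>z. z \<epsilon> x" "\<lambda>z. pair_rel z x"] definable_comp2[OF def] dfi)
         (auto simp: pair_rel_def)
  next
    case True
    then obtain a b where ab: "ord a" "ord b" "x = opair a b" by blast
    \<comment> \<open>Predecessors of a pair lie in the square of the successor of its maximum and
      hence form a set. Comparing maxima first is essential: the plain lexicographic order would
      have proper classes of predecessors.\<close>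
    let ?s = "succ (omax a b)"
    have s: "ord ?s" by (intro ord_succ ord_omax ab)
    have 1: "is_set (\<lambda>z. \<exists>c d. c \<epsilon> ?s \<and> d \<epsilon> ?s \<and> z = opair c d)"
      by (intro is_set_image2 is_set_elem dfi)
    have 2: "\<exists>c d. c \<epsilon> ?s \<and> d \<epsilon> ?s \<and> z = opair c d" if z: "pair_rel z x" for z
    proof -
      from z ab obtain c d where cd: "ord c" "ord d" "z = opair c d" "pless c d a b"
        unfolding pair_rel_def by auto
      then have "omax c d \<epsilon> ?s" unfolding pless_iff[OF ab(1,2) cd(1,2)] elem_succ by blast
      moreover have "c = omax c d \<or> c \<epsilon> omax c d" "d = omax c d \<or> d \<epsilon> omax c d"
        using ord_linear[OF cd(1,2)] unfolding omax_def by auto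
      ultimately show ?thesis using cd(3) ord_trans[OF s] by metis
    qed
    show ?thesis by (rule is_set_sep[OF 1]) (intro definable_comp2[OF def] dfi, erule 2)
  qed
  show "pair_rel x z" if "pair_rel x y" "pair_rel y z" for x y z
    using that unfolding pair_rel_def by (metis opair_inject pless_trans)
  show "\<exists>x. P x \<and> (\<forall>y. pair_rel y x \<longrightarrow> \<not> P y)" if "definable (\<lambda>e. P (e 0))" "P x" for P x
    using that by (rule pair_rel_minimal)
qed

definition pairing_fun :: "'m \<Rightarrow> 'm \<Rightarrow> 'm" where
  "pairing_fun a b = recur pair_rel (\<lambda>x. x) (opair a b)"

lemmas recur_pair = def_wf_pair_rel def_term_var[of 0]

lemma def_term_pairing_fun [dfi]: "def_term f \<Longrightarrow> def_term g \<Longrightarrow> def_term (\<lambda>e. pairing_fun (f e) (g e))"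
  unfolding pairing_fun_def by (intro def_term_recur[OF recur_pair] dfi)

lemma elem_recur_pair: "v \<epsilon> recur pair_rel (\<lambda>x. x) y \<longleftrightarrow> (\<exists>z. pair_rel z y \<and> v = recur pair_rel (\<lambda>x. x) z)"
  by (subst recur_eq[OF recur_pair]) (rule elem_cl[OF is_set_recur[OF recur_pair]])

lemma elem_pairing_fun:
  assumes "ord a" "ord b"
  shows "v \<epsilon> pairing_fun a b \<longleftrightarrow> (\<exists>c d. ord c \<and> ord d \<and> pless c d a b \<and> v = pairing_fun c d)"
  unfolding pairing_fun_def elem_recur_pair pair_rel_opair[OF assms] by blast

text \<open>Elements of a value are earlier values, hence ordinals by induction, and transitivity of
  the order makes the value a transitive set. No restriction on the arguments is involved, as other
  points collapse to the empty set.\<close>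

lemma ord_pairing_fun: "ord (pairing_fun a b)"
proof -
  have "ord (recur pair_rel (\<lambda>x. x) x)" for x
  proof (rule def_wf_induct[OF recur_pair, where x = x and P = "\<lambda>x. ord (recur pair_rel (\<lambda>x. x) x)"])
    show "definable (\<lambda>e. ord (recur pair_rel (\<lambda>x. x) (e 0)))"
      by (intro dfi def_term_recur[OF recur_pair])
    fix x assume IH: "\<And>y. pair_rel y x \<Longrightarrow> ord (recur pair_rel (\<lambda>x. x) y)"
    show "ord (recur pair_rel (\<lambda>x. x) x)"
    proof (rule ord_intro)
      show "ord y" if "y \<epsilon> recur pair_rel (\<lambda>x. x) x" for y
        using that IH unfolding elem_recur_pair by blast
      show "z \<epsilon> recur pair_rel (\<lambda>x. x) x" if "y \<epsilon> recur pair_rel (\<lambda>x. x) x" "z \<epsilon> y" for y z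
        using that def_wf_trans[OF recur_pair] unfolding elem_recur_pair[of _ x]
        by (metis elem_recur_pair)
    qed
  qed
  then show ?thesis unfolding pairing_fun_def .
qed

lemma pairing_fun_mono:
  "ord a \<Longrightarrow> ord b \<Longrightarrow> ord c \<Longrightarrow> ord d \<Longrightarrow> pless c d a b \<Longrightarrow> pairing_fun c d \<epsilon> pairing_fun a b"
  by (auto simp: elem_pairing_fun)

lemma pairing_fun_inject:
  assumes "ord a" "ord b" "ord c" "ord d" "pairing_fun a b = pairing_fun c d"
  shows "a = c \<and> b = d"
  using pless_total[OF assms(1-4)] pairing_fun_mono[OF assms(1-4)] pairing_fun_mono[OF assms(3,4,1,2)] assms(5)
  by auto

text \<open>This is the content of (GPF): for ordinals, being at most \<open>a\<close> means being a
  subset of \<open>a\<close>, and the value is the set of all earlier values.\<close>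

lemma pairing_fun_le_iff:
  assumes "ord a" "ord b" "ord c"
  shows "pairing_fun b c \<epsilon> a \<or> pairing_fun b c = a \<longleftrightarrow>
    (\<forall>d e. ord d \<longrightarrow> ord e \<longrightarrow> pless d e b c \<longrightarrow> pairing_fun d e \<epsilon> a)"
proof
  assume "pairing_fun b c \<epsilon> a \<or> pairing_fun b c = a"
  then show "\<forall>d e. ord d \<longrightarrow> ord e \<longrightarrow> pless d e b c \<longrightarrow> pairing_fun d e \<epsilon> a"
    using pairing_fun_mono[OF assms(2,3)] ord_trans[OF assms(1)] by blast
next
  assume "\<forall>d e. ord d \<longrightarrow> ord e \<longrightarrow> pless d e b c \<longrightarrow> pairing_fun d e \<epsilon> a"
  then show "pairing_fun b c \<epsilon> a \<or> pairing_fun b c = a"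
    by (intro ord_subset ord_pairing_fun assms) (auto simp: elem_pairing_fun[OF assms(2,3)])
qed

lemma ord_empty_ex: "\<exists>n. ord n \<and> (\<forall>z. \<not> z \<epsilon> n)"
proof -
  have *: "is_set (\<lambda>z. False)" by (rule is_set_sep[OF is_set_eq]) (intro dfi | simp)+
  have "ord (cl (\<lambda>z. False))" by (rule ord_intro) (simp_all add: elem_cl[OF *])
  then show ?thesis using elem_cl[OF *] by blast
qed

lemma pairing_fun_surj:
  assumes "ord a"
  shows "\<exists>b c. ord b \<and> ord c \<and> a = pairing_fun b c"
proof -
  obtain n where n: "ord n" "\<And>z. \<not> z \<epsilon> n" using ord_empty_ex by blast
  have "a \<epsilon> pairing_fun a n \<or> a = pairing_fun a n"
  proof (rule ord_induct[where x = a and P = "\<lambda>a. a \<epsilon> pairing_fun a n \<or> a = pairing_fun a n"])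
    show "ord a" by fact
    show "definable (\<lambda>e. e 0 \<epsilon> pairing_fun (e 0) n \<or> e 0 = pairing_fun (e 0) n)" by (intro dfi)
    fix x assume x: "ord x" and IH: "\<And>y. y \<epsilon> x \<Longrightarrow> y \<epsilon> pairing_fun y n \<or> y = pairing_fun y n"
    show "x \<epsilon> pairing_fun x n \<or> x = pairing_fun x n"
    proof (rule ord_subset[OF x ord_pairing_fun])
      fix z assume z: "z \<epsilon> x"
      have "pless z n x n"
        unfolding pless_iff[OF x n(1) ord_elem[OF x z] n(1)] omax_def using n z by auto
      then have "pairing_fun z n \<epsilon> pairing_fun x n"
        by (intro pairing_fun_mono x n(1) ord_elem[OF x z])
      then show "z \<epsilon> pairing_fun x n" using IH[OF z] ord_trans[OF ord_pairing_fun] by metis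
    qed
  qed
  \<comment> \<open>If \<open>a\<close> is not the value at \<open>(a, n)\<close>, it is an element
    of that value and so the value at some earlier pair.\<close>
  then show ?thesis
    using elem_pairing_fun[OF assms n(1)] assms n(1) by blast
qed


subsection \<open>Well-ordering\<close>

lemma choice_function:
  "\<exists>ch. def_term (\<lambda>e. ch (e 0)) \<and> (\<forall>s. (\<exists>z. z \<epsilon> s) \<longrightarrow> (\<forall>z. z \<epsilon> s \<longrightarrow> z \<epsilon> X) \<longrightarrow> ch s \<epsilon> s)"
proof -
  \<comment> \<open>The axiom of choice speaks of disjoint families, so each subset \<open>s\<close>
    is replaced by its copy \<open>{s} \<times> s\<close>. The transversal of the copies is one set,
    which then serves as parameter of a definable choice function.\<close>
  define tag where "tag s = cl (\<lambda>p. \<exists>z. z \<epsilon> s \<and> p = opair s z)" for s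
  have tag: "p \<epsilon> tag s \<longleftrightarrow> (\<exists>z. z \<epsilon> s \<and> p = opair s z)" for p s
    unfolding tag_def by (rule elem_cl, rule is_set_image[OF is_set_elem]) (intro dfi)
  define Q where "Q s \<longleftrightarrow> (\<exists>z. z \<epsilon> s) \<and> (\<forall>z. z \<epsilon> s \<longrightarrow> z \<epsilon> X)" for s
  have "is_set Q" unfolding Q_def by (rule is_set_sep[OF is_set_power[of X]]) (intro dfi | simp)+
  then have *: "is_set (\<lambda>t. \<exists>s. Q s \<and> t = tag s)"
    by (rule is_set_image) (unfold tag_def, intro dfi)
  have "\<exists>c. \<forall>x. x \<epsilon> cl (\<lambda>t. \<exists>s. Q s \<and> t = tag s) \<longrightarrow> (\<exists>w. \<forall>v. v \<epsilon> x \<and> v \<epsilon> c \<longleftrightarrow> v = w)"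
    by (rule choice, unfold elem_cl[OF *]) (auto simp: tag Q_def)
  then obtain c where c: "Q s \<Longrightarrow> \<exists>w. \<forall>v. v \<epsilon> tag s \<and> v \<epsilon> c \<longleftrightarrow> v = w" for s
    unfolding elem_cl[OF *] by blast
  define ch where "ch s = tha (\<lambda>z. z \<epsilon> s \<and> opair s z \<epsilon> c)" for s
  have "ch s \<epsilon> s" if "Q s" for s
  proof -
    from c[OF that] obtain w where w: "\<And>v. v \<epsilon> tag s \<and> v \<epsilon> c \<longleftrightarrow> v = w" by blast
    then obtain z where z: "z \<epsilon> s" "w = opair s z" "w \<epsilon> c" unfolding tag by blast
    have "ch s = z" unfolding ch_def
    proof (rule tha_equality)
      show "z \<epsilon> s \<and> opair s z \<epsilon> c" using z by simp
      show "x = z" if "x \<epsilon> s \<and> opair s x \<epsilon> c" for x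
        using w[of "opair s x"] that z(2) unfolding tag by auto
    qed
    with z show ?thesis by simp
  qed
  moreover have "def_term (\<lambda>e. ch (e 0))" unfolding ch_def by (intro dfi)
  ultimately show ?thesis unfolding Q_def by blast
qed

text \<open>The guard \<open>ord y\<close> leaves non-ordinals without predecessors, so minimality
  follows from the least ordinal principle.\<close>

lemma def_wf_ord: "def_wf (\<lambda>z y. ord y \<and> z \<epsilon> y)"
  unfolding def_wf_def
proof (intro conjI allI HOL.impI)
  show "definable (\<lambda>e. ord (e (Suc 0)) \<and> e 0 \<epsilon> e (Suc 0))" by (intro dfi)
  show "is_set (\<lambda>z. ord x \<and> z \<epsilon> x)" for x
    by (rule is_set_sep[of "\<lambda>z. z \<epsilon> x"]) (intro dfi | simp)+
  show "\<exists>x. P x \<and> (\<forall>y. ord x \<and> y \<epsilon> x \<longrightarrow> \<not> P y)" if "definable (\<lambda>e. P (e 0))" "P x" for P x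
    using ord_least[OF that] that(2) by blast
qed (blast intro: ord_trans)+

theorem enumeration:
  obtains k h where "ord k" "def_term (\<lambda>e. h (e 0))" "\<And>x. x \<epsilon> k \<Longrightarrow> h x \<epsilon> X"
    "\<And>x y. x \<epsilon> k \<Longrightarrow> y \<epsilon> k \<Longrightarrow> h x = h y \<Longrightarrow> x = y" "\<And>z. z \<epsilon> X \<Longrightarrow> \<exists>x. x \<epsilon> k \<and> h x = z"
proof -
  obtain ch where ch_def: "def_term (\<lambda>e. ch (e 0))"
    and ch: "\<And>s z. z \<epsilon> s \<Longrightarrow> (\<And>z. z \<epsilon> s \<Longrightarrow> z \<epsilon> X) \<Longrightarrow> ch s \<epsilon> s"
    using choice_function[of X] by blast
  \<comment> \<open>\<open>H\<close> receives the set of values chosen so far. Once \<open>X\<close>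
    is exhausted it returns \<open>X\<close> itself, a safe stop marker since no set is an element
    of itself.\<close>
  define H where "H S = (if \<exists>z. z \<epsilon> X \<and> \<not> z \<epsilon> S then ch (cl (\<lambda>z. z \<epsilon> X \<and> \<not> z \<epsilon> S)) else X)" for S
  define R where "R z y \<longleftrightarrow> ord y \<and> z \<epsilon> y" for z y
  have R: "def_wf R" unfolding R_def by (rule def_wf_ord)
  have H_def': "def_term (\<lambda>e. H (e 0))" unfolding H_def by (intro dfi def_term_comp1[OF ch_def])
  define h where "h = recur R H"
  have def_h: "def_term (\<lambda>e. h (f e))" if "def_term f" for f
    unfolding h_def by (rule def_term_recur[OF R H_def' that])
  have diff: "is_set (\<lambda>z. z \<epsilon> X \<and> \<not> z \<epsilon> S)" for S
    by (rule is_set_sep[of "\<lambda>z. z \<epsilon> X"]) (intro dfi | simp)+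
  have H_in: "H S \<epsilon> X \<and> \<not> H S \<epsilon> S" if "\<exists>z. z \<epsilon> X \<and> \<not> z \<epsilon> S" for S
    using ch[of _ "cl (\<lambda>z. z \<epsilon> X \<and> \<not> z \<epsilon> S)"] that unfolding H_def elem_cl[OF diff] by auto
  have h: "h x = X \<and> (\<forall>z. z \<epsilon> X \<longrightarrow> (\<exists>y. y \<epsilon> x \<and> h y = z)) \<or> h x \<epsilon> X \<and> (\<forall>y. y \<epsilon> x \<longrightarrow> h x \<noteq> h y)"
    if "ord x" for x
  proof -
    define S where "S = cl (\<lambda>w. \<exists>z. R z x \<and> w = h z)"
    have S: "w \<epsilon> S \<longleftrightarrow> (\<exists>z. z \<epsilon> x \<and> w = h z)" for w
      using elem_cl[OF is_set_recur[OF R H_def', of x]] that unfolding S_def h_def R_def by simp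
    have "h x = H S" unfolding S_def h_def by (rule recur_eq[OF R H_def'])
    show ?thesis
    proof (cases "\<exists>z. z \<epsilon> X \<and> \<not> z \<epsilon> S")
      case True
      then show ?thesis using H_in[OF True] S \<open>h x = H S\<close> by auto
    next
      case False
      then have "h x = X" using \<open>h x = H S\<close> unfolding H_def by argo
      moreover have "\<exists>y. y \<epsilon> x \<and> h y = z" if "z \<epsilon> X" for z using False S[of z] that by auto
      ultimately show ?thesis by blast
    qed
  qed
  have def: "definable (\<lambda>e. ord (e 0) \<and> h (e 0) = X)" by (intro dfi def_h)
  have "\<exists>x. ord x \<and> h x = X"
  proof (rule ccontr)
    assume no: "\<not> (\<exists>x. ord x \<and> h x = X)"
    \<comment> \<open>Were the marker never reached, \<open>h\<close> would be injective on all
      ordinals with values in \<open>X\<close>; replacement along its inverse \<open>g\<close> would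
      then bound the class of all ordinals.\<close>
    define g where "g z = tha (\<lambda>x. ord x \<and> h x = z)" for z
    have g: "g (h x) = x" if x: "ord x" for x
      unfolding g_def
    proof (rule tha_equality)
      fix y assume y: "ord y \<and> h y = h x"
      show "y = x" using ord_linear[of x y] h[of x] h[of y] no x y by metis
    qed (use x in simp)
    have "is_set (\<lambda>x. \<exists>z. z \<epsilon> X \<and> x = g z)"
      by (rule is_set_image) (unfold g_def, simp, intro dfi def_h)
    then obtain a where a: "ord a" "\<And>b. ord b \<Longrightarrow> (\<exists>z. z \<epsilon> X \<and> b = g z) \<Longrightarrow> b \<epsilon> a"
      using ord_bound[of "\<lambda>x. \<exists>z. z \<epsilon> X \<and> x = g z"] by blast
    have "h a \<epsilon> X" using h[OF a(1)] no a(1) by blast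
    then have "a \<epsilon> a" using a g[OF a(1)] by metis
    then show False by simp
  qed
  \<comment> \<open>At the first stage with the marker \<open>X\<close> is exhausted, while all
    earlier values are distinct elements of \<open>X\<close>.\<close>
  then obtain k where k: "ord k" "h k = X" "\<And>y. y \<epsilon> k \<Longrightarrow> \<not> (ord y \<and> h y = X)"
    using ord_least[OF def] by blast
  show ?thesis
  proof (rule that[OF k(1)])
    show "def_term (\<lambda>e. h (e 0))" by (intro def_h dfi)
    show in_X: "h x \<epsilon> X" if "x \<epsilon> k" for x
      using h[of x] k(3)[OF that] ord_elem[OF k(1) that] by blast
    show "x = y" if "x \<epsilon> k" "y \<epsilon> k" "h x = h y" for x y
    proof -
      have "ord x" "ord y" using that ord_elem k(1) by blast+
      then show ?thesis using ord_linear[of x y] h[of x] h[of y] that k(3)[OF that(1)] k(3)[OF that(2)] by metis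
    qed
    show "\<exists>x. x \<epsilon> k \<and> h x = z" if "z \<epsilon> X" for z
      using h[OF k(1)] k(2) that elem_irrefl by metis
  qed
qed

end


section \<open>The interpretation\<close>

text \<open>Ordinals are von Neumann ordinals. Since a set of ordinals may itself be an ordinal, it is
  represented by adding to it the non-ordinal \<open>{{\<emptyset>}}\<close> (\<open>tag_fm\<close>).\<close>

definition empty_fm :: "nat \<Rightarrow> zf_fm" where
  "empty_fm i = Forall (\<^bold>\<not> elem 0 (Suc i))"

definition one_fm :: "nat \<Rightarrow> zf_fm" where
  "one_fm i = Forall (elem 0 (Suc i) \<^bold>\<longleftrightarrow> empty_fm 0)"

definition tag_fm :: "nat \<Rightarrow> zf_fm" where
  "tag_fm i = Forall (elem 0 (Suc i) \<^bold>\<longleftrightarrow> one_fm 0)"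

definition tran_fm :: "nat \<Rightarrow> zf_fm" where
  "tran_fm i = Forall (elem 0 (Suc i) \<^bold>\<longrightarrow> Forall (elem 0 1 \<^bold>\<longrightarrow> elem 0 (Suc (Suc i))))"

definition ord_fm :: "nat \<Rightarrow> zf_fm" where
  "ord_fm i = (tran_fm i \<^bold>\<and> Forall (elem 0 (Suc i) \<^bold>\<longrightarrow> tran_fm 0))"

definition sord_fm :: "nat \<Rightarrow> zf_fm" where
  "sord_fm i = (Exists (elem 0 (Suc i) \<^bold>\<and> tag_fm 0) \<^bold>\<and>
     Forall (elem 0 (Suc i) \<^bold>\<longrightarrow> ord_fm 0 \<^bold>\<or> tag_fm 0))"

definition upair_fm :: "nat \<Rightarrow> nat \<Rightarrow> nat \<Rightarrow> zf_fm" where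
  "upair_fm i j k = Forall (elem 0 (Suc k) \<^bold>\<longleftrightarrow> Var 0 \<^bold>= Var (Suc i) \<^bold>\<or> Var 0 \<^bold>= Var (Suc j))"

definition opair_fm :: "nat \<Rightarrow> nat \<Rightarrow> nat \<Rightarrow> zf_fm" where
  "opair_fm i j k = Exists (Exists (upair_fm (Suc (Suc i)) (Suc (Suc i)) 1 \<^bold>\<and>
     upair_fm (Suc (Suc i)) (Suc (Suc j)) 0 \<^bold>\<and> upair_fm 1 0 (Suc (Suc k))))"

definition opair_in_fm :: "nat \<Rightarrow> nat \<Rightarrow> nat \<Rightarrow> zf_fm" where
  "opair_in_fm i j f = Exists (opair_fm (Suc i) (Suc j) 0 \<^bold>\<and> elem 0 (Suc f))"

definition max_less_fm :: "nat \<Rightarrow> nat \<Rightarrow> nat \<Rightarrow> nat \<Rightarrow> zf_fm" where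
  "max_less_fm c d a b = ((elem c a \<^bold>\<or> elem c b) \<^bold>\<and> (elem d a \<^bold>\<or> elem d b))"

definition pless_fm :: "nat \<Rightarrow> nat \<Rightarrow> nat \<Rightarrow> nat \<Rightarrow> zf_fm" where
  "pless_fm c d a b = (max_less_fm c d a b \<^bold>\<or>
     (\<^bold>\<not> max_less_fm a b c d \<^bold>\<and> (elem c a \<^bold>\<or> (Var c \<^bold>= Var a \<^bold>\<and> elem d b))))"

definition pair_rel_fm :: "nat \<Rightarrow> nat \<Rightarrow> zf_fm" where
  "pair_rel_fm z y = Exists (Exists (Exists (Exists \<comment> \<open>\<open>d, c, b, a\<close>\<close>
     (ord_fm 3 \<^bold>\<and> ord_fm 2 \<^bold>\<and> ord_fm 1 \<^bold>\<and> ord_fm 0 \<^bold>\<and>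
      opair_fm 1 0 (z + 4) \<^bold>\<and> opair_fm 3 2 (y + 4) \<^bold>\<and> pless_fm 1 0 3 2))))"

text \<open>The notion \<open>attempt\<close> for the order on pairs and the identity as
  \<open>H\<close>; the equation with a class term is replaced by a description of its
  elements.\<close>

definition attempt_fm :: "nat \<Rightarrow> zf_fm" where
  "attempt_fm f = Forall (Forall \<comment> \<open>\<open>v, y\<close>\<close> (opair_in_fm 1 0 (f + 2) \<^bold>\<longrightarrow>
     Forall \<comment> \<open>\<open>z, v, y\<close>\<close> (pair_rel_fm 0 2 \<^bold>\<longrightarrow> Exists (opair_in_fm 1 0 (f + 4))) \<^bold>\<and>
     Forall (elem 0 1 \<^bold>\<longleftrightarrow> Exists \<comment> \<open>\<open>z, w, v, y\<close>\<close> (pair_rel_fm 0 3 \<^bold>\<and> opair_in_fm 0 1 (f + 4)))))"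

text \<open>Index 0 is the value, 1 and 2 are the arguments. If one of them is not an ordinal the
  value is the empty set, which keeps the function total with ordinal values, as (SOR)
  demands.\<close>

definition pairing_fm :: zf_fm where
  "pairing_fm = ((ord_fm 1 \<^bold>\<and> ord_fm 2 \<^bold>\<and>
       Exists (attempt_fm 0 \<^bold>\<and> Exists (opair_fm 3 4 0 \<^bold>\<and> opair_in_fm 0 2 1))) \<^bold>\<or>
     (\<^bold>\<not> (ord_fm 1 \<^bold>\<and> ord_fm 2) \<^bold>\<and> empty_fm 0))"

text \<open>Equality is interpreted by itself. The sort conditions in the two binary relations give
  the corresponding clauses of (SOR), and they hide the tag, which is no ordinal, from the
  interpreted membership.\<close>

definition so_interp :: "(unit, zf_rel, so_fun, so_rel) interp" where
  "so_interp = \<lparr>univ_fm = (ord_fm 0 \<^bold>\<or> sord_fm 0),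
     eq_fm = (Var 0 \<^bold>= Var 1),
     rel_fm = (\<lambda>r. case r of OrdSym \<Rightarrow> ord_fm 0 | SOrdSym \<Rightarrow> sord_fm 0
       | LessSym \<Rightarrow> ord_fm 0 \<^bold>\<and> ord_fm 1 \<^bold>\<and> elem 0 1
       | MemSym \<Rightarrow> ord_fm 0 \<^bold>\<and> sord_fm 1 \<^bold>\<and> elem 0 1),
     fun_fm = (\<lambda>_. pairing_fm)\<rparr>"

section \<open>Free variables and well-formedness of the defining formulas\<close>

lemma fv_elem [simp]: "fv_fm (elem i j) = {i, j}"
  by (auto simp: elem_def)

lemma fv_basic [simp]:
  "fv_fm (empty_fm i) = {i}" "fv_fm (one_fm i) = {i}" "fv_fm (tag_fm i) = {i}"
  "fv_fm (tran_fm i) = {i}" "fv_fm (ord_fm i) = {i}" "fv_fm (sord_fm i) = {i}"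
  by (auto simp: empty_fm_def one_fm_def tag_fm_def tran_fm_def ord_fm_def sord_fm_def)

lemma fv_pairs [simp]:
  "fv_fm (upair_fm i j k) = {i, j, k}" "fv_fm (opair_fm i j k) = {i, j, k}"
  "fv_fm (opair_in_fm i j k) = {i, j, k}" "fv_fm (max_less_fm i j k l) = {i, j, k, l}"
  "fv_fm (pless_fm i j k l) = {i, j, k, l}" "fv_fm (pair_rel_fm i j) = {i, j}"
  by (auto simp: upair_fm_def opair_fm_def opair_in_fm_def max_less_fm_def pless_fm_def
      pair_rel_fm_def numeral_eq_Suc)

lemma fv_attempt_fm [simp]: "fv_fm (attempt_fm i) = {i}"
  by (auto simp: attempt_fm_def numeral_eq_Suc)

lemma fv_pairing_fm [simp]: "fv_fm pairing_fm = {0, 1, 2}"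
  by (auto simp: pairing_fm_def numeral_eq_Suc)

lemma wf_basic [simp]:
  "wf_fm L_ZF (empty_fm i)" "wf_fm L_ZF (one_fm i)" "wf_fm L_ZF (tag_fm i)"
  "wf_fm L_ZF (tran_fm i)" "wf_fm L_ZF (ord_fm i)" "wf_fm L_ZF (sord_fm i)"
  "wf_fm L_ZF (upair_fm i j k)" "wf_fm L_ZF (opair_fm i j k)"
  "wf_fm L_ZF (opair_in_fm i j k)" "wf_fm L_ZF (max_less_fm i j k l)"
  "wf_fm L_ZF (pless_fm i j k l)" "wf_fm L_ZF (pair_rel_fm i j)"
  "wf_fm L_ZF (attempt_fm i)" "wf_fm L_ZF pairing_fm"
  by (simp_all add: empty_fm_def one_fm_def tag_fm_def tran_fm_def ord_fm_def sord_fm_def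
      upair_fm_def opair_fm_def opair_in_fm_def max_less_fm_def pless_fm_def
      pair_rel_fm_def attempt_fm_def pairing_fm_def)

lemma wf_so_interp [simp]:
  "wf_fm L_ZF (univ_fm so_interp)" "wf_fm L_ZF (eq_fm so_interp)"
  "wf_fm L_ZF (rel_fm so_interp r)" "wf_fm L_ZF (fun_fm so_interp f)"
  by (simp_all add: so_interp_def split: so_rel.split)

lemma wf_bind_tms:
  "(\<And>t k \<phi>. t \<in> set ts \<Longrightarrow> wf_fm L_ZF \<phi> \<Longrightarrow> wf_fm L_ZF (bind_tm so_interp k t \<phi>)) \<Longrightarrow>
    wf_fm L_ZF \<phi> \<Longrightarrow> wf_fm L_ZF (bind_tms so_interp k ts \<phi>)"
  by (induction ts arbitrary: \<phi>) simp_all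

lemma wf_bind_tm: "wf_fm L_ZF \<phi> \<Longrightarrow> wf_fm L_ZF (bind_tm so_interp k t \<phi>)"
  by (induction t arbitrary: k \<phi>) (simp_all add: inst_Var ExistsU_def wf_bind_tms)

lemma wf_translate: "wf_fm L_ZF (translate so_interp \<phi>)"
  by (induction \<phi>) (simp_all add: wf_bind_tm wf_bind_tms ForallU_def del: bind_tms.simps)

section \<open>The interpreted structure inside a model\<close>

context zf
begin

definition is_tag :: "'m \<Rightarrow> bool" where
  "is_tag x \<longleftrightarrow> (\<forall>y. y \<epsilon> x \<longleftrightarrow> (\<forall>w. w \<epsilon> y \<longleftrightarrow> (\<forall>v. \<not> v \<epsilon> w)))"

definition sord :: "'m \<Rightarrow> bool" where
  "sord x \<longleftrightarrow> (\<exists>y. y \<epsilon> x \<and> is_tag y) \<and> (\<forall>y. y \<epsilon> x \<longrightarrow> ord y \<or> is_tag y)"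

definition zero :: 'm where "zero = cl (\<lambda>z. False)"

lemma not_elem_zero [simp]: "\<not> z \<epsilon> zero"
proof -
  have "is_set (\<lambda>z. False)" by (rule is_set_sep[OF is_set_eq]) (intro dfi | simp)+
  then show ?thesis unfolding zero_def by (simp add: elem_cl)
qed

lemma zero_iff: "(\<forall>z. \<not> z \<epsilon> x) \<longleftrightarrow> x = zero"
  by (auto intro: extensionality)

lemma ord_zero [simp]: "ord zero"
  by (rule ord_intro) simp_all

lemma eq_upair_iff: "x = upair a b \<longleftrightarrow> (\<forall>z. z \<epsilon> x \<longleftrightarrow> z = a \<or> z = b)"
  by (metis elem_upair extensionality)

lemma is_tag_iff: "is_tag x \<longleftrightarrow> x = upair (upair zero zero) (upair zero zero)"
proof -
  have "(\<forall>w. w \<epsilon> y \<longleftrightarrow> w = zero) \<longleftrightarrow> y = upair zero zero" for y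
    using eq_upair_iff[of y zero zero] by simp
  then show ?thesis unfolding is_tag_def zero_iff
    using eq_upair_iff[of x "upair zero zero" "upair zero zero"] by simp
qed

text \<open>Transitivity would put \<emptyset> into the tag, whose only element is
  {\<emptyset>}.\<close>

lemma is_tag_not_ord: "is_tag x \<Longrightarrow> \<not> ord x"
proof
  assume "is_tag x" "ord x"
  then have x: "z \<epsilon> x \<longleftrightarrow> z = upair zero zero" for z
    using elem_upair by (simp add: is_tag_iff)
  have "zero \<epsilon> x"
    using ord_trans[OF \<open>ord x\<close>, of zero "upair zero zero"] x elem_upair by simp
  then have "zero = upair zero zero" using x by simp
  then show False by (metis elem_upair not_elem_zero)
qed

lemma sord_not_ord: "sord x \<Longrightarrow> \<not> ord x"
  unfolding sord_def using is_tag_not_ord ord_elem by blast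

text \<open>Both sets contain the tag, and there is only one, so they can differ in ordinals
  only.\<close>

lemma sord_ext:
  assumes "sord a" "sord b" "\<And>x. ord x \<Longrightarrow> x \<epsilon> a \<longleftrightarrow> x \<epsilon> b"
  shows "a = b"
  by (rule extensionality) (use assms is_tag_iff in \<open>unfold sord_def, metis\<close>)

text \<open>The common source of witnesses for the set existence axioms: any set of ordinals becomes
  an object of the structure by adding the tag.\<close>

lemma sord_ex:
  assumes "is_set P" "\<And>z. P z \<Longrightarrow> ord z"
  shows "\<exists>b. sord b \<and> (\<forall>z. ord z \<longrightarrow> (z \<epsilon> b \<longleftrightarrow> P z))"
proof -
  have "is_set (\<lambda>z. P z \<or> is_tag z)" unfolding is_tag_iff by (intro is_set_or assms is_set_eq)
  then obtain b where b: "\<And>z. z \<epsilon> b \<longleftrightarrow> P z \<or> is_tag z" unfolding is_set_def by blast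
  moreover have "\<exists>t. is_tag t" unfolding is_tag_iff by blast
  ultimately have "sord b" using assms(2) unfolding sord_def by blast
  then show ?thesis using b is_tag_not_ord by blast
qed

definition gfun :: "'m \<Rightarrow> 'm \<Rightarrow> 'm" where
  "gfun x y = (if ord x \<and> ord y then pairing_fun x y else zero)"

lemma ord_gfun [simp]: "ord (gfun x y)"
  by (simp add: gfun_def ord_pairing_fun)

lemma zf_sat_basic [simp]:
  "zf_sat E e (empty_fm i) \<longleftrightarrow> e i = zero"
  "zf_sat E e (tran_fm i) \<longleftrightarrow> tran (e i)"
  "zf_sat E e (upair_fm i j k) \<longleftrightarrow> e k = upair (e i) (e j)"
  "zf_sat E e (max_less_fm i j k l) \<longleftrightarrow> max_less (e i) (e j) (e k) (e l)"
  by (auto simp: empty_fm_def zero_iff tran_fm_def tran_def upair_fm_def eq_upair_iff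
      max_less_fm_def max_less_def)

lemma zf_sat_tag [simp]: "zf_sat E e (tag_fm i) \<longleftrightarrow> is_tag (e i)"
  by (auto simp: tag_fm_def one_fm_def is_tag_def zero_iff)

lemma zf_sat_ord [simp]: "zf_sat E e (ord_fm i) \<longleftrightarrow> ord (e i)"
  by (auto simp: ord_fm_def ord_def)

lemma zf_sat_sord [simp]: "zf_sat E e (sord_fm i) \<longleftrightarrow> sord (e i)"
  by (auto simp: sord_fm_def sord_def)

lemma zf_sat_opair [simp]: "zf_sat E e (opair_fm i j k) \<longleftrightarrow> e k = opair (e i) (e j)"
  by (auto simp: opair_fm_def opair_def)

lemma zf_sat_opair_in [simp]: "zf_sat E e (opair_in_fm i j k) \<longleftrightarrow> opair (e i) (e j) \<epsilon> e k"
  by (auto simp: opair_in_fm_def)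

lemma zf_sat_pless [simp]: "zf_sat E e (pless_fm i j k l) \<longleftrightarrow> pless (e i) (e j) (e k) (e l)"
  by (auto simp: pless_fm_def pless_def)

lemma zf_sat_pair_rel [simp]: "zf_sat E e (pair_rel_fm i j) \<longleftrightarrow> pair_rel (e i) (e j)"
  by (auto simp: pair_rel_fm_def pair_rel_def numeral_eq_Suc)

lemma zf_sat_attempt [simp]: "zf_sat E e (attempt_fm i) \<longleftrightarrow> attempt pair_rel (\<lambda>x. x) (e i)"
proof -
  have "is_set (\<lambda>w. \<exists>z. pair_rel z y \<and> opair z w \<epsilon> f)" for f y
  proof (rule is_set_sep)
    show "is_set (\<lambda>w. w \<epsilon> Uni (Uni f))" by simp
    show "definable (\<lambda>e. \<exists>z. pair_rel z y \<and> opair z (e 0) \<epsilon> f)"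
      by (intro dfi def_wf_definable[OF recur_pair])
    show "w \<epsilon> Uni (Uni f)" if "\<exists>z. pair_rel z y \<and> opair z w \<epsilon> f" for w
      using that unfolding elem_Uni opair_def by (metis elem_upair)
  qed
  from elem_cl[OF this]
  have "v = cl (\<lambda>w. \<exists>z. pair_rel z y \<and> opair z w \<epsilon> f) \<longleftrightarrow> (\<forall>w. w \<epsilon> v \<longleftrightarrow> (\<exists>z. pair_rel z y \<and> opair z w \<epsilon> f))"
    for v y f by (auto intro: extensionality)
  then show ?thesis by (simp add: attempt_fm_def attempt_def numeral_eq_Suc) meson
qed

lemma zf_sat_pairing [simp]: "zf_sat E e pairing_fm \<longleftrightarrow> e 0 = gfun (e 1) (e 2)"
  by (auto simp: pairing_fm_def gfun_def pairing_fun_def recur_iff[OF recur_pair] numeral_eq_Suc)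

definition objects :: "'m set" where "objects = {x. ord x \<or> sord x}"

definition so_rels :: "so_rel \<Rightarrow> 'm list \<Rightarrow> bool" where
  "so_rels r xs = (case r of OrdSym \<Rightarrow> ord (xs ! 0) | SOrdSym \<Rightarrow> sord (xs ! 0)
     | LessSym \<Rightarrow> ord (xs ! 0) \<and> ord (xs ! 1) \<and> xs ! 0 \<epsilon> xs ! 1
     | MemSym \<Rightarrow> ord (xs ! 0) \<and> sord (xs ! 1) \<and> xs ! 0 \<epsilon> xs ! 1)"

definition so_eval :: "(nat \<Rightarrow> 'm) \<Rightarrow> so_tm \<Rightarrow> 'm" where
  "so_eval = eval (\<lambda>_ xs. gfun (xs ! 0) (xs ! 1))"

definition so_sat :: "(nat \<Rightarrow> 'm) \<Rightarrow> so_fm \<Rightarrow> bool" where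
  "so_sat = sat objects (\<lambda>_ xs. gfun (xs ! 0) (xs ! 1)) so_rels"

lemma so_eval_simps [simp]:
  "so_eval e (Var n) = e n" "so_eval e (G s t) = gfun (so_eval e s) (so_eval e t)"
  by (simp_all add: so_eval_def G_def)

lemma so_sat_simps [simp]:
  "\<not> so_sat e \<^bold>\<bottom>"
  "so_sat e (s \<^bold>= t) \<longleftrightarrow> so_eval e s = so_eval e t"
  "so_sat e (Ord t) \<longleftrightarrow> ord (so_eval e t)"
  "so_sat e (SOrd t) \<longleftrightarrow> sord (so_eval e t)"
  "so_sat e (s \<^bold>< t) \<longleftrightarrow> ord (so_eval e s) \<and> ord (so_eval e t) \<and> so_eval e s \<epsilon> so_eval e t"
  "so_sat e (s \<^bold>\<in> t) \<longleftrightarrow> ord (so_eval e s) \<and> sord (so_eval e t) \<and> so_eval e s \<epsilon> so_eval e t"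
  "so_sat e (\<phi> \<^bold>\<longrightarrow> \<psi>) \<longleftrightarrow> (so_sat e \<phi> \<longrightarrow> so_sat e \<psi>)"
  "so_sat e (Forall \<phi>) \<longleftrightarrow> (\<forall>x\<in>objects. so_sat (case_nat x e) \<phi>)"
  "so_sat e (rename \<rho> \<phi>) \<longleftrightarrow> so_sat (\<lambda>n. e (\<rho> n)) \<phi>"
  by (simp_all add: so_sat_def so_eval_def so_rels_def Ord_def SOrd_def less_so_def mem_so_def sat_rename)

lemma so_sat_connectives [simp]:
  "so_sat e (\<^bold>\<not> \<phi>) \<longleftrightarrow> \<not> so_sat e \<phi>"
  "so_sat e (\<phi> \<^bold>\<or> \<psi>) \<longleftrightarrow> so_sat e \<phi> \<or> so_sat e \<psi>"
  "so_sat e (\<phi> \<^bold>\<and> \<psi>) \<longleftrightarrow> so_sat e \<phi> \<and> so_sat e \<psi>"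
  "so_sat e (\<phi> \<^bold>\<longleftrightarrow> \<psi>) \<longleftrightarrow> (so_sat e \<phi> \<longleftrightarrow> so_sat e \<psi>)"
  by auto

lemma so_sat_bounded [simp]:
  "so_sat e (ForallO \<phi>) \<longleftrightarrow> (\<forall>x. ord x \<longrightarrow> so_sat (case_nat x e) \<phi>)"
  "so_sat e (ExistsO \<phi>) \<longleftrightarrow> (\<exists>x. ord x \<and> so_sat (case_nat x e) \<phi>)"
  "so_sat e (ForallS \<phi>) \<longleftrightarrow> (\<forall>x. sord x \<longrightarrow> so_sat (case_nat x e) \<phi>)"
  "so_sat e (ExistsS \<phi>) \<longleftrightarrow> (\<exists>x. sord x \<and> so_sat (case_nat x e) \<phi>)"
  by (auto simp: ForallO_def ExistsO_def ForallS_def ExistsS_def objects_def)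

section \<open>Correctness of the translation\<close>

text \<open>Correctness for single terms is a hypothesis here, so that the lemma can be applied
  inside the induction on terms.\<close>

lemma zf_sat_bind_tms:
  assumes "\<And>t k e \<phi>. t \<in> set ts \<Longrightarrow> zf_sat E e (bind_tm so_interp k t \<phi>) \<longleftrightarrow>
      zf_sat E (case_nat (so_eval (\<lambda>n. e (n + k)) t) e) \<phi>"
  shows "zf_sat E e (bind_tms so_interp k ts \<phi>) \<longleftrightarrow>
    zf_sat E (\<lambda>i. if i < length ts then so_eval (\<lambda>n. e (n + k)) (ts ! i) else e (i - length ts)) \<phi>"
  using assms
proof (induction ts arbitrary: \<phi>)
  case (Cons t ts)
  let ?e = "\<lambda>ts i. if i < length ts then so_eval (\<lambda>n. e (n + k)) (ts ! i) else e (i - length ts)"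
  have 1: "case_nat (so_eval (\<lambda>n. e (n + k)) t) (?e ts) = ?e (t # ts)"
    by (rule ext) (simp split: nat.split)
  have 2: "(\<lambda>n. ?e ts (n + (k + length ts))) = (\<lambda>n. e (n + k))"
    by (rule ext) (simp flip: add.assoc)
  have "zf_sat E e (bind_tms so_interp k (t # ts) \<phi>) \<longleftrightarrow>
      zf_sat E (?e ts) (bind_tm so_interp (k + length ts) t \<phi>)"
    unfolding bind_tms.simps by (rule Cons.IH) (rule Cons.prems, simp)
  also have "\<dots> \<longleftrightarrow> zf_sat E (case_nat (so_eval (\<lambda>n. ?e ts (n + (k + length ts))) t) (?e ts)) \<phi>"
    by (rule Cons.prems) simp
  finally show ?case unfolding 1 2 .
qed simp

lemma zf_sat_bind_tm:
  "wf_tm L_SO t \<Longrightarrow> zf_sat E e (bind_tm so_interp k t \<phi>) \<longleftrightarrow>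
     zf_sat E (case_nat (so_eval (\<lambda>n. e (n + k)) t) e) \<phi>"
proof (induction t arbitrary: k e \<phi>)
  case (Var n)
  have "(\<lambda>i. e (case_nat (n + k) id i)) = case_nat (e (n + k)) e"
    by (rule ext) (simp split: nat.split)
  then show ?case unfolding bind_tm.simps inst_Var zf_sat_simps so_eval_simps by (simp only:)
next
  case (Fun f ts)
  then have len: "length ts = 2" by (simp add: L_SO_def)
  then obtain s t where ts: "ts = [s, t]" by (auto simp: numeral_eq_Suc length_Suc_conv)
  have IH: "zf_sat E e (bind_tm so_interp k t \<phi>) \<longleftrightarrow> zf_sat E (case_nat (so_eval (\<lambda>n. e (n + k)) t) e) \<phi>"
    if "t \<in> set ts" for t k e \<phi> using that Fun by (auto simp: list_all_iff)
  have G: "Fun f ts = G s t" by (cases f) (simp add: G_def ts)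
  let ?e = "\<lambda>i. if i < length ts then so_eval (\<lambda>n. e (n + k)) (ts ! i) else e (i - length ts)"
  \<comment> \<open>After the value \<open>y\<close> has been bound, the rest of the formula must
    skip the slots of the arguments to reach the surrounding context.\<close>
  have env: "(\<lambda>n. case_nat y ?e (case_nat 0 (\<lambda>i. Suc (i + length ts)) n)) = case_nat y e" for y
    by (rule ext) (simp split: nat.split)
  have *: "zf_sat E e (bind_tms so_interp k ts \<psi>) \<longleftrightarrow> zf_sat E ?e \<psi>" for \<psi>
    by (rule zf_sat_bind_tms) (rule IH)
  have "zf_sat E e (bind_tm so_interp k (Fun f ts) \<phi>) \<longleftrightarrow>
     (\<exists>y. (ord y \<or> sord y) \<and> y = gfun (so_eval (\<lambda>n. e (n + k)) s) (so_eval (\<lambda>n. e (n + k)) t) \<and>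
        zf_sat E (case_nat y e) \<phi>)"
    unfolding bind_tm.simps *
    unfolding ExistsU_def so_interp_def by (simp add: env) (simp add: ts)
  then show ?case unfolding G so_eval_simps by auto
qed

lemma zf_sat_translate:
  "wf_fm L_SO \<phi> \<Longrightarrow> zf_sat E e (translate so_interp \<phi>) \<longleftrightarrow> so_sat e \<phi>"
proof (induction \<phi> arbitrary: e)
  case (Equal s t)
  have "zf_sat E e (bind_tms so_interp 0 [s, t] (eq_fm so_interp)) \<longleftrightarrow> so_eval e s = so_eval e t"
    by (subst zf_sat_bind_tms, rule zf_sat_bind_tm) (use Equal in \<open>auto simp: so_interp_def\<close>)
  then show ?case by simp
next
  case (Rel r ts)
  then have *: "zf_sat E e (bind_tms so_interp 0 ts (rel_fm so_interp r)) \<longleftrightarrow>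
      zf_sat E (\<lambda>i. if i < length ts then so_eval (\<lambda>n. e (n + 0)) (ts ! i) else e (i - length ts)) (rel_fm so_interp r)"
    by (intro zf_sat_bind_tms zf_sat_bind_tm) (auto simp: list_all_iff)
  have "length ts = (case r of OrdSym \<Rightarrow> 1 | SOrdSym \<Rightarrow> 1 | LessSym \<Rightarrow> 2 | MemSym \<Rightarrow> 2)"
    using Rel by (simp add: L_SO_def)
  then show ?case unfolding translate.simps * so_sat_def sat.simps
    by (cases r) (simp_all add: so_interp_def so_rels_def so_eval_def)
next
  case (Forall \<phi>)
  then show ?case by (auto simp: ForallU_def so_interp_def objects_def)
qed (simp_all del: bind_tms.simps)


subsection \<open>The axioms of SO\<close>

lemma so_sat_Foralls:
  "(\<And>e. range e \<subseteq> objects \<Longrightarrow> so_sat e \<phi>) \<Longrightarrow> range e \<subseteq> objects \<Longrightarrow> so_sat e (Foralls n \<phi>)"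
proof (induction n arbitrary: e)
  case (Suc n)
  have "so_sat (case_nat x e) (Foralls n \<phi>)" if "x \<in> objects" for x
    using that Suc.prems by (intro Suc.IH) (auto simp: image_subset_iff split: nat.split)
  then show ?case by (simp add: Foralls_def)
qed (simp add: Foralls_def)

lemma so_SOR: "so_sat e so_SOR"
  by (auto simp: so_SOR_def objects_def sord_not_ord)

lemma so_WO: "so_sat e so_WO"
proof -
  have "\<exists>x. ord x \<and> x \<epsilon> a \<and> (\<forall>y. ord y \<longrightarrow> y \<epsilon> x \<longrightarrow> \<not> y \<epsilon> a)" if "ord b" "b \<epsilon> a" for a b
  proof -
    have "definable (\<lambda>e. e 0 \<epsilon> a)" by (intro dfi)
    from ord_least[OF this that(2,1)] show ?thesis by blast
  qed
  then show ?thesis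
    by (simp add: so_WO_def) (use ord_linear ord_trans in meson)
qed

lemma so_INF: "so_sat e so_INF"
proof -
  from limit_ord_ex obtain a where a: "ord a" "\<exists>b. b \<epsilon> a" "\<And>b. b \<epsilon> a \<Longrightarrow> \<exists>c. b \<epsilon> c \<and> c \<epsilon> a" by blast
  then show ?thesis
    by (simp add: so_INF_def) (rule exI[of _ a], use a ord_elem[OF a(1)] in blast)
qed

lemma so_EXT: "so_sat e so_EXT"
  by (auto simp: so_EXT_def intro: sord_ext)

lemma so_INI: "so_sat e so_INI"
proof -
  have "\<exists>b. sord b \<and> (\<forall>z. ord z \<longrightarrow> (z \<epsilon> b \<longleftrightarrow> z \<epsilon> a))" if "ord a" for a
    by (rule sord_ex) (use that ord_elem in auto)
  then show ?thesis by (simp add: so_INI_def) blast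
qed

lemma so_BOU: "so_sat e so_BOU"
  using ord_bound[OF is_set_elem] by (simp add: so_BOU_def) blast

lemma so_sat_pair_less:
  assumes "ord (e i)" "ord (e j)" "ord (e k)" "ord (e l)"
  shows "so_sat e (pair_less i j k l) \<longleftrightarrow> pless (e i) (e j) (e k) (e l)"
  unfolding pless_iff[OF assms(3,4,1,2)] using assms
  by (auto simp: pair_less_def is_max_def Let_def omax_def)

lemma so_GPF: "so_sat e so_GPF"
  using pairing_fun_le_iff
  by (simp add: so_GPF_def le_so_def so_sat_pair_less gfun_def ord_pairing_fun disj_imp)

lemma so_SUR: "so_sat e so_SUR"
  using pairing_fun_surj by (simp add: so_SUR_def gfun_def) metis

lemma so_POW: "so_sat e so_POW"
proof -
  have "\<exists>b. sord b \<and> (\<forall>z. sord z \<longrightarrow> (\<exists>x. ord x \<and> x \<epsilon> z) \<longrightarrow> (\<forall>x. ord x \<longrightarrow> x \<epsilon> z \<longrightarrow> x \<epsilon> a) \<longrightarrow>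
      (\<exists>k. ord k \<and> (\<forall>x. ord x \<longrightarrow> (x \<epsilon> z \<longleftrightarrow> gfun x k \<epsilon> b)) \<and>
        (\<forall>l. ord l \<longrightarrow> (\<forall>x. ord x \<longrightarrow> (x \<epsilon> z \<longleftrightarrow> gfun x l \<epsilon> b)) \<longrightarrow> l = k)))"
    (is "\<exists>b. sord b \<and> ?P a b")
    if "sord a" for a
  proof -
    \<comment> \<open>Subsets are enumerated without the tag, as plain sets of ordinals.\<close>
    define X where "X = cl (\<lambda>s. \<forall>w. w \<epsilon> s \<longrightarrow> w \<epsilon> a \<and> ord w)"
    have *: "is_set (\<lambda>s. \<forall>w. w \<epsilon> s \<longrightarrow> w \<epsilon> a \<and> ord w)"
      by (rule is_set_sep[OF is_set_power[of a]]) (intro dfi | simp)+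
    have X: "s \<epsilon> X \<longleftrightarrow> (\<forall>w. w \<epsilon> s \<longrightarrow> w \<epsilon> a \<and> ord w)" for s
      unfolding X_def by (rule elem_cl[OF *])
    obtain \<kappa> h where \<kappa>: "ord \<kappa>" and def_h: "def_term (\<lambda>e. h (e 0))"
      and h: "\<And>x. x \<epsilon> \<kappa> \<Longrightarrow> h x \<epsilon> X" "\<And>x y. x \<epsilon> \<kappa> \<Longrightarrow> y \<epsilon> \<kappa> \<Longrightarrow> h x = h y \<Longrightarrow> x = y"
        "\<And>z. z \<epsilon> X \<Longrightarrow> \<exists>x. x \<epsilon> \<kappa> \<and> h x = z"
      by (rule enumeration[of X]) blast
    define P where "P p \<longleftrightarrow> (\<exists>x y. x \<epsilon> a \<and> y \<epsilon> \<kappa> \<and> x \<epsilon> h y \<and> p = pairing_fun x y)" for p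
    have "is_set (\<lambda>p. \<exists>x y. x \<epsilon> a \<and> y \<epsilon> \<kappa> \<and> p = pairing_fun x y)"
      by (intro is_set_image2 is_set_elem dfi)
    then have "is_set P"
      by (rule is_set_sep) (unfold P_def, intro dfi def_term_comp1[OF def_h], blast)
    then have "\<exists>b. sord b \<and> (\<forall>z. ord z \<longrightarrow> (z \<epsilon> b \<longleftrightarrow> P z))"
      by (rule sord_ex) (auto simp: P_def ord_pairing_fun)
    then obtain b where b: "sord b" "\<And>z. ord z \<Longrightarrow> z \<epsilon> b \<longleftrightarrow> P z" by blast
    \<comment> \<open>By injectivity of pairing, the section of \<open>b\<close> at \<open>y\<close>
      is \<open>h y\<close> for \<open>y\<close> below \<kappa>, and it is empty for all other
      ordinals.\<close>
    have in_b: "gfun x y \<epsilon> b \<longleftrightarrow> y \<epsilon> \<kappa> \<and> x \<epsilon> h y" if x: "ord x" and y: "ord y" for x y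
    proof -
      have "x' = x \<and> y' = y" if "x' \<epsilon> h y'" "y' \<epsilon> \<kappa>" "pairing_fun x y = pairing_fun x' y'" for x' y'
        using that h(1)[of y'] X pairing_fun_inject[OF x y, of x' y'] ord_elem[OF \<kappa>] by auto
      moreover have "x \<epsilon> a" if "x \<epsilon> h y" "y \<epsilon> \<kappa>" using that h(1) X by blast
      moreover have "gfun x y = pairing_fun x y" using x y by (simp add: gfun_def)
      ultimately show ?thesis using b(2)[OF ord_pairing_fun, of x y] unfolding P_def by metis
    qed
    show ?thesis
    proof (rule exI[of _ b], intro conjI allI HOL.impI)
      show "sord b" by (rule b)
      fix z assume z: "sord z" "\<exists>x. ord x \<and> x \<epsilon> z" "\<forall>x. ord x \<longrightarrow> x \<epsilon> z \<longrightarrow> x \<epsilon> a"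
      have **: "is_set (\<lambda>w. w \<epsilon> z \<and> ord w)"
        by (rule is_set_sep[of "\<lambda>w. w \<epsilon> z"]) (intro dfi | simp)+
      \<comment> \<open>Removing the tag turns \<open>z\<close> into an element of the enumerated
        set \<open>X\<close>.\<close>
      define z' where "z' = cl (\<lambda>w. w \<epsilon> z \<and> ord w)"
      have z': "w \<epsilon> z' \<longleftrightarrow> w \<epsilon> z \<and> ord w" for w unfolding z'_def by (rule elem_cl[OF **])
      then have "z' \<epsilon> X" unfolding X using z(3) by blast
      then obtain k where k: "k \<epsilon> \<kappa>" "h k = z'" using h(3) by blast
      then have "ord k" using \<kappa> ord_elem by blast
      moreover have "\<forall>x. ord x \<longrightarrow> (x \<epsilon> z \<longleftrightarrow> gfun x k \<epsilon> b)"
        using in_b[OF _ \<open>ord k\<close>] k z' by auto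
      \<comment> \<open>An element of \<open>z\<close> yields an element of the section at
        \<open>l\<close>, which places \<open>l\<close> below \<kappa>; then \<open>h l\<close> and
        \<open>h k\<close> are the same set, and \<open>h\<close> is injective there.\<close>
      moreover have "l = k" if l: "ord l" "\<forall>x. ord x \<longrightarrow> (x \<epsilon> z \<longleftrightarrow> gfun x l \<epsilon> b)" for l
      proof -
        from l z(2) have "l \<epsilon> \<kappa>" using in_b[OF _ l(1)] by blast
        moreover have "h l = z'"
        proof (rule extensionality)
          show "w \<epsilon> h l \<longleftrightarrow> w \<epsilon> z'" for w
            using in_b[OF _ l(1), of w] l(2) \<open>l \<epsilon> \<kappa>\<close> h(1)[of l] X z' by blast
        qed
        ultimately show "l = k" using h(2) k by metis
      qed
      ultimately show "\<exists>k. ord k \<and> (\<forall>x. ord x \<longrightarrow> (x \<epsilon> z \<longleftrightarrow> gfun x k \<epsilon> b)) \<and>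
        (\<forall>l. ord l \<longrightarrow> (\<forall>x. ord x \<longrightarrow> (x \<epsilon> z \<longleftrightarrow> gfun x l \<epsilon> b)) \<longrightarrow> l = k)" by blast
    qed
  qed
  then show ?thesis
    apply (simp add: so_POW_def Exists1O_def)
    apply (intro allI HOL.impI)
    subgoal premises prems for a
    proof -
      from prems(1)[OF prems(2)] obtain b where b: "sord b" "?P a b" by (elim exE conjE)
      show ?thesis
      proof (rule exI[of _ b], intro conjI allI HOL.impI, rule b(1), goal_cases)
        case (1 z)
        then have "\<exists>k. ord k \<and> (\<forall>x. ord x \<longrightarrow> (x \<epsilon> z \<longleftrightarrow> gfun x k \<epsilon> b)) \<and>
          (\<forall>l. ord l \<longrightarrow> (\<forall>x. ord x \<longrightarrow> (x \<epsilon> z \<longleftrightarrow> gfun x l \<epsilon> b)) \<longrightarrow> l = k)"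
          using b(2) by simp
        then obtain k where k: "ord k" "\<forall>x. ord x \<longrightarrow> (x \<epsilon> z \<longleftrightarrow> gfun x k \<epsilon> b)"
          "\<forall>l. ord l \<longrightarrow> (\<forall>x. ord x \<longrightarrow> (x \<epsilon> z \<longleftrightarrow> gfun x l \<epsilon> b)) \<longrightarrow> l = k"
          by (elim exE conjE)
        show ?case
        proof (rule exI[of _ k], intro conjI, rule k(1), goal_cases)
          case 1
          show ?case using k(2) b(1) by blast
        next
          case 2
          show ?case
          proof (intro allI HOL.impI, goal_cases)
            case (1 l)
            show ?case
            proof (cases "\<forall>x. ord x \<longrightarrow> (x \<epsilon> z \<longleftrightarrow> gfun x l \<epsilon> b)")
              case True
              then show ?thesis using k(3) 1 by blast
            next
              case False
              then show ?thesis using b(1) by blast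
            qed
          qed
        qed
      qed
    qed
    done
qed

text \<open>Makes separation and replacement in the model applicable to arbitrary formulas of SO:
  the assignment \<open>e\<close> is absorbed into the parameters.\<close>

lemma definable_translate:
  "definable (\<lambda>e'. zf_sat E (case_nat (e' 0) e) (translate so_interp \<phi>))"
  "definable (\<lambda>e'. zf_sat E (case_nat (e' 0) (case_nat (e' (Suc 0)) e)) (translate so_interp \<phi>))"
proof -
  define f g :: "nat \<Rightarrow> (nat \<Rightarrow> 'm) \<Rightarrow> 'm"
    where "f i = (case i of 0 \<Rightarrow> \<lambda>e'. e' 0 | Suc i \<Rightarrow> \<lambda>_. e i)"
      and "g i = (case i of 0 \<Rightarrow> \<lambda>e'. e' 0 | Suc 0 \<Rightarrow> \<lambda>e'. e' (Suc 0) | Suc (Suc i) \<Rightarrow> \<lambda>_. e i)" for i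
  have "(\<exists>j. f i = (\<lambda>e. e j)) \<or> (\<exists>c. f i = (\<lambda>e. c))"
    and "(\<exists>j. g i = (\<lambda>e. e j)) \<or> (\<exists>c. g i = (\<lambda>e. c))" for i
    by (auto simp: f_def g_def split: nat.split)
  then have "definable (\<lambda>e'. zf_sat E (\<lambda>i. f i e') (translate so_interp \<phi>))"
    "definable (\<lambda>e'. zf_sat E (\<lambda>i. g i e') (translate so_interp \<phi>))"
    by (intro definable_sat[OF wf_translate]; blast)+
  moreover have "(\<lambda>i. f i e') = case_nat (e' 0) e" "(\<lambda>i. g i e') = case_nat (e' 0) (case_nat (e' (Suc 0)) e)" for e'
    by (rule ext, simp add: f_def g_def split: nat.split)+
  ultimately show "definable (\<lambda>e'. zf_sat E (case_nat (e' 0) e) (translate so_interp \<phi>))"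
    "definable (\<lambda>e'. zf_sat E (case_nat (e' 0) (case_nat (e' (Suc 0)) e)) (translate so_interp \<phi>))"
    by (simp_all only:)
qed

lemma so_SEP:
  assumes wf: "wf_fm L_SO \<phi>" and "range e \<subseteq> objects"
  shows "so_sat e (so_SEP n \<phi>)"
  unfolding so_SEP_def
proof (rule so_sat_Foralls[OF _ assms(2)])
  fix e :: "nat \<Rightarrow> 'm"
  have env: "(\<lambda>n. case_nat z (case_nat b (case_nat a e)) (case_nat 0 (\<lambda>i. i + 3) n)) = case_nat z e" for z b a
    by (rule ext) (simp split: nat.split add: numeral_eq_Suc)
  have "\<exists>b. sord b \<and> (\<forall>z. ord z \<longrightarrow> (z \<epsilon> b \<longleftrightarrow> z \<epsilon> a \<and> ord z \<and> so_sat (case_nat z e) \<phi>))" for a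
    unfolding zf_sat_translate[OF wf, symmetric]
    by (rule sord_ex, rule is_set_sep[of "\<lambda>z. z \<epsilon> a"]) (intro dfi definable_translate | simp)+
  then show "so_sat e (ForallS (ExistsS (ForallO (Var 0 \<^bold>\<in> Var 1 \<^bold>\<longleftrightarrow> Var 0 \<^bold>\<in> Var 2 \<^bold>\<and>
      rename (case_nat 0 (\<lambda>i. i + 3)) \<phi>))))"
    unfolding so_sat_bounded so_sat_simps env by simp blast
qed

lemma so_REP:
  assumes wf: "wf_fm L_SO \<phi>" and "range e \<subseteq> objects"
  shows "so_sat e (so_REP n \<phi>)"
  unfolding so_REP_def
proof (rule so_sat_Foralls[OF _ assms(2)])
  fix e :: "nat \<Rightarrow> 'm"
  have env: "(\<lambda>n. case_nat z (case_nat y (case_nat x e)) (case_nat 2 (case_nat 1 (\<lambda>i. i + 3)) n)) = case_nat x (case_nat y e)"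
    "(\<lambda>n. case_nat z (case_nat y (case_nat x e)) (case_nat 2 (case_nat 0 (\<lambda>i. i + 3)) n)) = case_nat x (case_nat z e)"
    "(\<lambda>n. case_nat x (case_nat z (case_nat b (case_nat a e))) (case_nat 0 (case_nat 1 (\<lambda>i. i + 4)) n)) = case_nat x (case_nat z e)"
    for x y z a b
    by (rule ext, simp split: nat.split add: numeral_eq_Suc)+
  define \<psi> where "\<psi> x y \<longleftrightarrow> ord x \<and> ord y \<and> so_sat (case_nat x (case_nat y e)) \<phi>" for x y
  have def_\<psi>: "definable (\<lambda>e. \<psi> (e 0) (e (Suc 0)))"
    unfolding \<psi>_def zf_sat_translate[OF wf, symmetric] by (intro dfi definable_translate)
  have "\<exists>b. sord b \<and> (\<forall>y. ord y \<longrightarrow> (y \<epsilon> b \<longleftrightarrow> (\<exists>x. x \<epsilon> a \<and> \<psi> x y)))"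
    if fn: "\<And>x y z. \<psi> x y \<Longrightarrow> \<psi> x z \<Longrightarrow> y = z" for a
  proof (rule sord_ex)
    define F where "F x = tha (\<lambda>y. \<psi> x y)" for x
    have F: "F x = y" if "\<psi> x y" for x y unfolding F_def by (rule tha_equality) (use that fn in blast)+
    \<comment> \<open>Members of \<open>a\<close> without a value, among them the tag, are removed
      first, because \<open>F\<close> would send them to a default value.\<close>
    have "is_set (\<lambda>x. x \<epsilon> a \<and> (\<exists>y. \<psi> x y))"
      by (rule is_set_sep[of "\<lambda>x. x \<epsilon> a"]) (intro dfi definable_comp2[OF def_\<psi>] | simp)+
    then have "is_set (\<lambda>y. \<exists>x. (x \<epsilon> a \<and> (\<exists>y. \<psi> x y)) \<and> y = F x)"
      by (rule is_set_image) (unfold F_def, intro dfi definable_comp2[OF def_\<psi>])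
    then show "is_set (\<lambda>y. \<exists>x. x \<epsilon> a \<and> \<psi> x y)" by (rule is_set_cong) (use F in blast)
  qed (auto simp: \<psi>_def)
  then show "so_sat e
     (ForallO (ForallO (ForallO
        (rename (case_nat 2 (case_nat 1 (\<lambda>i. i + 3))) \<phi> \<^bold>\<and>
         rename (case_nat 2 (case_nat 0 (\<lambda>i. i + 3))) \<phi> \<^bold>\<longrightarrow> Var 1 \<^bold>= Var 0))) \<^bold>\<longrightarrow>
      ForallS (ExistsS (ForallO (Var 0 \<^bold>\<in> Var 1 \<^bold>\<longleftrightarrow>
        ExistsO (Var 0 \<^bold>\<in> Var 3 \<^bold>\<and> rename (case_nat 0 (case_nat 1 (\<lambda>i. i + 4))) \<phi>)))))"
    unfolding so_sat_bounded so_sat_simps env \<psi>_def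
    apply simp
    apply (intro allI HOL.impI)
    subgoal premises prems for a
    proof -
      have "\<exists>b. sord b \<and> (\<forall>y. ord y \<longrightarrow> (y \<epsilon> b \<longleftrightarrow> (\<exists>x. x \<epsilon> a \<and> ord x \<and> so_sat (case_nat x (case_nat y e)) \<phi>)))"
        by (rule prems(1)) (use prems(2) in blast)
      then obtain b where "sord b" "\<And>y. ord y \<Longrightarrow> (y \<epsilon> b \<longleftrightarrow> (\<exists>x. x \<epsilon> a \<and> ord x \<and> so_sat (case_nat x (case_nat y e)) \<phi>))"
        by blast
      then show ?thesis by (intro exI[of _ b]) (simp, blast)
    qed
    done
qed

end


section \<open>Models of ZFC\<close>

instance zf_rel :: countable
  by countable_datatype

lemma fv_Foralls: "fv_fm (Foralls n \<phi>) = {i. i + n \<in> fv_fm \<phi>}"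
  by (induction n arbitrary: \<phi>) (auto simp: Foralls_def)

lemma wf_Foralls [simp]: "wf_fm L (Foralls n \<phi>) = wf_fm L \<phi>"
  by (induction n) (simp_all add: Foralls_def)

lemma zf_sat_Foralls: "zf_sat E e' (Foralls n \<phi>) \<Longrightarrow> (\<And>i. e (i + n) = e' i) \<Longrightarrow> zf_sat E e \<phi>"
proof (induction n arbitrary: e')
  case 0
  then have "e = e'" by auto
  then show ?case using 0 by (simp add: Foralls_def)
next
  case (Suc n)
  have "zf_sat E (case_nat (e n) e') (Foralls n \<phi>)" using Suc.prems(1) by (simp add: Foralls_def)
  then show ?case by (rule Suc.IH) (use Suc.prems(2) in \<open>simp split: nat.split\<close>)
qed

lemma zf_sat_cong: "(\<And>n. n \<in> fv_fm \<phi> \<Longrightarrow> e n = e' n) \<Longrightarrow> zf_sat E e \<phi> \<Longrightarrow> zf_sat E e' \<phi>"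
  unfolding zf_sat_def using sat_cong by blast

lemma fv_zf_separation: "fv_fm \<phi> \<subseteq> {..<n + 1} \<Longrightarrow> fv_fm (zf_separation n \<phi>) = {}"
  by (auto simp: zf_separation_def fv_Foralls fv_fm_rename split: nat.splits)

lemma fv_zf_replacement: "fv_fm \<phi> \<subseteq> {..<n + 2} \<Longrightarrow> fv_fm (zf_replacement n \<phi>) = {}"
  by (auto simp: zf_replacement_def fv_Foralls fv_fm_rename split: nat.splits)

lemma ZFC_sentence: "\<phi> \<in> ZFC \<Longrightarrow> fv_fm \<phi> = {}"
proof -
  have "fv_fm zf_extensionality = {}" "fv_fm zf_foundation = {}" "fv_fm zf_pairing = {}"
    "fv_fm zf_union = {}" "fv_fm zf_powerset = {}" "fv_fm zf_infinity = {}" "fv_fm zf_choice = {}"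
    by (auto simp: zf_extensionality_def zf_foundation_def zf_pairing_def zf_union_def
        zf_powerset_def zf_infinity_def zf_choice_def fv_Foralls)
  then show "\<phi> \<in> ZFC \<Longrightarrow> fv_fm \<phi> = {}"
    unfolding ZFC_def by (auto simp: fv_zf_separation fv_zf_replacement)
qed

lemma ZFC_wf: "\<phi> \<in> ZFC \<Longrightarrow> wf_fm L_ZF \<phi>"
  by (auto simp: ZFC_def zf_extensionality_def zf_foundation_def zf_pairing_def zf_union_def
      zf_powerset_def zf_infinity_def zf_choice_def zf_separation_def zf_replacement_def)

lemma zf_model:
  assumes ZFC: "\<And>\<phi>. \<phi> \<in> ZFC \<Longrightarrow> zf_sat E e0 \<phi>"
  shows "zf E"
proof
  \<comment> \<open>The axioms are sentences, so the assignment may be chosen freely; the schemes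
    below exploit this.\<close>
  have ax: "zf_sat E e \<phi>" if "\<phi> \<in> ZFC" for \<phi> e
    using zf_sat_cong[OF _ ZFC[OF that]] ZFC_sentence[OF that] by blast
  have "zf_sat E e0 zf_extensionality" by (rule ZFC) (simp add: ZFC_def)
  then show "x = y" if "\<And>z. E z x \<longleftrightarrow> E z y" for x y
    using that by (simp add: zf_extensionality_def Foralls_def numeral_eq_Suc)
  have "zf_sat E e0 zf_foundation" by (rule ZFC) (simp add: ZFC_def)
  then show "\<exists>y. E y x \<and> \<not> (\<exists>z. E z x \<and> E z y)" if "E y x" for x y
    using that by (auto simp: zf_foundation_def numeral_eq_Suc)
  have "zf_sat E e0 zf_pairing" by (rule ZFC) (simp add: ZFC_def)
  then show "\<exists>p. \<forall>z. E z p \<longleftrightarrow> z = x \<or> z = y" for x y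
    unfolding zf_pairing_def Foralls_def by (simp add: numeral_eq_Suc) metis
  have "zf_sat E e0 zf_union" by (rule ZFC) (simp add: ZFC_def)
  then show "\<exists>u. \<forall>z. E z u \<longleftrightarrow> (\<exists>y. E z y \<and> E y x)" for x
    unfolding zf_union_def by (simp add: numeral_eq_Suc) metis
  have "zf_sat E e0 zf_powerset" by (rule ZFC) (simp add: ZFC_def)
  then show "\<exists>p. \<forall>z. E z p \<longleftrightarrow> (\<forall>w. E w z \<longrightarrow> E w x)" for x
    unfolding zf_powerset_def by (simp add: numeral_eq_Suc) metis
  have "zf_sat E e0 zf_infinity" by (rule ZFC) (simp add: ZFC_def)
  then show "\<exists>x. (\<exists>e. E e x \<and> (\<forall>w. \<not> E w e)) \<and>
      (\<forall>y. E y x \<longrightarrow> (\<exists>s. E s x \<and> (\<forall>w. E w s \<longleftrightarrow> E w y \<or> w = y)))"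
    unfolding zf_infinity_def by (simp add: numeral_eq_Suc) metis
  have choice: "zf_sat E e0 zf_choice" by (rule ZFC) (simp add: ZFC_def)
  show "\<exists>c. \<forall>x. E x F \<longrightarrow> (\<exists>w. \<forall>v. E v x \<and> E v c \<longleftrightarrow> v = w)"
    if F1: "\<And>x. E x F \<Longrightarrow> \<exists>w. E w x"
      and F2: "\<And>x y w. E x F \<Longrightarrow> E y F \<Longrightarrow> E w x \<Longrightarrow> E w y \<Longrightarrow> x = y" for F
  proof -
    have imp_False: "(P \<longrightarrow> False) \<longleftrightarrow> \<not> P" for P by simp
    \<comment> \<open>The shape of the choice axiom once its connectives have been unfolded and
      negations partly pushed inwards; it is brought back to the form of the locale
      afterwards.\<close>
    have "(\<forall>x. E x F \<longrightarrow> (\<exists>w. E w x)) \<and>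
        (\<forall>x y. (\<not> E x F \<or> \<not> E y F \<or> x = y) \<or> (\<forall>w. \<not> E w x \<or> \<not> E w y)) \<longrightarrow>
      (\<exists>c. \<forall>x. \<not> E x F \<or> (\<exists>w. \<forall>v. \<not> ((E v x \<and> E v c) \<and> v \<noteq> w \<or>
        \<not> (v \<noteq> w \<or> \<not> (\<not> E v x \<or> \<not> E v c)))))"
      using choice
      unfolding zf_choice_def Foralls_def numeral_eq_Suc pred_numeral_simps One_nat_def
        funpow.simps comp_def id_apply zf_sat_connectives zf_sat_simps
      by (simp only: nat.case id_def pred_numeral_simps BitM.simps numeral_One One_nat_def
          funpow.simps comp_def zf_sat_simps imp_False not_imp not_not not_all not_ex de_Morgan_conj)
        (erule spec)
    moreover have "\<forall>x. E x F \<longrightarrow> (\<exists>w. E w x)" using F1 by blast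
    moreover have "\<forall>x y. (\<not> E x F \<or> \<not> E y F \<or> x = y) \<or> (\<forall>w. \<not> E w x \<or> \<not> E w y)" using F2 by blast
    ultimately obtain c where c: "\<forall>x. \<not> E x F \<or> (\<exists>w. \<forall>v. \<not> ((E v x \<and> E v c) \<and> v \<noteq> w \<or>
        \<not> (v \<noteq> w \<or> \<not> (\<not> E v x \<or> \<not> E v c))))" by (elim HOL.impE conjI exE)
    show ?thesis
    proof (rule exI[of _ c], intro allI HOL.impI)
      fix x assume "E x F"
      with c obtain w where "\<forall>v. \<not> ((E v x \<and> E v c) \<and> v \<noteq> w \<or>
        \<not> (v \<noteq> w \<or> \<not> (\<not> E v x \<or> \<not> E v c)))" by blast
      then show "\<exists>w. \<forall>v. E v x \<and> E v c \<longleftrightarrow> v = w" by (intro exI[of _ w] allI) blast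
    qed
  qed
  show "\<exists>y. \<forall>z. E z y \<longleftrightarrow> E z x \<and> zf_sat E (case_nat z e) \<phi>" if wf: "wf_fm L_ZF \<phi>" for \<phi> x e
  proof -
    obtain n where "fv_fm \<phi> \<subseteq> {..<n}" using finite_fv_fm finite_nat_bounded by blast
    then have "fv_fm \<phi> \<subseteq> {..<n + 1}" by auto
    then have "zf_separation n \<phi> \<in> ZFC" using wf unfolding ZFC_def by blast
    \<comment> \<open>Starting from the tail of \<open>e\<close>, the \<open>n\<close> universal
      quantifiers over parameters are instantiated so as to restore \<open>e\<close>.\<close>
    then have "zf_sat E (\<lambda>i. e (i + n)) (zf_separation n \<phi>)" by (rule ax)
    from zf_sat_Foralls[OF this[unfolded zf_separation_def], of e]
    have *: "zf_sat E e (Forall (Exists (Forall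
      (elem 0 1 \<^bold>\<longleftrightarrow> elem 0 2 \<^bold>\<and> rename (case_nat 0 (\<lambda>i. i + 3)) \<phi>))))" by simp
    have env: "(\<lambda>n. case_nat z (case_nat b (case_nat a e)) (case_nat 0 (\<lambda>i. i + 3) n)) = case_nat z e" for z b a
      by (rule ext) (simp split: nat.split add: numeral_eq_Suc)
    from *[unfolded zf_sat_simps zf_sat_connectives env] show ?thesis
      by simp (drule spec[of _ x], blast)
  qed
  show "\<exists>b. \<forall>y. E y b \<longleftrightarrow> (\<exists>x. E x a \<and> zf_sat E (case_nat x (case_nat y e)) \<phi>)"
    if wf: "wf_fm L_ZF \<phi>" and fn: "\<And>x y z. zf_sat E (case_nat x (case_nat y e)) \<phi> \<Longrightarrow>
      zf_sat E (case_nat x (case_nat z e)) \<phi> \<Longrightarrow> y = z" for \<phi> e a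
  proof -
    obtain n where "fv_fm \<phi> \<subseteq> {..<n}" using finite_fv_fm finite_nat_bounded by blast
    then have "fv_fm \<phi> \<subseteq> {..<n + 2}" by auto
    then have "zf_replacement n \<phi> \<in> ZFC" using wf unfolding ZFC_def by blast
    then have "zf_sat E (\<lambda>i. e (i + n)) (zf_replacement n \<phi>)" by (rule ax)
    from zf_sat_Foralls[OF this[unfolded zf_replacement_def], of e]
    have *: "zf_sat E e (Foralls 3
        (rename (case_nat 2 (case_nat 1 (\<lambda>i. i + 3))) \<phi> \<^bold>\<and>
         rename (case_nat 2 (case_nat 0 (\<lambda>i. i + 3))) \<phi> \<^bold>\<longrightarrow> Var 1 \<^bold>= Var 0) \<^bold>\<longrightarrow>
      Forall (Exists (Forall (elem 0 1 \<^bold>\<longleftrightarrow>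
        Exists (elem 0 3 \<^bold>\<and> rename (case_nat 0 (case_nat 1 (\<lambda>i. i + 4))) \<phi>)))))" by simp
    have env: "(\<lambda>n. case_nat z (case_nat y (case_nat x e)) (case_nat 2 (case_nat 1 (\<lambda>i. i + 3)) n)) = case_nat x (case_nat y e)"
      "(\<lambda>n. case_nat z (case_nat y (case_nat x e)) (case_nat 2 (case_nat 0 (\<lambda>i. i + 3)) n)) = case_nat x (case_nat z e)"
      "(\<lambda>n. case_nat x (case_nat z (case_nat b (case_nat a e))) (case_nat 0 (case_nat 1 (\<lambda>i. i + 4)) n)) = case_nat x (case_nat z e)"
      for x y z a b
      by (rule ext, simp split: nat.split add: numeral_eq_Suc)+
    have F3: "Foralls 3 \<psi> = Forall (Forall (Forall \<psi>))" for \<psi> :: zf_fm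
      by (simp add: Foralls_def numeral_eq_Suc)
    from *[unfolded F3 zf_sat_simps zf_sat_connectives env] fn show ?thesis
      by (simp add: numeral_eq_Suc) metis
  qed
qed

text \<open>A finite carrier would have a universal set by pairing and union.\<close>

lemma ZFC_carrier_infinite:
  assumes "U \<noteq> {}" and ZFC: "\<And>\<phi>. \<phi> \<in> ZFC \<Longrightarrow> sat U F R e \<phi>"
  shows "infinite U"
proof
  assume "finite U"
  define E where "E x y = R Elem [x, y]" for x y
  have "sat U F R e zf_pairing" by (rule ZFC) (simp add: ZFC_def)
  then have pairing: "\<exists>p\<in>U. \<forall>z\<in>U. E z p \<longleftrightarrow> z = x \<or> z = y" if "x \<in> U" "y \<in> U" for x y
    using that unfolding zf_pairing_def Foralls_def elem_def E_def by (simp add: numeral_eq_Suc) metis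
  have "sat U F R e zf_union" by (rule ZFC) (simp add: ZFC_def)
  then have union: "\<exists>u\<in>U. \<forall>z\<in>U. E z u \<longleftrightarrow> (\<exists>y\<in>U. E z y \<and> E y x)" if "x \<in> U" for x
    using that unfolding zf_union_def elem_def E_def by (simp add: numeral_eq_Suc) metis
  have "sat U F R e zf_foundation" by (rule ZFC) (simp add: ZFC_def)
  then have foundation: "\<exists>y\<in>U. E y x \<and> \<not> (\<exists>z\<in>U. E z x \<and> E z y)" if "x \<in> U" "\<exists>y\<in>U. E y x" for x
    using that unfolding zf_foundation_def elem_def E_def by (simp add: numeral_eq_Suc)
  have "\<exists>x\<in>U. \<forall>z\<in>S. E z x" if "finite S" "S \<subseteq> U" for S
    using that
  proof (induction S rule: finite_induct)
    case empty
    then show ?case using assms(1) by blast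
  next
    case (insert a S)
    then obtain x where x: "x \<in> U" "\<forall>z\<in>S. E z x" by blast
    \<comment> \<open>One more element is captured by adding the singleton of \<open>a\<close> to
      \<open>x\<close>: \<open>u\<close> is the union of the pair of \<open>x\<close> and that
      singleton.\<close>
    obtain p where p: "p \<in> U" "\<forall>z\<in>U. E z p \<longleftrightarrow> z = a \<or> z = a" using pairing insert.prems by blast
    obtain q where q: "q \<in> U" "\<forall>z\<in>U. E z q \<longleftrightarrow> z = x \<or> z = p" using pairing x(1) p(1) by blast
    obtain u where u: "u \<in> U" "\<forall>z\<in>U. E z u \<longleftrightarrow> (\<exists>y\<in>U. E z y \<and> E y q)" using union q(1) by blast
    have "E z u" if "z \<in> insert a S" for z
    proof -
      have "z \<in> U" using that insert.prems by blast
      moreover have "E z p \<or> E z x" using that p(2) x(2) \<open>z \<in> U\<close> by auto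
      moreover have "E x q" "E p q" using q(2) x(1) p(1) by simp_all
      ultimately show ?thesis using u(2) x(1) p(1) by auto
    qed
    then show ?case using u(1) by blast
  qed
  then obtain x where x: "x \<in> U" "\<forall>z\<in>U. E z x" using \<open>finite U\<close> by blast
  \<comment> \<open>The universal set belongs to itself, so its singleton violates
    foundation.\<close>
  obtain p where p: "p \<in> U" "\<forall>z\<in>U. E z p \<longleftrightarrow> z = x \<or> z = x" using pairing x(1) by blast
  then have "E x p" using x(1) by simp
  then obtain y where "y \<in> U" "E y p" "\<not> (E x p \<and> E x y)" using foundation[of p] p(1) x(1) by meson
  then show False using p x \<open>E x p\<close> by auto
qed

section \<open>Transfer to models on the natural numbers\<close>

lemma sat_bij:
  assumes g: "bij_betw g UNIV U" and nf: "funs L = {}"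
    and R: "\<And>r xs. r \<in> rels L \<Longrightarrow> length xs = rel_arity L r \<Longrightarrow> R' r xs \<longleftrightarrow> R r (map g xs)"
  shows "wf_fm L \<phi> \<Longrightarrow> sat U F R (\<lambda>i. g (e i)) \<phi> \<longleftrightarrow> sat UNIV F' R' e \<phi>"
proof (induction \<phi> arbitrary: e)
  case (Equal s t)
  then obtain i j where "s = Var i" "t = Var j" using wf_tm_no_funs[OF nf] by (meson wf_fm.simps(2))
  then show ?case using bij_betw_imp_inj_on[OF g] by (auto dest: injD)
next
  case (Rel r ts)
  then obtain ns where ns: "ts = map Var ns" using wf_tms_no_funs[OF nf] by (meson wf_fm.simps(3))
  then show ?case using R[of r "map e ns"] Rel by (simp add: comp_def)
next
  case (Forall \<phi>)
  have env: "(\<lambda>i. g (case_nat x e i)) = case_nat (g x) (\<lambda>i. g (e i))" for x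
    by (rule ext) (simp split: nat.split)
  have U: "U = range g" using g by (simp add: bij_betw_def)
  have "sat U F R (case_nat (g x) (\<lambda>i. g (e i))) \<phi> \<longleftrightarrow> sat UNIV F' R' (case_nat x e) \<phi>" for x
    using Forall.IH[of "case_nat x e"] Forall.prems unfolding env by simp
  then show ?case unfolding sat.simps U by simp
qed simp_all

text \<open>A Henkin countermodel lives on an infinite set of numbers. Enumerating this set moves
  the countermodel to the whole type, as the locale \<open>zf\<close> requires.\<close>

lemma ZFC_provesI:
  assumes wf: "wf_fm L_ZF \<phi>" and valid: "\<And>(E :: nat \<Rightarrow> nat \<Rightarrow> bool) e. zf E \<Longrightarrow> zf_sat E e \<phi>"
  shows "proves L_ZF ZFC \<phi>"
proof (rule ccontr)
  assume unprov: "\<not> proves L_ZF ZFC \<phi>"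
  let ?F = "\<lambda>_ _. undefined"
  have nf: "funs L_ZF = {}" by (simp add: L_ZF_def)
  obtain U :: "nat set" and R :: "zf_rel \<Rightarrow> nat list \<Rightarrow> bool" and e :: "nat \<Rightarrow> nat" where U: "U \<noteq> {}" and e: "range e \<subseteq> U"
    and sat: "\<And>\<gamma>. \<gamma> \<in> ZFC \<Longrightarrow> sat U ?F R e \<gamma>" and not_sat: "\<not> sat U ?F R e \<phi>"
  proof (rule completeness[OF nf _ wf unprov, where F = ?F])
    show "fv_fm \<gamma> = {} \<and> wf_fm L_ZF \<gamma>" if "\<gamma> \<in> ZFC" for \<gamma>
      using that ZFC_sentence ZFC_wf by simp
    fix U :: "nat set" and R :: "zf_rel \<Rightarrow> nat list \<Rightarrow> bool" and e :: "nat \<Rightarrow> nat"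
    assume "U \<noteq> {}" "range e \<subseteq> U" "\<And>\<gamma>. \<gamma> \<in> ZFC \<Longrightarrow> sat U ?F R e \<gamma>" "\<not> sat U ?F R e \<phi>"
    then show thesis by (rule that)
  qed
  have "infinite U" using U sat by (rule ZFC_carrier_infinite)
  then have g: "bij_betw (enumerate U) UNIV U" by (rule bij_enumerate)
  define E where "E x y = R Elem [enumerate U x, enumerate U y]" for x y
  define e' where "e' i = (SOME n. enumerate U n = e i)" for i
  have e': "enumerate U (e' i) = e i" for i
  proof -
    have "e i \<in> range (enumerate U)" unfolding bij_betw_imp_surj_on[OF g] using e by blast
    then have "\<exists>n. enumerate U n = e i" by (elim rangeE) (rule exI, erule sym)
    then show ?thesis unfolding e'_def by (rule someI_ex)
  qed
  have R: "E (xs ! 0) (xs ! 1) \<longleftrightarrow> R r (map (enumerate U) xs)"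
    if "r \<in> rels L_ZF" and len: "length xs = rel_arity L_ZF r" for r xs
  proof -
    obtain x y where "xs = [x, y]"
      using len by (auto simp: L_ZF_def numeral_eq_Suc length_Suc_conv)
    then show ?thesis by (cases r) (simp add: E_def)
  qed
  have eq: "sat U ?F R e \<psi> \<longleftrightarrow> zf_sat E e' \<psi>" if "wf_fm L_ZF \<psi>" for \<psi>
  proof -
    have "sat U ?F R (\<lambda>i. enumerate U (e' i)) \<psi> \<longleftrightarrow> sat UNIV ?F (\<lambda>_ xs. E (xs ! 0) (xs ! 1)) e' \<psi>"
      by (rule sat_bij[OF g nf, where R = R]) (rule R, assumption+, rule that)
    then show ?thesis unfolding e' zf_sat_def .
  qed
  have "zf E" by (rule zf_model) (use sat eq ZFC_wf in blast)
  then show False using valid[of E e'] not_sat eq[OF wf] by blast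
qed

lemma zf_sat_ForallU: "zf_sat E e (ForallU U \<phi>) \<longleftrightarrow> (\<forall>x. zf_sat E (case_nat x e) U \<longrightarrow> zf_sat E (case_nat x e) \<phi>)"
  by (simp add: ForallU_def)

lemma zf_sat_ExistsU: "zf_sat E e (ExistsU U \<phi>) \<longleftrightarrow> (\<exists>x. zf_sat E (case_nat x e) U \<and> zf_sat E (case_nat x e) \<phi>)"
  by (simp add: ExistsU_def)

lemma wf_ForallU [simp]: "wf_fm L (ForallU U \<phi>) \<longleftrightarrow> wf_fm L U \<and> wf_fm L \<phi>"
  by (simp add: ForallU_def)

lemma wf_ForallsU: "wf_fm L U \<Longrightarrow> wf_fm L \<phi> \<Longrightarrow> wf_fm L (ForallsU U n \<phi>)"
  by (induction n) (simp_all add: ForallsU_def)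

lemma wf_Conj: "(\<And>\<phi>. \<phi> \<in> set \<phi>s \<Longrightarrow> wf_fm L \<phi>) \<Longrightarrow> wf_fm L (Conj \<phi>s)"
  by (induction \<phi>s) (simp_all add: Conj_def)

lemma zf_sat_ForallsU: "(\<And>e. zf_sat E e \<phi>) \<Longrightarrow> zf_sat E e (ForallsU U n \<phi>)"
  by (induction n arbitrary: e) (simp_all add: ForallsU_def zf_sat_ForallU)

lemma eq_at_so_interp: "eq_at so_interp i j = (Var i \<^bold>= Var j)"
  by (simp add: eq_at_def so_interp_def)

lemma fv_so_SEP: "fv_fm \<phi> \<subseteq> {..<n + 1} \<Longrightarrow> fv_fm (so_SEP n \<phi>) = {}"
  by (auto simp: so_SEP_def fv_Foralls fv_fm_rename ForallO_def ExistsS_def ForallS_def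
      Ord_def SOrd_def mem_so_def split: nat.splits)

lemma fv_so_REP: "fv_fm \<phi> \<subseteq> {..<n + 2} \<Longrightarrow> fv_fm (so_REP n \<phi>) = {}"
  by (auto simp: so_REP_def fv_Foralls fv_fm_rename ForallO_def ExistsO_def ExistsS_def ForallS_def
      Ord_def SOrd_def mem_so_def split: nat.splits)

lemma SO_wf: "\<phi> \<in> SO \<Longrightarrow> wf_fm L_SO \<phi>"
  by (auto simp: SO_def so_SOR_def so_WO_def so_INF_def so_EXT_def so_INI_def so_BOU_def so_GPF_def
      so_SUR_def so_POW_def so_SEP_def so_REP_def ForallO_def ExistsO_def ExistsS_def ForallS_def
      Exists1O_def Ord_def SOrd_def mem_so_def less_so_def le_so_def G_def pair_less_def is_max_def Let_def L_SO_def numeral_eq_Suc)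

context zf
begin

lemma so_sat_SO: "\<phi> \<in> SO \<Longrightarrow> so_sat e \<phi>"
proof -
  \<comment> \<open>The schemes were verified for assignments with values in the structure; since
    the axioms are sentences, a constant assignment to \<open>zero\<close> suffices.\<close>
  have closed: "so_sat e \<phi>" if "so_sat (\<lambda>_. zero) \<phi>" "fv_fm \<phi> = {}" for \<phi>
    using that sat_cong[of \<phi> e "\<lambda>_. zero"] unfolding so_sat_def by blast
  have zero: "range (\<lambda>_ :: nat. zero) \<subseteq> objects" by (auto simp: objects_def)
  have "so_sat e (so_SEP n \<phi>)" if "wf_fm L_SO \<phi>" "fv_fm \<phi> \<subseteq> {..<n + 1}" for n \<phi>
    using closed[OF so_SEP[OF that(1) zero] fv_so_SEP[OF that(2)]] .
  moreover have "so_sat e (so_REP n \<phi>)" if "wf_fm L_SO \<phi>" "fv_fm \<phi> \<subseteq> {..<n + 2}" for n \<phi>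
    using closed[OF so_REP[OF that(1) zero] fv_so_REP[OF that(2)]] .
  ultimately show "\<phi> \<in> SO \<Longrightarrow> so_sat e \<phi>"
    unfolding SO_def using so_SOR so_WO so_INF so_EXT so_INI so_BOU so_GPF so_SUR so_POW by auto
qed

lemma zf_sat_SO: "\<phi> \<in> SO \<Longrightarrow> zf_sat E e (translate so_interp \<phi>)"
  by (simp add: zf_sat_translate SO_wf so_sat_SO)

text \<open>Uniqueness is immediate since equality is interpreted by itself; existence holds because
  \<open>gfun\<close> always yields an ordinal, an element of the universe.\<close>

lemma total_unique_so: "zf_sat E e (total_unique so_interp f n)"
  unfolding total_unique_def eq_at_so_interp
  by (rule zf_sat_ForallsU)
    (simp add: zf_sat_ForallU zf_sat_ExistsU fun_at_def so_interp_def)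

lemma eq_equivalence_so: "zf_sat E e (eq_equivalence so_interp)"
  unfolding eq_equivalence_def eq_at_so_interp
  by (simp add: zf_sat_ForallsU)

lemma respects_rel_so:
  assumes "r \<in> rels L_SO"
  shows "zf_sat E e (respects_rel so_interp r (rel_arity L_SO r))"
  unfolding respects_rel_def eq_at_so_interp
  by (rule zf_sat_ForallsU, cases r)
    (simp_all add: L_SO_def so_interp_def Conj_def numeral_eq_Suc)

lemma respects_fun_so: "zf_sat E e (respects_fun so_interp f (fun_arity L_SO f))"
  unfolding respects_fun_def eq_at_so_interp
  by (rule zf_sat_ForallsU)
    (simp add: fun_at_def L_SO_def so_interp_def Conj_def numeral_eq_Suc)

end

lemma definable_structure_so: "definable_structure L_ZF ZFC L_SO so_interp"
  unfolding definable_structure_def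
proof (intro conjI ballI)
  show "fv_fm (univ_fm so_interp) = {0}" by (simp add: so_interp_def)
  show "fv_fm (eq_fm so_interp) = {0, 1}" by (auto simp: so_interp_def)
  show "proves L_ZF ZFC (Exists (univ_fm so_interp))"
    by (rule ZFC_provesI) (auto simp: so_interp_def zf.zf_sat_ord zf.zf_sat_sord intro: zf.ord_zero)
  show "proves L_ZF ZFC (eq_equivalence so_interp)"
    by (rule ZFC_provesI[OF _ zf.eq_equivalence_so])
      (auto simp: eq_equivalence_def eq_at_so_interp intro!: wf_ForallsU)
  show "fv_fm (rel_fm so_interp r) = {..<rel_arity L_SO r}" for r
    by (cases r) (auto simp: so_interp_def L_SO_def)
  show "proves L_ZF ZFC (respects_rel so_interp r (rel_arity L_SO r))" if "r \<in> rels L_SO" for r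
    by (rule ZFC_provesI[OF _ zf.respects_rel_so[OF _ that]])
      (auto simp: respects_rel_def eq_at_so_interp intro!: wf_ForallsU wf_Conj)
  show "fv_fm (fun_fm so_interp f) = {..fun_arity L_SO f}" for f
    by (auto simp: so_interp_def L_SO_def)
  show "proves L_ZF ZFC (total_unique so_interp f (fun_arity L_SO f))" for f
    by (rule ZFC_provesI[OF _ zf.total_unique_so])
      (auto simp: total_unique_def eq_at_so_interp fun_at_def ExistsU_def intro!: wf_ForallsU)
  show "proves L_ZF ZFC (respects_fun so_interp f (fun_arity L_SO f))" for f
    by (rule ZFC_provesI[OF _ zf.respects_fun_so])
      (auto simp: respects_fun_def eq_at_so_interp fun_at_def intro!: wf_ForallsU wf_Conj)
qed simp_all

theorem theorem3: "interprets L_ZF ZFC L_SO SO"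
  unfolding interprets_def
proof (intro exI conjI ballI)
  show "definable_structure L_ZF ZFC L_SO so_interp" by (rule definable_structure_so)
  fix \<phi> assume "\<phi> \<in> SO"
  show "proves L_ZF ZFC (translate so_interp \<phi>)"
  proof (rule ZFC_provesI[OF wf_translate])
    fix E :: "nat \<Rightarrow> nat \<Rightarrow> bool" and e
    assume "zf E"
    show "zf_sat E e (translate so_interp \<phi>)"
      using zf.zf_sat_SO[OF \<open>zf E\<close> \<open>\<phi> \<in> SO\<close>] .
  qed
qed

end
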